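(* Let $\zeta_3$ be a primitive cube root of unity. Then \[\mathcal{O}_3(\zeta_3;q)=\overline{\mathcal B}_0(q^3)+q\mathcal B_1(q^3)+q^2\mathcal B_2(q^3),\] where \[\overline{\mathcal B}_0(q^3)=6q^{-36}m(q^{-27},q^{162},-1)-\frac32q^{-9}\frac{J_{18}J_{27}J_{108}J_{162}^5}{J_{36}^2J_{54}J_{81}J_{324}^3}\Bigl(\frac{j(q^{27};q^{162})}{j(-q^{27};q^{162})}+\frac{j(q^{81};q^{162})}{j(-q^{81};q^{162})}\Bigr)+\mathcal B_0(q^3)\] and, for $N=0,1,2$, \[ \begin{aligned} \mathcal B_N(q^3)&=3q^3\frac{J_6^3J_9J_{108}}{J_3J_{18}J_{36}}q^NI_N(q^3)+\frac{J_3^2J_6^2J_{36}}{J_{12}J_{18}^2}\Biggl(\frac{J_3^3J_{12}^2J_{18}^2J_{72}J_{108}^2}{J_6^4J_9J_{24}J_{36}J_{54}J_{216}}\sum_{\substack{k,l\in\{0,1,2\}\\k+l\equiv N\ (\mathrm{mod}\ 3)}}q^{k+l}g_k(q^3)W_l(q^3)\\ &\quad-2q^2\frac{J_{12}^2J_{108}}{J_6J_{24}}\Bigl((2AD-AE)\mathcal G_{N+1}-(BD+BE)\mathcal G_N+(2CE-CD)\mathcal G_{N+2}\Bigr)\\ &\quad+q^5\frac{J_3^3J_{18}J_{24}J_{36}^2J_{216}}{J_6^3J_9J_{12}J_{72}J_{108}}\sum_{\substack{k,l\in\{0,1,2\}\\k+l\equiv N+1\ (\mathrm{mod}\ 3)}}q^{k+l}h_k(q^3)W_l(q^3)\\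 &\quad-2q\frac{J_{24}J_{108}}{J_{12}}\Bigl((2AG+AF)\mathcal H_{N+2}-(2BF+BG)\mathcal H_{N+1}-(CG-CF)\mathcal H_N\Bigr)\Biggr). \end{aligned} \]
   Context: Let $q\in\mathbb{C}$ with $|q|<1$, $(x)_\infty=(x;q)_\infty=\prod_{k\ge0}(1-xq^k)$, $J_m=(q^m;q^m)_\infty$, and for a base $Q$ set $j(z;Q)=(z;Q)_\infty(Q/z;Q)_\infty(Q;Q)_\infty$. $\mathcal{O}_3(z;q)=\frac{(-q)_\infty}{(q)_\infty}\Bigl(1+2\sum_{n\ge1}\frac{(1-z)(1-z^{-1})(-1)^nq^{n^2+3n}}{(1-zq^{3n})(1-z^{-1}q^{3n})}\Bigr)$. Appell–Lerch series: $m(x,Q,z)=\frac{1}{j(z;Q)}\sum_{r\in\mathbb{Z}}\frac{(-1)^rQ^{\binom r2}z^r}{1-Q^{r-1}xz}$. Auxiliary functions (as functions of $q$; writing $F(q^3)$ means replacing $q$ by $q^3$ throughout, so $J_m\mapsto J_{3m}$): with $w(q)=\frac{J_1J_6^3}{J_2J_3^3}$, $W_0(q)=\frac{J_3^9}{J_1^{12}}\bigl(\frac1{w(q)^2}+8qw(q)+16q^2w(q)^4\bigr)$, $W_1(q)=\frac{J_3^9}{J_1^{12}}\bigl(\frac3{w(q)}+12qw(q)^2\bigr)$, $W_2(q)=9\frac{J_3^9}{J_1^{12}}$; $f_0(q)=\frac{j(q^7;q^{18})}{J_1J_2}$, $f_1(q)=-\frac{j(q^5;q^{18})}{J_1J_2}$,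 $f_2(q)=-q\frac{j(q;q^{18})}{J_1J_2}$; $g_0(q)=\frac{J_1J_2^2J_8^2J_{12}^2}{J_4^5J_{24}}$, $g_1(q)=\frac{J_2^7J_3J_8^2J_{12}^4}{J_1^2J_4^7J_6^3J_{24}}$, $g_2(q)=-2\frac{J_2^2J_6^2J_8^3}{J_3J_4^5}$; $h_0(q)=\frac{J_4^4J_6^2}{J_2J_3J_8^3}$, $h_1(q)=\frac{J_1J_4J_6J_{24}}{J_8^2J_{12}}$, $h_2(q)=-\frac{J_2^5J_3J_{12}J_{24}}{J_1^2J_4J_6^2J_8^2}$; $I_0(q)=\frac{J_2^2J_6^3}{J_4^6}$, $I_1(q)=q\frac{J_2^4J_{12}^6}{J_4^8J_6^3}$, $I_2(q)=-\frac{J_2^3J_{12}^3}{J_4^7}$. Further, $A=j(-q^{12};q^{27})$, $B=q\,j(-q^{21};q^{27})$, $C=q^2j(-q^3;q^{27})$, $D=\frac{j(q^{60};q^{108})}{j(-q^{30};q^{108})}$, $E=q^6\frac{j(q^{84};q^{108})}{j(-q^{42};q^{108})}$, $F=\frac{j(q^{24};q^{108})}{j(-q^{12};q^{108})}$, $G=q^{12}\frac{j(q^{96};q^{108})}{j(-q^{48};q^{108})}$, and for any integer $N$ (the value depending only on $N$ mod $3$) $\mathcal G_N=\sum_{k,l,m\in\{0,1,2\},\,k+l+m\equiv N\ (\mathrm{mod}\ 3)}q^{k+l+m}g_k(q^3)W_l(q^3)f_m(q^3)$ and $\mathcal H_N=\sum_{k,l,m\in\{0,1,2\},\,k+l+m\equiv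 N\ (\mathrm{mod}\ 3)}q^{k+l+m}h_k(q^3)W_l(q^3)f_m(q^3)$.
   Formalization: The display for B_N(q^3) is taken as the formula for q^N B_N(q^3), so B_N(q^3) is the displayed expression divided by q^N (for N=1,2 the literal identity is false, e.g. the coefficient of q would be 0 instead of 2); q is assumed nonzero. *)

theory Defs
  imports "HOL-Analysis.Analysis" "HOL-Number_Theory.Cong"
begin

definition primitive_root_of_unity :: "nat \<Rightarrow> complex \<Rightarrow> bool" where
  "primitive_root_of_unity n z \<longleftrightarrow> n > 0 \<and> z ^ n = 1 \<and> (\<forall>k. 0 < k \<and> k < n \<longrightarrow> z ^ k \<noteq> 1)"

definition qpoch_inf :: "complex \<Rightarrow> complex \<Rightarrow> complex" where
  "qpoch_inf x q = (\<Prod>k. 1 - x * q ^ k)"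

definition Jq :: "complex \<Rightarrow> nat \<Rightarrow> complex" where
  "Jq q m = qpoch_inf (q ^ m) (q ^ m)"

definition jtheta :: "complex \<Rightarrow> complex \<Rightarrow> complex" where
  "jtheta z Q = qpoch_inf z Q * qpoch_inf (Q / z) Q * qpoch_inf Q Q"

definition O3 :: "complex \<Rightarrow> complex \<Rightarrow> complex" where
  "O3 z q = qpoch_inf (- q) q / qpoch_inf q q *
     (1 + 2 * (\<Sum>\<^sub>\<infinity>n\<in>{1..}.
        (1 - z) * (1 - inverse z) * (- 1) ^ n * q ^ (n\<^sup>2 + 3 * n) /
        ((1 - z * q ^ (3 * n)) * (1 - inverse z * q ^ (3 * n)))))"

definition appell_m :: "complex \<Rightarrow> complex \<Rightarrow> complex \<Rightarrow> complex" where
  "appell_m x Q z = 1 / jtheta z Q *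
     (\<Sum>\<^sub>\<infinity>r\<in>(UNIV :: int set).
        (- 1) powi r * Q powi (r * (r - 1) div 2) * z powi r / (1 - Q powi (r - 1) * x * z))"

text \<open>
  The families below are functions of \<open>q\<close> whose index is meant to range over \<open>{0, 1, 2}\<close> only;
  \<open>F(q\<^sup>3)\<close> is rendered by passing \<open>q ^ 3\<close> as the argument.
\<close>

definition wq :: "complex \<Rightarrow> complex" where
  "wq q = Jq q 1 * Jq q 6 ^ 3 / (Jq q 2 * Jq q 3 ^ 3)"

definition Wq :: "complex \<Rightarrow> nat \<Rightarrow> complex" where
  "Wq q l =
     [Jq q 3 ^ 9 / Jq q 1 ^ 12 * (1 / wq q ^ 2 + 8 * q * wq q + 16 * q ^ 2 * wq q ^ 4),
      Jq q 3 ^ 9 / Jq q 1 ^ 12 * (3 / wq q + 12 * q * wq q ^ 2),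
      9 * (Jq q 3 ^ 9 / Jq q 1 ^ 12)] ! l"

definition fq :: "complex \<Rightarrow> nat \<Rightarrow> complex" where
  "fq q m =
     [jtheta (q ^ 7) (q ^ 18) / (Jq q 1 * Jq q 2),
      - (jtheta (q ^ 5) (q ^ 18) / (Jq q 1 * Jq q 2)),
      - q * (jtheta q (q ^ 18) / (Jq q 1 * Jq q 2))] ! m"

definition gq :: "complex \<Rightarrow> nat \<Rightarrow> complex" where
  "gq q k =
     [Jq q 1 * Jq q 2 ^ 2 * Jq q 8 ^ 2 * Jq q 12 ^ 2 / (Jq q 4 ^ 5 * Jq q 24),
      Jq q 2 ^ 7 * Jq q 3 * Jq q 8 ^ 2 * Jq q 12 ^ 4 /
        (Jq q 1 ^ 2 * Jq q 4 ^ 7 * Jq q 6 ^ 3 * Jq q 24),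
      - 2 * (Jq q 2 ^ 2 * Jq q 6 ^ 2 * Jq q 8 ^ 3 / (Jq q 3 * Jq q 4 ^ 5))] ! k"

definition hq :: "complex \<Rightarrow> nat \<Rightarrow> complex" where
  "hq q k =
     [Jq q 4 ^ 4 * Jq q 6 ^ 2 / (Jq q 2 * Jq q 3 * Jq q 8 ^ 3),
      Jq q 1 * Jq q 4 * Jq q 6 * Jq q 24 / (Jq q 8 ^ 2 * Jq q 12),
      - (Jq q 2 ^ 5 * Jq q 3 * Jq q 12 * Jq q 24 /
        (Jq q 1 ^ 2 * Jq q 4 * Jq q 6 ^ 2 * Jq q 8 ^ 2))] ! k"

definition Iq :: "complex \<Rightarrow> nat \<Rightarrow> complex" where
  "Iq q N =
     [Jq q 2 ^ 2 * Jq q 6 ^ 3 / Jq q 4 ^ 6,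
      q * (Jq q 2 ^ 4 * Jq q 12 ^ 6 / (Jq q 4 ^ 8 * Jq q 6 ^ 3)),
      - (Jq q 2 ^ 3 * Jq q 12 ^ 3 / Jq q 4 ^ 7)] ! N"

definition theta_A :: "complex \<Rightarrow> complex" where
  "theta_A q = jtheta (- (q ^ 12)) (q ^ 27)"

definition theta_B :: "complex \<Rightarrow> complex" where
  "theta_B q = q * jtheta (- (q ^ 21)) (q ^ 27)"

definition theta_C :: "complex \<Rightarrow> complex" where
  "theta_C q = q ^ 2 * jtheta (- (q ^ 3)) (q ^ 27)"

definition theta_D :: "complex \<Rightarrow> complex" where
  "theta_D q = jtheta (q ^ 60) (q ^ 108) / jtheta (- (q ^ 30)) (q ^ 108)"

definition theta_E :: "complex \<Rightarrow> complex" where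
  "theta_E q = q ^ 6 * (jtheta (q ^ 84) (q ^ 108) / jtheta (- (q ^ 42)) (q ^ 108))"

definition theta_F :: "complex \<Rightarrow> complex" where
  "theta_F q = jtheta (q ^ 24) (q ^ 108) / jtheta (- (q ^ 12)) (q ^ 108)"

definition theta_G :: "complex \<Rightarrow> complex" where
  "theta_G q = q ^ 12 * (jtheta (q ^ 96) (q ^ 108) / jtheta (- (q ^ 48)) (q ^ 108))"

definition idx2 :: "int \<Rightarrow> (nat \<times> nat) set" where
  "idx2 N = {(k, l). k \<in> {0, 1, 2} \<and> l \<in> {0, 1, 2} \<and> [int (k + l) = N] (mod 3)}"

definition idx3 :: "int \<Rightarrow> (nat \<times> nat \<times> nat) set" where
  "idx3 N = {(k, l, m). k \<in> {0, 1, 2} \<and> l \<in> {0, 1, 2} \<and> m \<in> {0, 1, 2} \<and>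
                        [int (k + l + m) = N] (mod 3)}"

definition calG :: "complex \<Rightarrow> int \<Rightarrow> complex" where
  "calG q N = (\<Sum>(k, l, m)\<in>idx3 N. q ^ (k + l + m) * gq (q ^ 3) k * Wq (q ^ 3) l * fq (q ^ 3) m)"

definition calH :: "complex \<Rightarrow> int \<Rightarrow> complex" where
  "calH q N = (\<Sum>(k, l, m)\<in>idx3 N. q ^ (k + l + m) * hq (q ^ 3) k * Wq (q ^ 3) l * fq (q ^ 3) m)"

text \<open>
  \<open>calB_term q N\<close> is \<open>q\<^sup>N \<B>\<^sub>N(q\<^sup>3)\<close>: as a power series in \<open>q\<close> it has only exponents
  congruent to \<open>N\<close> modulo 3, as witnessed by the factors \<open>q\<^sup>N I\<^sub>N(q\<^sup>3)\<close> and
  \<open>q ^ (k + l)\<close> with \<open>k + l \<equiv> N\<close>.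
  Hence it is only after division by \<open>q\<^sup>N\<close> that one gets a function of \<open>q\<^sup>3\<close>, the
  coefficient \<open>\<B>\<^sub>N(q\<^sup>3)\<close> of the 3-dissection. (Reading this expression as
  \<open>\<B>\<^sub>N(q\<^sup>3)\<close> itself would count \<open>q\<^sup>N\<close> twice in
  \<open>\<B>\<^sub>0(q\<^sup>3) + q \<B>\<^sub>1(q\<^sup>3) + q\<^sup>2 \<B>\<^sub>2(q\<^sup>3)\<close>, which is then false.) Both \<open>calB_cubed\<close> and
  \<open>calB0_bar_cubed\<close> take \<open>q\<close>, not \<open>q\<^sup>3\<close>, as their argument.
\<close>

definition calB_term :: "complex \<Rightarrow> nat \<Rightarrow> complex" where
  "calB_term q N =
     3 * q ^ 3 * (Jq q 6 ^ 3 * Jq q 9 * Jq q 108 / (Jq q 3 * Jq q 18 * Jq q 36)) * q ^ N * Iq (q ^ 3) N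
     + Jq q 3 ^ 2 * Jq q 6 ^ 2 * Jq q 36 / (Jq q 12 * Jq q 18 ^ 2) *
       (Jq q 3 ^ 3 * Jq q 12 ^ 2 * Jq q 18 ^ 2 * Jq q 72 * Jq q 108 ^ 2 /
          (Jq q 6 ^ 4 * Jq q 9 * Jq q 24 * Jq q 36 * Jq q 54 * Jq q 216) *
          (\<Sum>(k, l)\<in>idx2 (int N). q ^ (k + l) * gq (q ^ 3) k * Wq (q ^ 3) l)
        - 2 * q ^ 2 * (Jq q 12 ^ 2 * Jq q 108 / (Jq q 6 * Jq q 24)) *
          ((2 * theta_A q * theta_D q - theta_A q * theta_E q) * calG q (int N + 1)
           - (theta_B q * theta_D q + theta_B q * theta_E q) * calG q (int N)
           + (2 * theta_C q * theta_E q - theta_C q * theta_D q) * calG q (int N + 2))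
        + q ^ 5 * (Jq q 3 ^ 3 * Jq q 18 * Jq q 24 * Jq q 36 ^ 2 * Jq q 216 /
            (Jq q 6 ^ 3 * Jq q 9 * Jq q 12 * Jq q 72 * Jq q 108)) *
          (\<Sum>(k, l)\<in>idx2 (int N + 1). q ^ (k + l) * hq (q ^ 3) k * Wq (q ^ 3) l)
        - 2 * q * (Jq q 24 * Jq q 108 / Jq q 12) *
          ((2 * theta_A q * theta_G q + theta_A q * theta_F q) * calH q (int N + 2)
           - (2 * theta_B q * theta_F q + theta_B q * theta_G q) * calH q (int N + 1)
           - (theta_C q * theta_G q - theta_C q * theta_F q) * calH q (int N)))"

definition calB_cubed :: "complex \<Rightarrow> nat \<Rightarrow> complex" where
  "calB_cubed q N = calB_term q N / q ^ N"

definition calB0_bar_cubed :: "complex \<Rightarrow> complex" where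
  "calB0_bar_cubed q =
     6 * q powi (- 36) * appell_m (q powi (- 27)) (q ^ 162) (- 1)
     - 3 / 2 * q powi (- 9) *
       (Jq q 18 * Jq q 27 * Jq q 108 * Jq q 162 ^ 5 / (Jq q 36 ^ 2 * Jq q 54 * Jq q 81 * Jq q 324 ^ 3)) *
       (jtheta (q ^ 27) (q ^ 162) / jtheta (- (q ^ 27)) (q ^ 162)
        + jtheta (q ^ 81) (q ^ 162) / jtheta (- (q ^ 81)) (q ^ 162))
     + calB_cubed q 0"

end

theory Submission imports Defs "HOL-Library.Nat_Bijection"
begin

text \<open>
  Let \<open>y\<^sup>3 = \<zeta>\<close>. As a bilateral series, \<open>\<O>\<^sub>3(\<zeta>; q)\<close> has the denominators \<open>1 - \<zeta>q\<^bsup>3n\<^esup>\<close>, so by partial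
  fractions it is the average over \<open>Y \<in> {y, \<zeta>y, \<zeta>\<^sup>2y}\<close> of the series with denominators \<open>1 - Yq\<^sup>n\<close>.
  The change of parameter formula for Appell--Lerch sums writes each of these as \<open>m(qY\<^sup>2, q\<^sup>2, -1)\<close> plus a
  theta quotient. Averaging the \<open>m\<close> part gives a sum in \<open>q\<^bsup>6r-3\<^esup>\<close>; splitting \<open>r\<close> modulo 3 and changing parameters,
  first with base \<open>q\<close> and then with base \<open>q\<^sup>9\<close>, produces \<open>m(q\<^bsup>-27\<^esup>, q\<^bsup>162\<^esup>, -1)\<close> and the terms that carry \<open>I\<^sub>N\<close>.
  In the theta quotient the denominator is made a function of \<open>Y\<^sup>3 = \<zeta>\<close> by multiplying it with its two
  rotations; what is left above is a product of two theta expansions in powers of \<open>Y\<close>, and the average keeps the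
  exponents divisible by 3. The quintuple product turns the resulting theta values into \<open>D\<close>, \<open>E\<close>, \<open>F\<close>, \<open>G\<close>. Finally
  \<open>W\<^sub>l\<close>, \<open>f\<^sub>m\<close>, \<open>g\<^sub>k\<close>, \<open>h\<^sub>k\<close>, \<open>I\<^sub>N\<close> are the 3-dissections of five eta quotients, which follow
  from algebraic relations between \<open>t(q) = q w(q\<^sup>3)\<close>, \<open>t(q\<^sup>2)\<close> and \<open>t(q\<^sup>4)\<close>. Since \<open>\<O>\<^sub>3\<close> is the sum of the three components,
  only the sum over \<open>N\<close> of the stated \<open>\<B>\<^sub>N\<close> has to be matched.
\<close>

text \<open>The change of parameter has to end at a \<open>w\<close> that does not depend on
  \<open>Y\<close>. With \<open>w = -1\<close> the three rotated series share their numerators, so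
  averaging acts on the denominators alone and partial fractions apply a second time; moreover
  \<open>jtheta (- 1)\<close> is a nonzero eta quotient in every base that occurs. The theta
  quotient has no such normalisation: its denominator contains \<open>Y\<close> itself, and the
  rotated factors that repair this become the long products with A to G.

  All identities are between values at a fixed \<open>q\<close>. The triple product turns a product
  of two thetas into a double series over the integers, and a change of lattice basis that
  diagonalises the quadratic form turns the double series back into products. Every division needs a
  nonzero theta value. This is settled mostly by norms: \<open>Y\<close> has norm 1, and an argument
  of norm \<open>norm q ^ k\<close> cannot meet a zero in base \<open>q ^ n\<close> unless
  \<open>n\<close> divides \<open>k\<close>.

  Coefficients such as 2 and -1 in front of AD and AE have a single source,
  \<open>1 + \<omega> + \<omega> ^ 2 = 0\<close>: a sum of two conjugate products only sees
  differences of trisection components.\<close>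

section \<open>Triangular exponents and absolutely convergent theta series\<close>

definition tri :: "int \<Rightarrow> int" where "tri n = n * (n - 1) div 2"

text \<open>Index identities are mostly proved in doubled form: there \<open>div\<close> is gone and
  \<open>algebra_simps\<close> decides them.\<close>

lemma two_tri: "2 * tri n = n * (n - 1)"
  unfolding tri_def by (simp add: even_mult_iff)

lemma tri_eqI: "n * (n - 1) = 2 * m \<Longrightarrow> tri n = m"
  using two_tri[of n] by simp

lemma tri_add1: "tri (n + 1) = tri n + n"
  using two_tri[of n] by (intro tri_eqI) (simp add: algebra_simps)

lemma tri_1_add: "tri (1 + n) = tri n + n"
  using tri_add1[of n] by (simp add: add.commute)

lemma tri_diff1: "tri (n - 1) = tri n - n + 1"
  using tri_add1[of "n - 1"] by simp

lemma tri_minus: "tri (- n) = tri n + n"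
  using two_tri[of n] by (intro tri_eqI) (simp add: algebra_simps)

lemma tri_0 [simp]: "tri 0 = 0" and tri_1 [simp]: "tri 1 = 0"
  by (simp_all add: tri_def)

lemma minus1_powi_add_self [simp]: "(- 1 :: complex) powi n * (- 1) powi n = 1"
  by (simp flip: power_int_mult_distrib)

lemma norm_minus1_powi [simp]: "norm ((- 1 :: complex) powi n) = 1"
  by (simp add: norm_power_int)

text \<open>The quotient of consecutive terms is \<open>a ^ n * b\<close>, which tends to 0 however
  large \<open>b\<close> is.\<close>

lemma summable_tri:
  fixes a b :: real
  assumes "0 < a" "a < 1" "0 < b"
  shows "summable (\<lambda>n. a powi tri (int n) * b ^ n)"
proof -
  have "(\<lambda>n. a ^ n * b) \<longlonglongrightarrow> 0 * b"
    by (intro tendsto_intros LIMSEQ_power_zero) (use assms in auto)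
  then have "eventually (\<lambda>n. a ^ n * b < 1 / 2) sequentially"
    by (rule order_tendstoD) simp
  then obtain N where N: "\<And>n. n \<ge> N \<Longrightarrow> a ^ n * b < 1 / 2"
    by (auto simp: eventually_sequentially)
  show ?thesis
  proof (rule summable_ratio_test)
    fix n assume "N \<le> n"
    have "a powi tri (int (Suc n)) * b ^ Suc n = (a ^ n * b) * (a powi tri (int n) * b ^ n)"
      using assms by (simp add: tri_add1 power_int_add add.commute[of 1])
    also have "norm \<dots> \<le> 1 / 2 * norm (a powi tri (int n) * b ^ n)"
      unfolding norm_mult[of "a ^ n * b"] using N[OF \<open>N \<le> n\<close>] assms by (intro mult_right_mono) auto
    finally show "norm (a powi tri (int (Suc n)) * b ^ Suc n) \<le> 1 / 2 * norm (a powi tri (int n) * b ^ n)" .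
  qed simp
qed

lemma summable_on_int_split:
  fixes f :: "int \<Rightarrow> real"
  assumes "\<And>n. 0 \<le> f n" "summable (\<lambda>n. f (int n))" "summable (\<lambda>n. f (- int n))"
  shows "f summable_on UNIV"
proof -
  have 1: "f summable_on range int"
    by (subst summable_on_reindex) (use assms in \<open>auto intro!: norm_summable_imp_summable_on simp: o_def\<close>)
  have 2: "f summable_on range (\<lambda>n. - int n)"
    by (subst summable_on_reindex) (use assms in \<open>auto intro!: norm_summable_imp_summable_on simp: o_def inj_def\<close>)
  have "(UNIV :: int set) = range int \<union> range (\<lambda>n. - int n)"
    by (auto simp: image_iff) (metis int_cases2)
  then show ?thesis using summable_on_union[OF 1 2] by simp
qed

lemma summable_on_tri:
  fixes a b :: real
  assumes "0 < a" "a < 1" "0 < b"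
  shows "(\<lambda>n::int. a powi tri n * b powi n) summable_on UNIV"
proof (rule summable_on_int_split)
  show "summable (\<lambda>n. a powi tri (- int n) * b powi - int n)"
    using summable_tri[of a "a / b"] assms
    by (simp add: tri_minus power_int_add power_divide power_int_minus field_simps)
qed (use assms summable_tri in auto)

lemma abs_summable_theta_bdd:
  fixes Q z :: complex
  assumes "Q \<noteq> 0" "norm Q < 1" "z \<noteq> 0" and "\<And>n. norm (c n) \<le> B"
  shows "(\<lambda>n::int. norm (c n * (Q powi tri n * z powi n))) summable_on UNIV"
proof (rule summable_on_comparison_test)
  show "(\<lambda>n. B * (norm Q powi tri n * norm z powi n)) summable_on UNIV"
    using assms by (intro summable_on_cmult_right summable_on_tri) auto
qed (use assms in \<open>auto simp: norm_mult norm_power_int intro!: mult_right_mono\<close>)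

definition theta_term :: "complex \<Rightarrow> complex \<Rightarrow> int \<Rightarrow> complex" where
  "theta_term z Q n = (- 1) powi n * Q powi tri n * z powi n"

lemma abs_summable_theta:
  assumes "Q \<noteq> 0" "norm Q < 1" "z \<noteq> 0"
  shows "(\<lambda>n. norm (theta_term z Q n)) summable_on UNIV"
  using abs_summable_theta_bdd[OF assms, of "\<lambda>n. (- 1) powi n" 1]
  by (simp add: theta_term_def mult.assoc)

lemma summable_theta:
  assumes "Q \<noteq> 0" "norm Q < 1" "z \<noteq> 0"
  shows "theta_term z Q summable_on UNIV"
  using abs_summable_summable[OF abs_summable_theta[OF assms]] .

text \<open>Dominated convergence for series over the integers, for the passage from the finite to
  the infinite triple product. The enumeration \<open>int_decode\<close> turns both series into
  ordinary ones.\<close>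

lemma tannery_int:
  fixes a :: "int \<Rightarrow> nat \<Rightarrow> complex"
  assumes "\<And>k. (\<lambda>n. a k n) \<longlonglongrightarrow> b k" "\<And>k n. norm (a k n) \<le> M k" "M summable_on UNIV"
  shows "(\<lambda>n. \<Sum>\<^sub>\<infinity>k. a k n) \<longlonglongrightarrow> (\<Sum>\<^sub>\<infinity>k. b k)"
proof -
  have bij: "bij_betw int_decode UNIV UNIV" by (rule bij_int_decode)
  have M: "(\<lambda>k. M (int_decode k)) summable_on UNIV"
    using summable_on_reindex_bij_betw[OF bij, of M] assms(3) by simp
  have sumM: "summable (\<lambda>k. M (int_decode k))"
    using summable_on_imp_summable[OF M] .
  have nb: "norm (b k) \<le> M k" for k
    using assms(1)[of k] assms(2)[of k] by (intro LIMSEQ_le_const2[OF tendsto_norm]) auto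
  have conv: "infsum g UNIV = suminf (\<lambda>k. g (int_decode k))"
    if g: "\<And>k. norm (g k) \<le> M k" for g :: "int \<Rightarrow> complex"
  proof -
    have sg: "summable (\<lambda>k. norm (g (int_decode k)))"
      by (rule summable_comparison_test[OF _ sumM]) (use g in auto)
    then have "((\<lambda>k. g (int_decode k)) has_sum suminf (\<lambda>k. g (int_decode k))) UNIV"
      by (rule norm_summable_imp_has_sum) (simp_all add: sg summable_norm_cancel[OF sg] summable_sums)
    then show ?thesis
      using infsum_reindex_bij_betw[OF bij, of g] by (simp add: infsumI)
  qed
  have "(\<lambda>n. suminf (\<lambda>k. a (int_decode k) n)) \<longlonglongrightarrow> suminf (\<lambda>k. b (int_decode k))"
    by (rule conjunct2[OF conjunct2[OF tannerys_theorem[where M = "\<lambda>k. M (int_decode k)"]]])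
       (use assms sumM in \<open>auto intro!: always_eventually\<close>)
  then show ?thesis using conv[of "\<lambda>k. a k n" for n] conv[of b] assms(2) nb by simp
qed

subsection \<open>Infinite products\<close>

lemma qpoch_convergent:
  fixes x q :: complex
  assumes "norm q < 1"
  shows "convergent_prod (\<lambda>k. 1 - x * q ^ k)"
proof -
  have "summable (\<lambda>k. norm (1 - x * q ^ k - 1))"
    using assms by (auto simp: norm_mult norm_power intro!: summable_mult summable_geometric)
  then show ?thesis
    by (intro abs_convergent_prod_imp_convergent_prod summable_imp_abs_convergent_prod)
qed

lemma qpoch_LIMSEQ:
  assumes "norm q < 1"
  shows "(\<lambda>n. \<Prod>k<n. 1 - x * q ^ k) \<longlonglongrightarrow> qpoch_inf x q"
  using convergent_prod_LIMSEQ[OF qpoch_convergent[OF assms]]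
  unfolding qpoch_inf_def by (rule LIMSEQ_lessThan_iff_atMost[THEN iffD2])

lemma qpoch_nonzero:
  assumes "norm q < 1" "\<And>k. x * q ^ k \<noteq> 1"
  shows "qpoch_inf x q \<noteq> 0"
  unfolding qpoch_inf_def using assms
  by (intro prodinf_nonzero qpoch_convergent) auto

lemma qpoch_Suc:
  assumes "norm q < 1"
  shows "qpoch_inf x q = (1 - x) * qpoch_inf (x * q) q"
proof -
  have "(\<lambda>n. \<Prod>k<Suc n. 1 - x * q ^ k) \<longlonglongrightarrow> qpoch_inf x q"
    using qpoch_LIMSEQ[OF assms] by (rule LIMSEQ_Suc)
  moreover have "(\<Prod>k<Suc n. 1 - x * q ^ k) = (1 - x) * (\<Prod>k<n. 1 - x * q * q ^ k)" for n
    by (subst prod.lessThan_Suc_shift) (simp add: mult.assoc)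
  ultimately have "(\<lambda>n. (1 - x) * (\<Prod>k<n. 1 - x * q * q ^ k)) \<longlonglongrightarrow> qpoch_inf x q" by simp
  moreover have "(\<lambda>n. (1 - x) * (\<Prod>k<n. 1 - x * q * q ^ k)) \<longlonglongrightarrow> (1 - x) * qpoch_inf (x * q) q"
    by (intro tendsto_intros qpoch_LIMSEQ assms)
  ultimately show ?thesis by (rule LIMSEQ_unique)
qed

section \<open>The triple product, from its finite form\<close>

definition pfin :: "complex \<Rightarrow> nat \<Rightarrow> complex" where "pfin q m = (\<Prod>i<m. 1 - q * q ^ i)"

text \<open>The reciprocal is extended by zero to negative indices, which makes the recurrence below
  hold for all integers and removes all boundary cases from the finite triple product.\<close>
definition rfin :: "complex \<Rightarrow> int \<Rightarrow> complex" where
  "rfin q m = (if m < 0 then 0 else 1 / pfin q (nat m))"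

lemma power_neq_1:
  fixes q :: complex
  assumes "norm q < 1" "n > 0"
  shows "q ^ n \<noteq> 1"
  using assms power_less_one_iff[of "norm q" n] by (auto simp flip: norm_power)

lemma pfin_nonzero: "norm q < 1 \<Longrightarrow> pfin q m \<noteq> 0"
  using power_neq_1[of q] by (auto simp: pfin_def simp flip: power_Suc)

lemma rfin_rec:
  assumes "norm q < 1" "q \<noteq> 0"
  shows "rfin q m = (1 - q powi (m + 1)) * rfin q (m + 1)"
proof -
  have "m < -1 \<or> m = -1 \<or> m \<ge> 0" by linarith
  then consider "m < -1" | "m = -1" | k where "m = int k" using nonneg_int_cases by blast
  then show ?thesis
  proof cases
    case 3
    have "pfin q (nat (int k + 1)) = pfin q k * (1 - q * q ^ k)"
      by (simp add: pfin_def nat_add_distrib)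
    moreover have "q powi (int k + 1) = q * q ^ k" using assms by (simp add: power_int_add)
    ultimately show ?thesis using 3 pfin_nonzero[OF assms(1), of "Suc k"]
      by (simp add: rfin_def pfin_def)
  qed (auto simp: rfin_def)
qed

text \<open>The Gaussian binomial coefficient "2n choose n + k" in base \<open>q\<close>, which is
  zero outside the range of \<open>k\<close>.\<close>

definition fcoef :: "complex \<Rightarrow> nat \<Rightarrow> int \<Rightarrow> complex" where
  "fcoef q n k = pfin q (2 * n) * rfin q (int n - k) * rfin q (int n + k)"

text \<open>The \<open>q\<close>-Pascal rule applied twice, arranged in the way in which
  multiplication by \<open>(1 - z q^n)(1 - q^(n+1)/z) = 1 + q^(2n+1) - z q^n - q^(n+1)/z\<close>
  acts on coefficients.\<close>

lemma fcoef_rec: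
  assumes "norm q < 1" "q \<noteq> 0"
  shows "fcoef q (Suc n) k = (1 + q ^ (2 * n + 1)) * fcoef q n k
     + q powi (int n + 1 - k) * fcoef q n (k - 1) + q powi (int n + 1 + k) * fcoef q n (k + 1)"
proof -
  \<comment> \<open>The reciprocals are all pulled back to the two of largest index,
    \<open>X\<close> and \<open>Y\<close>. With \<open>a * b = q ^ (2 * n)\<close> what remains is a
    polynomial identity in \<open>q\<close>, \<open>a\<close>, \<open>b\<close>.\<close>
  define X where "X = rfin q (int n + 1 - k)"
  define Y where "Y = rfin q (int n + 1 + k)"
  define a where "a = q powi (int n - k)"
  define b where "b = q powi (int n + k)"
  have a1: "q powi (int n + 1 - k) = q * a" "q powi (int n + 1 + k) = q * b"
    using assms by (simp_all add: a_def b_def power_int_add power_int_diff)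
  have ab: "a * b = q ^ (2 * n)"
    using assms by (simp add: a_def b_def power_int_add power_int_diff mult_2 power_add)
  have r: "rfin q (int n - k) = (1 - q * a) * X" "rfin q (int n + k) = (1 - q * b) * Y"
    using rfin_rec[OF assms, of "int n - k"] rfin_rec[OF assms, of "int n + k"] a1
    by (simp_all add: X_def Y_def algebra_simps)
  have e: "int n - (k - 1) = int n + 1 - k" "int n + (k + 1) = int n + 1 + k"
     "int (Suc n) - k = int n + 1 - k" "int (Suc n) + k = int n + 1 + k"
     "int n - (k + 1) + 1 = int n - k" "int n + (k - 1) + 1 = int n + k" by simp_all
  have r2: "rfin q (int n - (k + 1)) = (1 - a) * ((1 - q * a) * X)"
    "rfin q (int n + (k - 1)) = (1 - b) * ((1 - q * b) * Y)"
    using rfin_rec[OF assms, of "int n - (k + 1)"] rfin_rec[OF assms, of "int n + (k - 1)"]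
    unfolding e r a_def b_def by simp_all
  have P: "pfin q (2 * Suc n) = pfin q (2 * n) * (1 - q * (a * b)) * (1 - q * (q * (a * b)))"
    by (simp add: pfin_def ab)
  show ?thesis
    unfolding fcoef_def e r r2 P a1 X_def[symmetric] Y_def[symmetric] power_add power_one_right ab[symmetric]
    by (simp add: algebra_simps)
qed

lemma fcoef_eq_0: "\<bar>k\<bar> > int n \<Longrightarrow> fcoef q n k = 0"
  by (auto simp: fcoef_def rfin_def)

lemma pfin_LIMSEQ: "norm q < 1 \<Longrightarrow> pfin q \<longlonglongrightarrow> qpoch_inf q q"
  using qpoch_LIMSEQ[of q q] by (simp add: pfin_def[abs_def])

lemma qpoch_self_nonzero:
  assumes "norm q < 1"
  shows "qpoch_inf q q \<noteq> 0"
  using power_neq_1[OF assms] by (intro qpoch_nonzero assms) (auto simp flip: power_Suc)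

text \<open>The support is finite, but summing over all integers makes the index shifts of the
  induction step bijections and prepares the limit.\<close>

lemma finite_triple_product:
  assumes "norm q < 1" "q \<noteq> 0" "z \<noteq> 0"
  shows "((\<lambda>k. fcoef q n k * theta_term z q k) has_sum
           (\<Prod>k<n. (1 - z * q ^ k) * (1 - q / z * q ^ k))) UNIV"
proof (induction n)
  case 0
  have "((\<lambda>k. fcoef q 0 k * theta_term z q k) has_sum (\<Sum>k\<in>{0}. fcoef q 0 k * theta_term z q k)) UNIV"
    by (rule has_sum_finite_neutralI[of "{0}"]) (auto simp: fcoef_eq_0)
  then show ?case by (simp add: fcoef_def rfin_def pfin_def theta_term_def)
next
  case (Suc n)
  define a where "a k = fcoef q n k * theta_term z q k" for k
  define P where "P = (\<Prod>k<n. (1 - z * q ^ k) * (1 - q / z * q ^ k))"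
  have A: "(a has_sum P) UNIV" using Suc.IH by (simp add: a_def[abs_def] P_def)
  have A1: "((\<lambda>k. a (k - 1)) has_sum P) UNIV"
    using has_sum_reindex_bij_betw[of "\<lambda>k. k - 1" UNIV UNIV a P] A
    by (simp add: bij_betwI[where g = "\<lambda>k. k + 1"])
  have A2: "((\<lambda>k. a (k + 1)) has_sum P) UNIV"
    using has_sum_reindex_bij_betw[of "\<lambda>k. k + 1" UNIV UNIV a P] A
    by (simp add: bij_betwI[where g = "\<lambda>k. k - 1"])
  have "((\<lambda>k. (1 + q ^ (2 * n + 1)) * a k + ((- z * q ^ n) * a (k - 1) + (- (q ^ (n + 1)) / z) * a (k + 1)))
      has_sum ((1 + q ^ (2 * n + 1)) * P + ((- z * q ^ n) * P + (- (q ^ (n + 1)) / z) * P))) UNIV"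
    by (intro has_sum_add has_sum_cmult_right A A1 A2)
  moreover have "fcoef q (Suc n) k * theta_term z q k =
     (1 + q ^ (2 * n + 1)) * a k + ((- z * q ^ n) * a (k - 1) + (- (q ^ (n + 1)) / z) * a (k + 1))" for k
  proof -
    \<comment> \<open>The power of \<open>q\<close> in the recurrence is exactly what moves a theta
      term to the neighbouring index.\<close>
    have t1: "q powi (int n + 1 - k) * theta_term z q k = (- z * q ^ n) * theta_term z q (k - 1)"
      using assms by (simp add: theta_term_def tri_diff1 power_int_diff power_int_add field_simps)
    have t2: "q powi (int n + 1 + k) * theta_term z q k = (- (q ^ (n + 1)) / z) * theta_term z q (k + 1)"
      using assms by (simp add: theta_term_def tri_add1 tri_1_add power_int_add field_simps)
    have "fcoef q (Suc n) k * theta_term z q k = (1 + q ^ (2 * n + 1)) * (fcoef q n k * theta_term z q k)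
        + fcoef q n (k - 1) * (q powi (int n + 1 - k) * theta_term z q k)
        + fcoef q n (k + 1) * (q powi (int n + 1 + k) * theta_term z q k)"
      unfolding fcoef_rec[OF assms(1,2)] by (simp add: algebra_simps)
    then show ?thesis unfolding t1 t2 a_def by (simp add: mult_ac)
  qed
  moreover have "(1 + q ^ (2 * n + 1)) * P + ((- z * q ^ n) * P + (- (q ^ (n + 1)) / z) * P) =
     P * ((1 - z * q ^ n) * (1 - q / z * q ^ n))"
    using assms by (simp add: field_simps power_add mult_2_right)
  ultimately show ?case by (simp add: P_def)
qed

text \<open>For fixed \<open>k\<close> the Gaussian binomial tends to \<open>1 / E\<close>, and it
  is bounded uniformly in \<open>n\<close> and \<open>k\<close>; dominated convergence then gives
  the limit of the finite identity.\<close>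

theorem jacobi_triple_product:
  assumes "q \<noteq> 0" "norm q < 1" "z \<noteq> 0"
  shows "jtheta z q = (\<Sum>\<^sub>\<infinity>n. theta_term z q n)"
proof -
  define E where "E = qpoch_inf q q"
  have E: "E \<noteq> 0" using qpoch_self_nonzero assms by (simp add: E_def)
  have pl: "pfin q \<longlonglongrightarrow> E" using pfin_LIMSEQ assms by (simp add: E_def)
  have rl: "(\<lambda>n. rfin q (int n)) \<longlonglongrightarrow> 1 / E"
    using E by (auto simp: rfin_def intro!: tendsto_intros pl)
  obtain B where B: "\<And>n. norm (pfin q n) \<le> B"
    using convergent_imp_Bseq[OF convergentI[OF pl]] by (auto simp: Bseq_def)
  obtain C where C: "\<And>n. norm (rfin q (int n)) \<le> C"
    using convergent_imp_Bseq[OF convergentI[OF rl]] by (auto simp: Bseq_def)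
  have B0: "B \<ge> 0" and C0: "C \<ge> 0" using norm_ge_zero B C order_trans by blast+
  have C': "norm (rfin q m) \<le> C" for m
    using C[of "nat m"] C0 by (cases "m < 0") (auto simp: rfin_def)
  \<comment> \<open>Negative indices occur only for finitely many \<open>n\<close>, so passing
    through \<open>nat\<close> does not affect the limit.\<close>
  have shift: "(\<lambda>n. rfin q (int n + k)) \<longlonglongrightarrow> 1 / E" for k
  proof -
    have "filterlim (\<lambda>n. nat (int n + k)) at_top sequentially"
      unfolding filterlim_at_top
    proof
      fix Z show "\<forall>\<^sub>F n in sequentially. Z \<le> nat (int n + k)"
        using eventually_ge_at_top[of "Z + nat (- k)"] by eventually_elim linarith
    qed
    then have "(\<lambda>n. rfin q (int (nat (int n + k)))) \<longlonglongrightarrow> 1 / E"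
      by (rule filterlim_compose[OF rl])
    moreover have "eventually (\<lambda>n. rfin q (int (nat (int n + k))) = rfin q (int n + k)) sequentially"
      by (auto simp: eventually_sequentially intro!: exI[of _ "nat (- k)"])
    ultimately show ?thesis by (rule Lim_transform_eventually)
  qed
  have cl: "(\<lambda>n. fcoef q n k * theta_term z q k) \<longlonglongrightarrow> 1 / E * theta_term z q k" for k
  proof -
    have "(\<lambda>n. pfin q (2 * n)) \<longlonglongrightarrow> E"
      using LIMSEQ_subseq_LIMSEQ[OF pl, of "\<lambda>n. 2 * n"] by (simp add: strict_mono_def o_def)
    then have "(\<lambda>n. pfin q (2 * n) * rfin q (int n + - k) * rfin q (int n + k) * theta_term z q k)
        \<longlonglongrightarrow> E * (1 / E) * (1 / E) * theta_term z q k"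
      by (intro tendsto_mult shift tendsto_const)
    then show ?thesis using E by (simp add: fcoef_def)
  qed
  have bd: "norm (fcoef q n k * theta_term z q k) \<le> B * C * C * norm (theta_term z q k)" for n k
    unfolding fcoef_def norm_mult
    by (intro mult_mono mult_nonneg_nonneg B C') (use B0 C0 in auto)
  have "(\<lambda>n. \<Sum>\<^sub>\<infinity>k. fcoef q n k * theta_term z q k) \<longlonglongrightarrow> (\<Sum>\<^sub>\<infinity>k. 1 / E * theta_term z q k)"
    using abs_summable_theta[OF assms]
    by (intro tannery_int[where M = "\<lambda>k. B * C * C * norm (theta_term z q k)"] cl bd summable_on_cmult_right)
  then have "(\<lambda>n. (\<Prod>k<n. 1 - z * q ^ k) * (\<Prod>k<n. 1 - q / z * q ^ k)) \<longlonglongrightarrow> 1 / E * (\<Sum>\<^sub>\<infinity>k. theta_term z q k)"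
    unfolding infsumI[OF finite_triple_product[OF assms(2,1,3)]] prod.distrib infsum_cmult_right' .
  moreover have "(\<lambda>n. (\<Prod>k<n. 1 - z * q ^ k) * (\<Prod>k<n. 1 - q / z * q ^ k)) \<longlonglongrightarrow> qpoch_inf z q * qpoch_inf (q / z) q"
    by (intro tendsto_mult qpoch_LIMSEQ assms)
  ultimately have "qpoch_inf z q * qpoch_inf (q / z) q = 1 / E * (\<Sum>\<^sub>\<infinity>k. theta_term z q k)"
    using LIMSEQ_unique by blast
  then show ?thesis using E by (simp add: jtheta_def E_def)
qed

subsection \<open>Theta functions\<close>

lemma jtheta_flip: "Q \<noteq> 0 \<Longrightarrow> z \<noteq> 0 \<Longrightarrow> jtheta (Q / z) Q = jtheta z Q"
  by (simp add: jtheta_def)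

lemma jtheta_shift:
  assumes "Q \<noteq> 0" "norm Q < 1" "z \<noteq> 0"
  shows "jtheta (Q * z) Q = - jtheta z Q / z"
proof -
  have "qpoch_inf z Q = (1 - z) * qpoch_inf (Q * z) Q" "qpoch_inf (1 / z) Q = (1 - 1 / z) * qpoch_inf (Q / z) Q"
    using qpoch_Suc[OF assms(2), of z] qpoch_Suc[OF assms(2), of "1 / z"] by (simp_all add: mult.commute)
  moreover have "Q / (Q * z) = 1 / z" using assms by simp
  ultimately show ?thesis unfolding jtheta_def using assms by (simp only:) (simp add: field_simps)
qed

lemma jtheta_inverse:
  assumes "Q \<noteq> 0" "norm Q < 1" "z \<noteq> 0"
  shows "jtheta (1 / z) Q = - jtheta z Q / z"
  using jtheta_shift[OF assms] jtheta_flip[of Q "Q * z"] assms by simp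

lemma jtheta_1 [simp]: "norm Q < 1 \<Longrightarrow> jtheta 1 Q = 0"
  using qpoch_Suc[of Q 1] by (simp add: jtheta_def)

section \<open>Regrouping theta series and their products\<close>

lemma summable_on_int_product:
  fixes f g :: "int \<Rightarrow> complex"
  assumes "f summable_on UNIV" "g summable_on UNIV"
  shows "(\<lambda>(n, m). f n * g m) summable_on UNIV"
    and "infsum f UNIV * infsum g UNIV = (\<Sum>\<^sub>\<infinity>(n, m). f n * g m)"
proof -
  have f: "(\<lambda>x. norm (f x)) summable_on UNIV" and g: "(\<lambda>x. norm (g x)) summable_on UNIV"
    using assms by (simp_all add: summable_on_iff_abs_summable_on_complex)
  have "(\<lambda>x. norm ((\<lambda>(n, m). f n * g m) x)) summable_on (UNIV \<times> UNIV)"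
    by (rule iffD2[OF Infinite_Sum.abs_summable_on_Sigma_iff])
       (use f g in \<open>auto simp: norm_mult infsum_cmult_right' abs_mult infsum_nonneg intro!: summable_on_cmult_right summable_on_cmult_left\<close>)
  then show s: "(\<lambda>(n, m). f n * g m) summable_on UNIV"
    using abs_summable_summable by force
  have "(\<Sum>\<^sub>\<infinity>(n, m)\<in>UNIV \<times> UNIV. f n * g m) = (\<Sum>\<^sub>\<infinity>n. \<Sum>\<^sub>\<infinity>m. f n * g m)"
    using infsum_Sigma_banach[of "\<lambda>(n, m). f n * g m" UNIV "\<lambda>_. UNIV"] s by simp
  then show "infsum f UNIV * infsum g UNIV = (\<Sum>\<^sub>\<infinity>(n, m). f n * g m)"
    by (simp add: infsum_cmult_right' infsum_cmult_left')
qed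

text \<open>The bijection says that the sheets \<open>h s\<close> cover the index set once.
  Dissections by residue classes and by cosets of a sublattice both go through this.\<close>

lemma infsum_residue_split:
  fixes F :: "'a \<Rightarrow> complex" and h :: "nat \<Rightarrow> 'b \<Rightarrow> 'a"
  assumes "bij_betw (\<lambda>(s, p). h s p) ({..<N} \<times> UNIV) UNIV" and "F summable_on UNIV"
  shows "infsum F UNIV = (\<Sum>s<N. \<Sum>\<^sub>\<infinity>p. F (h s p))"
proof -
  have "(\<lambda>(s, p). F (h s p)) summable_on ({..<N} \<times> UNIV)"
    using summable_on_reindex_bij_betw[OF assms(1), of F] assms(2) by (simp add: case_prod_unfold)
  from infsum_Sigma_banach[OF this] show ?thesis
    using infsum_reindex_bij_betw[OF assms(1), of F] by (simp add: case_prod_unfold)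
qed

lemma bij_residue: "bij_betw (\<lambda>(s, k). 3 * k + int s) ({..<3::nat} \<times> UNIV) UNIV"
  by (rule bij_betwI[where g = "\<lambda>n. (nat (n mod 3), n div 3)"]) (auto simp: nat_less_iff)

text \<open>Counting residues downwards turns \<open>6 * r - 3\<close> at
  \<open>r = 3 * k - s\<close> into \<open>18 * (k - 1) + (15 - 6 * s)\<close>: a Lerch denominator
  with the natural exponents 15, 9, 3.\<close>

lemma bij_residue_minus: "bij_betw (\<lambda>(s, k). 3 * k - int s) ({..<3::nat} \<times> UNIV) UNIV"
proof (rule bij_betwI[where g = "\<lambda>n. (nat ((- n) mod 3), - ((- n) div 3))"])
  fix p :: "nat \<times> int" assume "p \<in> {..<3} \<times> UNIV"
  then obtain s k where p: "p = (s, k)" "s < 3" by (cases p) auto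
  have "- (3 * k - int s) = int s + 3 * (- k)" by simp
  then show "(nat ((- (case p of (s, k) \<Rightarrow> 3 * k - int s)) mod 3), - ((- (case p of (s, k) \<Rightarrow> 3 * k - int s)) div 3)) = p"
    using p by (simp only: p prod.case mod_mult_self2 div_mult_self2 mod_pos_pos_trivial div_pos_pos_trivial of_nat_0_le_iff of_nat_less_numeral_iff) auto
qed (auto simp: nat_less_iff, presburger)

text \<open>With \<open>n = k + l + s\<close> and \<open>m = k - l\<close> the form
  \<open>n^2 + m^2\<close> becomes \<open>2 k^2 + 2 l^2\<close> up to lower order terms. The sheet
  \<open>s\<close> is the parity of \<open>n - m\<close>.\<close>

lemma bij_parity: "bij_betw (\<lambda>(s, (k, l)). (k + l + int s, k - l)) ({..<2::nat} \<times> UNIV) UNIV"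
proof (rule bij_betwI[where g = "\<lambda>(n, m). (nat ((n - m) mod 2), (m + (n - m) div 2, (n - m) div 2))"])
  fix p :: "nat \<times> int \<times> int" assume "p \<in> {..<2} \<times> UNIV"
  then obtain s k l where p: "p = (s, k, l)" "s < 2" by (cases p) auto
  have "k + l + int s - (k - l) = int s + 2 * l" by simp
  then show "(\<lambda>(n, m). (nat ((n - m) mod 2), (m + (n - m) div 2, (n - m) div 2))) (case p of (s, k, l) \<Rightarrow> (k + l + int s, k - l)) = p"
    using p by (simp only: p prod.case mod_mult_self2 div_mult_self2 mod_pos_pos_trivial div_pos_pos_trivial of_nat_0_le_iff of_nat_less_numeral_iff) auto
next
  fix y :: "int \<times> int"
  show "(\<lambda>(s, (k, l)). (k + l + int s, k - l)) ((\<lambda>(n, m). (nat ((n - m) mod 2), (m + (n - m) div 2, (n - m) div 2))) y) = y"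
    by (cases y; simp only: prod.case; simp; presburger)
qed (auto simp: nat_less_iff)

text \<open>The analogue for \<open>n^2 + 2 m^2\<close>: with \<open>n = k + 2 l + s\<close> and
  \<open>m = k - l\<close> the mixed terms cancel and \<open>3 k^2 + 6 l^2\<close> remains;
  \<open>s\<close> is \<open>n - m\<close> modulo 3.\<close>

lemma bij_third: "bij_betw (\<lambda>(s, (k, l)). (k + 2 * l + int s, k - l)) ({..<3::nat} \<times> UNIV) UNIV"
proof (rule bij_betwI[where g = "\<lambda>(n, m). (nat ((n - m) mod 3), (m + (n - m) div 3, (n - m) div 3))"])
  fix p :: "nat \<times> int \<times> int" assume "p \<in> {..<3} \<times> UNIV"
  then obtain s k l where p: "p = (s, k, l)" "s < 3" by (cases p) auto
  have "k + 2 * l + int s - (k - l) = int s + 3 * l" by simp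
  then show "(\<lambda>(n, m). (nat ((n - m) mod 3), (m + (n - m) div 3, (n - m) div 3))) (case p of (s, k, l) \<Rightarrow> (k + 2 * l + int s, k - l)) = p"
    using p by (simp only: p prod.case mod_mult_self2 div_mult_self2 mod_pos_pos_trivial div_pos_pos_trivial of_nat_0_le_iff of_nat_less_numeral_iff) auto
next
  fix y :: "int \<times> int"
  show "(\<lambda>(s, (k, l)). (k + 2 * l + int s, k - l)) ((\<lambda>(n, m). (nat ((n - m) mod 3), (m + (n - m) div 3, (n - m) div 3))) y) = y"
    by (cases y; simp only: prod.case; simp; presburger)
qed (auto simp: nat_less_iff)

lemma theta_term_minus: "theta_term (- z) Q n = Q powi tri n * z powi n"
proof -
  have "(- z) powi n = (- 1) powi n * z powi n" by (simp flip: power_int_mult_distrib)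
  then show ?thesis using minus1_powi_add_self[of n] by (simp add: theta_term_def algebra_simps)
qed

lemma divide_minus1_powi: "x / (- 1 :: complex) powi n = x * (- 1) powi n"
  using minus1_powi_add_self[of n] by (simp add: field_simps)

lemma theta_term_power_base:
  "theta_term z (Q ^ m) n = (- 1) powi n * Q powi (int m * tri n) * z powi n"
  by (simp add: theta_term_def power_int_power)

lemma theta_term_minus_power_base:
  "theta_term (- z) (Q ^ m) n = Q powi (int m * tri n) * z powi n"
  by (simp add: theta_term_minus power_int_power)

lemma norm_power_lt_1:
  fixes Q :: complex
  shows "norm Q < 1 \<Longrightarrow> m > 0 \<Longrightarrow> norm (Q ^ m) < 1"
  by (simp add: norm_power power_less_one_iff)

text \<open>Multiply the two series, change the lattice basis, and read each coset as a product of
  two theta series again. An instance only supplies the basis and checks the exponents.\<close>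

lemma theta_product_gen:
  fixes h1 h2 :: "nat \<Rightarrow> int \<Rightarrow> int \<Rightarrow> int"
  assumes Q: "Q \<noteq> 0" "norm Q < 1" and R: "R \<noteq> 0" "norm R < 1" and xy: "x \<noteq> 0" "y \<noteq> 0"
    and bij: "bij_betw (\<lambda>(s, (k, l)). (h1 s k l, h2 s k l)) ({..<N} \<times> UNIV) UNIV"
    and S: "S \<noteq> 0" "norm S < 1" "T \<noteq> 0" "norm T < 1" "\<And>s. u s \<noteq> 0" "\<And>s. v s \<noteq> 0"
    and eq: "\<And>s k l. s < N \<Longrightarrow> theta_term x Q (h1 s k l) * theta_term y R (h2 s k l)
               = c s * (theta_term (u s) S k * theta_term (v s) T l)"
  shows "jtheta x Q * jtheta y R = (\<Sum>s<N. c s * (jtheta (u s) S * jtheta (v s) T))"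
proof -
  have "jtheta x Q * jtheta y R = (\<Sum>\<^sub>\<infinity>(n, m). theta_term x Q n * theta_term y R m)"
    using assms by (simp add: jacobi_triple_product summable_on_int_product summable_theta)
  also have "\<dots> = (\<Sum>s<N. \<Sum>\<^sub>\<infinity>p. (\<lambda>(n, m). theta_term x Q n * theta_term y R m) ((\<lambda>(k, l). (h1 s k l, h2 s k l)) p))"
    using bij by (intro infsum_residue_split summable_on_int_product summable_theta Q R xy) (simp add: case_prod_unfold)
  also have "\<dots> = (\<Sum>s<N. c s * (jtheta (u s) S * jtheta (v s) T))"
  proof (intro sum.cong refl)
    fix s assume "s \<in> {..<N}"
    then have "(\<Sum>\<^sub>\<infinity>p. (\<lambda>(n, m). theta_term x Q n * theta_term y R m) ((\<lambda>(k, l). (h1 s k l, h2 s k l)) p))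
        = (\<Sum>\<^sub>\<infinity>(k, l). c s * (theta_term (u s) S k * theta_term (v s) T l))"
      by (intro infsum_cong) (auto simp: eq)
    also have "\<dots> = c s * (\<Sum>\<^sub>\<infinity>(k, l). theta_term (u s) S k * theta_term (v s) T l)"
      by (simp add: case_prod_unfold infsum_cmult_right')
    finally show "(\<Sum>\<^sub>\<infinity>p. (\<lambda>(n, m). theta_term x Q n * theta_term y R m) ((\<lambda>(k, l). (h1 s k l, h2 s k l)) p))
        = c s * (jtheta (u s) S * jtheta (v s) T)"
      using S by (simp add: jacobi_triple_product summable_on_int_product summable_theta)
  qed
  finally show ?thesis .
qed

text \<open>Equal bases lead to the basis of \<open>bij_parity\<close>. The sign
  \<open>(- 1) powi (n + m)\<close> depends on the coset only, which is why both new arguments are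
  negated.\<close>

lemma theta_product_parity:
  assumes "Q \<noteq> 0" "norm Q < 1" "x \<noteq> 0" "y \<noteq> 0"
  shows "jtheta x Q * jtheta y Q =
     jtheta (- (x * y)) (Q ^ 2) * jtheta (- (Q * x / y)) (Q ^ 2)
     - x * (jtheta (- (Q * x * y)) (Q ^ 2) * jtheta (- (Q ^ 2 * x / y)) (Q ^ 2))"
proof -
  have "jtheta x Q * jtheta y Q = (\<Sum>s<2. (- x) ^ s *
     (jtheta (- (x * y * Q ^ s)) (Q ^ 2) * jtheta (- (Q ^ (s + 1) * x / y)) (Q ^ 2)))"
  proof (rule theta_product_gen[OF _ _ _ _ _ _ bij_parity])
    fix s :: nat and k l :: int assume s: "s < 2"
    define S where "S = int s"
    have tS: "tri S = 0" using s by (cases s) (auto simp: S_def tri_def)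
    have "2 * (tri (k + l + S) + tri (k - l)) = 2 * (2 * tri k + 2 * tri l + S * k + S * l + l + tri S)"
      using two_tri[of k] two_tri[of l] two_tri[of S] two_tri[of "k + l + S"] two_tri[of "k - l"]
      by (simp add: algebra_simps)
    then have t: "tri (k + l + S) + tri (k - l) = 2 * tri k + 2 * tri l + S * k + S * l + l" using tS by simp
    have m: "(- 1 :: complex) powi (k + l + S) * (- 1) powi (k - l) = (- 1) ^ s"
      by (simp add: S_def power_int_add power_int_diff)
    have "theta_term x Q (k + l + S) * theta_term y Q (k - l) =
       ((- 1) powi (k + l + S) * (- 1) powi (k - l)) * Q powi (tri (k + l + S) + tri (k - l)) *
       (x powi (k + l + S) * y powi (k - l))"
      using assms by (simp add: theta_term_def power_int_add algebra_simps)
    also have "\<dots> = (- x) ^ s * (theta_term (- (x * y * Q ^ s)) (Q ^ 2) k * theta_term (- (Q ^ (s + 1) * x / y)) (Q ^ 2) l)"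
      unfolding t m theta_term_minus_power_base
      using assms by (simp add: S_def power_int_add power_int_diff power_int_mult_distrib power_int_divide_distrib
          power_int_power power_minus[of x] field_simps)
    finally show "theta_term x Q (k + l + int s) * theta_term y Q (k - l) = \<dots>" by (simp add: S_def)
  qed (use assms norm_power_lt_1[of Q 2] in auto)
  then show ?thesis by (simp add: numeral_2_eq_2 mult_ac)
qed

text \<open>Bases \<open>q\<close> and \<open>q ^ 2\<close> lead to the basis of
  \<open>bij_third\<close>. Here the sign leaves \<open>(- 1) powi l\<close> on each coset, so only
  the theta summed over \<open>k\<close> has a negated argument.\<close>

lemma theta_product_third:
  assumes "q \<noteq> 0" "norm q < 1" "x \<noteq> 0" "y \<noteq> 0"
  shows "jtheta x q * jtheta y (q ^ 2) =
     jtheta (- (x * y)) (q ^ 3) * jtheta (q ^ 3 * x ^ 2 / y) (q ^ 6)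
     - x * (jtheta (- (q * x * y)) (q ^ 3) * jtheta (q ^ 5 * x ^ 2 / y) (q ^ 6))
     + x ^ 2 * q * (jtheta (- (q ^ 2 * x * y)) (q ^ 3) * jtheta (q ^ 7 * x ^ 2 / y) (q ^ 6))"
proof -
  have "jtheta x q * jtheta y (q ^ 2) = (\<Sum>s<3. ((- x) ^ s * q powi tri (int s)) *
     (jtheta (- (x * y * q ^ s)) (q ^ 3) * jtheta (q ^ (3 + 2 * s) * x ^ 2 / y) (q ^ 6)))"
  proof (rule theta_product_gen[OF _ _ _ _ _ _ bij_third])
    fix s :: nat and k l :: int
    define S where "S = int s"
    have "2 * (tri (k + 2 * l + S) + 2 * tri (k - l)) = 2 * (3 * tri k + S * k + 6 * tri l + (3 + 2 * S) * l + tri S)"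
      using two_tri[of k] two_tri[of l] two_tri[of S] two_tri[of "k + 2 * l + S"] two_tri[of "k - l"]
      by (simp add: algebra_simps)
    then have t: "tri (k + 2 * l + S) + 2 * tri (k - l) = 3 * tri k + S * k + 6 * tri l + (3 + 2 * S) * l + tri S" by simp
    have m: "(- 1 :: complex) powi (k + 2 * l + S) * (- 1) powi (k - l) = (- 1) ^ s * (- 1) powi l"
      by (simp add: S_def power_int_add power_int_diff power_int_mult divide_minus1_powi)
    have "theta_term x q (k + 2 * l + S) * theta_term y (q ^ 2) (k - l) =
       ((- 1) powi (k + 2 * l + S) * (- 1) powi (k - l)) * q powi (tri (k + 2 * l + S) + 2 * tri (k - l)) *
       (x powi (k + 2 * l + S) * y powi (k - l))"
      using assms by (simp add: theta_term_def power_int_power power_int_add algebra_simps)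
    also have "\<dots> = ((- x) ^ s * q powi tri (int s)) *
       (theta_term (- (x * y * q ^ s)) (q ^ 3) k * theta_term (q ^ (3 + 2 * s) * x ^ 2 / y) (q ^ 6) l)"
      unfolding t m theta_term_minus_power_base unfolding theta_term_power_base
      using assms by (simp add: S_def power_int_add power_int_diff power_int_mult_distrib power_int_divide_distrib
          power_int_power power_minus[of x] field_simps)
    finally show "theta_term x q (k + 2 * l + int s) * theta_term y (q ^ 2) (k - l) = \<dots>" by (simp add: S_def)
  qed (use assms norm_power_lt_1[of q] in auto)
  then show ?thesis by (simp add: eval_nat_numeral tri_def mult_ac)
qed

text \<open>Inside the thetas on the right \<open>x\<close> enters only as \<open>x ^ 3\<close>.
  Replacing \<open>x\<close> by \<open>\<omega> * x\<close> therefore changes nothing but the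
  prefactors, which is how twisted values are dissected later.\<close>

lemma theta_trisect:
  assumes "q \<noteq> 0" "norm q < 1" "x \<noteq> 0"
  shows "jtheta x q = jtheta (q ^ 3 * x ^ 3) (q ^ 9)
     - x * jtheta (q ^ 6 * x ^ 3) (q ^ 9) + x ^ 2 * q * jtheta (q ^ 9 * x ^ 3) (q ^ 9)"
proof -
  have "infsum (theta_term x q) UNIV = (\<Sum>s<3. \<Sum>\<^sub>\<infinity>k. theta_term x q (3 * k + int s))"
    by (intro infsum_residue_split bij_residue summable_theta assms)
  also have "\<dots> = (\<Sum>s<3. ((- x) ^ s * q powi tri (int s)) * jtheta (q ^ (3 + 3 * s) * x ^ 3) (q ^ 9))"
  proof (intro sum.cong refl)
    fix s
    have "theta_term x q (3 * k + int s) =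
        ((- x) ^ s * q powi tri (int s)) * theta_term (q ^ (3 + 3 * s) * x ^ 3) (q ^ 9) k" for k
    proof -
      define S where "S = int s"
      have "2 * tri (3 * k + S) = 2 * (9 * tri k + (3 + 3 * S) * k + tri S)"
        using two_tri[of k] two_tri[of S] two_tri[of "3 * k + S"] by (simp add: algebra_simps)
      then have t: "tri (3 * k + S) = 9 * tri k + (3 + 3 * S) * k + tri S" by simp
      have m: "(- 1 :: complex) powi (3 * k + S) = (- 1) ^ s * (- 1) powi k"
        by (simp add: S_def power_int_add power_int_mult)
      show ?thesis
        unfolding S_def[symmetric] theta_term_power_base theta_term_def[of x] t m
        using assms by (simp add: S_def power_int_add power_int_mult_distrib
          power_int_power power_minus[of x] field_simps)
    qed
    then show "(\<Sum>\<^sub>\<infinity>k. theta_term x q (3 * k + int s)) =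
       ((- x) ^ s * q powi tri (int s)) * jtheta (q ^ (3 + 3 * s) * x ^ 3) (q ^ 9)"
      using assms norm_power_lt_1[of q 9] by (simp add: infsum_cmult_right' jacobi_triple_product)
  qed
  finally show ?thesis
    using assms by (simp add: jacobi_triple_product eval_nat_numeral tri_def mult_ac)
qed

subsection \<open>Appell--Lerch sums\<close>

text \<open>The Appell--Lerch sum without its normalising theta, and with the pole parameter
  \<open>b\<close> separated from the argument \<open>w\<close>; \<open>b = x * z\<close>,
  \<open>w = z\<close> gives back the numerator of \<open>appell_m x Q z\<close>. The change of
  parameter scales \<open>b\<close> and \<open>w\<close> by the same factor.\<close>

definition lerch :: "complex \<Rightarrow> complex \<Rightarrow> complex \<Rightarrow> complex" where
  "lerch b w Q = (\<Sum>\<^sub>\<infinity>r. theta_term w Q r / (1 - Q powi (r - 1) * b))"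

text \<open>At large positive exponents the denominator tends to 1. At negative ones the fraction is
  \<open>Q ^ n / (Q ^ n - b)\<close>, which tends to 0. A denominator that happens to vanish
  contributes 0, the HOL value of division by zero.\<close>

lemma bounded_lerch_denominator:
  fixes Q b :: complex
  assumes "Q \<noteq> 0" "norm Q < 1" "b \<noteq> 0"
  shows "\<exists>B. \<forall>r::int. norm (1 / (1 - Q powi (r - 1) * b)) \<le> B"
proof -
  have q: "(\<lambda>n. Q ^ n) \<longlonglongrightarrow> 0" using assms by (intro LIMSEQ_power_zero) auto
  have "(\<lambda>n. 1 / (1 - Q ^ n * b)) \<longlonglongrightarrow> 1 / (1 - 0 * b)" by (intro tendsto_intros q) auto
  from convergent_imp_Bseq[OF convergentI[OF this]]
  obtain B1 where B1: "\<And>n. norm (1 / (1 - Q ^ n * b)) \<le> B1" by (auto simp: Bseq_def)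
  have "(\<lambda>n. Q ^ n / (Q ^ n - b)) \<longlonglongrightarrow> 0 / (0 - b)" by (intro tendsto_intros q) (use assms in auto)
  from convergent_imp_Bseq[OF convergentI[OF this]]
  obtain B2 where B2: "\<And>n. norm (Q ^ n / (Q ^ n - b)) \<le> B2" by (auto simp: Bseq_def)
  have *: "norm (1 / (1 - Q powi r * b)) \<le> max B1 B2" for r
  proof (cases r rule: int_cases2)
    case (nonneg n)
    then show ?thesis using B1[of n] by simp
  next
    case (nonpos n)
    have "1 / (1 - Q powi r * b) = Q ^ n / (Q ^ n - b)"
      using assms nonpos by (cases "Q ^ n = b") (auto simp: power_int_minus field_simps)
    then show ?thesis using B2[of n] by simp
  qed
  show ?thesis by (intro exI[of _ "max B1 B2"] allI *)
qed

lemma summable_on_bounded_mult: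
  fixes f g :: "'a \<Rightarrow> complex"
  assumes "f summable_on A" "\<And>x. norm (g x) \<le> B"
  shows "(\<lambda>x. f x * g x) summable_on A"
proof -
  have "(\<lambda>x. norm (f x)) summable_on A"
    using assms(1) by (simp add: summable_on_iff_abs_summable_on_complex)
  then have "(\<lambda>x. norm (f x) * B) summable_on A" by (rule summable_on_cmult_left)
  then have "(\<lambda>x. norm (f x * g x)) summable_on A"
    by (rule summable_on_comparison_test) (auto simp: norm_mult intro!: mult_left_mono assms(2))
  then show ?thesis by (simp add: summable_on_iff_abs_summable_on_complex)
qed

lemma summable_lerch:
  assumes "Q \<noteq> 0" "norm Q < 1" "w \<noteq> 0" "b \<noteq> 0"
  shows "(\<lambda>r. theta_term w Q r / (1 - Q powi (r - 1) * b)) summable_on UNIV"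
proof -
  obtain B where "\<forall>r::int. norm (1 / (1 - Q powi (r - 1) * b)) \<le> B"
    using bounded_lerch_denominator[OF assms(1,2,4)] by blast
  then show ?thesis
    using summable_on_bounded_mult[OF summable_theta[OF assms(1-3)], of "\<lambda>r. 1 / (1 - Q powi (r - 1) * b)" B]
    by simp
qed

lemma theta_term_add1: "Q \<noteq> 0 \<Longrightarrow> w \<noteq> 0 \<Longrightarrow> theta_term w Q (n + 1) = - (Q powi n * w * theta_term w Q n)"
  by (simp add: theta_term_def tri_add1 power_int_add)

lemma jtheta_nonzero:
  assumes "Q \<noteq> 0" "norm Q < 1" "z \<noteq> 0" "\<And>r::int. Q powi r * z \<noteq> 1"
  shows "jtheta z Q \<noteq> 0"
proof -
  have 1: "z * Q ^ k \<noteq> 1" for k using assms(4)[of "int k"] by (simp add: mult.commute)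
  have 2: "Q / z * Q ^ k \<noteq> 1" for k
  proof
    assume "Q / z * Q ^ k = 1"
    then have "z = Q ^ Suc k" using assms(3) by (simp add: field_simps)
    then have "Q powi (- int (Suc k)) * z = 1" using assms(1) by (simp add: power_int_minus del: of_nat_Suc power_Suc)
    then show False using assms(4) by blast
  qed
  show ?thesis
    using qpoch_nonzero[OF assms(2) 1] qpoch_nonzero[OF assms(2) 2] qpoch_self_nonzero[OF assms(2)]
    by (simp add: jtheta_def)
qed

text \<open>Grouping the double series by the total degree \<open>n\<close> in \<open>w\<close>, the coefficients obey the same
  first-order recurrence as those of the theta function on the right.\<close>
lemma lerch_relation:
  assumes Q: "Q \<noteq> 0" "norm Q < 1" and c: "c \<noteq> 0" and b: "b \<noteq> 0"
    and nb: "\<And>r::int. Q powi r * b \<noteq> 1" and ncb: "\<And>r::int. Q powi r * (c * b) \<noteq> 1"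
  obtains K where "\<And>w. w \<noteq> 0 \<Longrightarrow>
    jtheta w Q * lerch (c * b) (c * w) Q - jtheta (c * w) Q * lerch b w Q = K * w * jtheta (c * b * w) Q"
proof -
  define d1 where "d1 r = 1 / (1 - Q powi (r - 1) * (c * b))" for r
  define d0 where "d0 r = 1 / (1 - Q powi (r - 1) * b)" for r
  obtain B1 where B1: "\<And>r. norm (d1 r) \<le> B1"
    using bounded_lerch_denominator[OF Q, of "c * b"] b c by (auto simp: d1_def)
  obtain B0 where B0: "\<And>r. norm (d0 r) \<le> B0"
    using bounded_lerch_denominator[OF Q b] by (auto simp: d0_def)
  \<comment> \<open>This is the antidiagonal sum \<open>G 1\<close> below with its single factor
    \<open>w\<close> removed, which is why it can be named before \<open>w\<close> is fixed.\<close>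
  define K where "K = (\<Sum>\<^sub>\<infinity>r. c powi r * (- (Q powi (tri r + tri (1 - r)))) * (d1 r - d0 (1 - r)))"
  show ?thesis
  proof (rule that[of K])
    fix w :: complex assume w: "w \<noteq> 0"
    define t where "t = theta_term w Q"
    define tc where "tc = theta_term (c * w) Q"
    define F where "F r s = tc r * t s * (d1 r - d0 s)" for r s
    define G where "G n = (\<Sum>\<^sub>\<infinity>r. F r (n - r))" for n
    have st: "t summable_on UNIV" and stc: "tc summable_on UNIV"
      using Q c w by (auto simp: t_def tc_def intro!: summable_theta)
    have bj: "bij_betw (\<lambda>(n, r). (r, n - r)) UNIV (UNIV :: (int \<times> int) set)"
      by (rule bij_betwI[where g = "\<lambda>(r, s). (r + s, r)"]) auto
    have stt: "(\<lambda>(r, s). tc r * t s) summable_on UNIV"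
      using summable_on_int_product[OF stc st] by simp
    have sF: "(\<lambda>(r, s). F r s) summable_on UNIV"
    proof -
      have "(\<lambda>p. (\<lambda>(r, s). tc r * t s) p * (d1 (fst p) - d0 (snd p))) summable_on UNIV"
        by (rule summable_on_bounded_mult[OF stt, of _ "B1 + B0"])
           (intro order_trans[OF norm_triangle_ineq4] add_mono B0 B1)
      then show ?thesis by (simp add: F_def case_prod_unfold)
    qed
    have L: "jtheta w Q * lerch (c * b) (c * w) Q - jtheta (c * w) Q * lerch b w Q = (\<Sum>\<^sub>\<infinity>(r, s). F r s)"
    proof -
      have s1: "(\<lambda>r. tc r * d1 r) summable_on UNIV" and s0: "(\<lambda>s. t s * d0 s) summable_on UNIV"
        using summable_on_bounded_mult[OF stc B1] summable_on_bounded_mult[OF st B0] by auto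
      have "jtheta w Q * lerch (c * b) (c * w) Q = infsum (\<lambda>r. tc r * d1 r) UNIV * infsum t UNIV"
        using Q w by (simp add: jacobi_triple_product lerch_def t_def tc_def d1_def)
      also have "\<dots> = (\<Sum>\<^sub>\<infinity>(r, s). (tc r * d1 r) * t s)"
        by (rule summable_on_int_product(2)[OF s1 st])
      finally have e1: "jtheta w Q * lerch (c * b) (c * w) Q = (\<Sum>\<^sub>\<infinity>(r, s). (tc r * d1 r) * t s)" .
      have "jtheta (c * w) Q * lerch b w Q = infsum tc UNIV * infsum (\<lambda>s. t s * d0 s) UNIV"
        using Q w c by (simp add: jacobi_triple_product lerch_def t_def tc_def d0_def)
      also have "\<dots> = (\<Sum>\<^sub>\<infinity>(r, s). tc r * (t s * d0 s))"
        by (rule summable_on_int_product(2)[OF stc s0])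
      finally have e0: "jtheta (c * w) Q * lerch b w Q = (\<Sum>\<^sub>\<infinity>(r, s). tc r * (t s * d0 s))" .
      have "(\<Sum>\<^sub>\<infinity>(r, s). F r s) = (\<Sum>\<^sub>\<infinity>p. (\<lambda>(r, s). (tc r * d1 r) * t s) p + - (\<lambda>(r, s). tc r * (t s * d0 s)) p)"
        by (intro infsum_cong) (auto simp: F_def algebra_simps)
      also have "\<dots> = (\<Sum>\<^sub>\<infinity>(r, s). (tc r * d1 r) * t s) + (\<Sum>\<^sub>\<infinity>p. - (\<lambda>(r, s). tc r * (t s * d0 s)) p)"
        by (intro infsum_add summable_on_int_product s1 st summable_on_uminus[THEN iffD2] stc s0)
      also have "\<dots> = (\<Sum>\<^sub>\<infinity>(r, s). (tc r * d1 r) * t s) - (\<Sum>\<^sub>\<infinity>(r, s). tc r * (t s * d0 s))"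
        by (simp only: infsum_uminus diff_conv_add_uminus)
      finally show ?thesis unfolding e1 e0 by simp
    qed
    have sFb: "(\<lambda>p. (\<lambda>(r, s). F r s) ((\<lambda>(n, r). (r, n - r)) p)) summable_on UNIV"
      using summable_on_reindex_bij_betw[OF bj, of "\<lambda>(r, s). F r s"] sF by simp
    have "(\<Sum>\<^sub>\<infinity>(r, s). F r s) = (\<Sum>\<^sub>\<infinity>p. (\<lambda>(r, s). F r s) ((\<lambda>(n, r). (r, n - r)) p))"
      using infsum_reindex_bij_betw[OF bj, of "\<lambda>(r, s). F r s"] by simp
    also have "\<dots> = infsum G UNIV"
      using infsum_Sigma_banach[of "\<lambda>p. (\<lambda>(r, s). F r s) ((\<lambda>(n, r). (r, n - r)) p)" UNIV "\<lambda>_. UNIV"] sFb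
      by (simp add: G_def[abs_def])
    finally have LG: "(\<Sum>\<^sub>\<infinity>(r, s). F r s) = infsum G UNIV" .
    obtain Bt where Bt: "\<And>s. norm (t s) \<le> Bt"
    proof -
      have a: "(\<lambda>s. norm (t s)) summable_on UNIV" using st by (simp add: summable_on_iff_abs_summable_on_complex)
      have "norm (t s) \<le> (\<Sum>\<^sub>\<infinity>s. norm (t s))" for s
        using finite_sum_le_infsum[OF a, of "{s}"] by simp
      then show ?thesis using that by blast
    qed
    have sg: "(\<lambda>r. tc r * t (m - r) * e r) summable_on UNIV" if "\<And>r. norm (e r) \<le> B" for m e B
    proof -
      have "(\<lambda>r. tc r * t (m - r)) summable_on UNIV"
        by (rule summable_on_bounded_mult[OF stc Bt])
      then show ?thesis by (rule summable_on_bounded_mult) (rule that)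
    qed
    have shift: "infsum (\<lambda>r. f (r + 1)) UNIV = infsum f UNIV" for f :: "int \<Rightarrow> complex"
      by (rule infsum_reindex_bij_betw) (rule bij_betwI[where g = "\<lambda>k. k - 1"], auto)
    have shifts: "(\<lambda>r. f (r + 1)) summable_on UNIV \<longleftrightarrow> f summable_on UNIV" for f :: "int \<Rightarrow> complex"
      by (rule summable_on_reindex_bij_betw) (rule bij_betwI[where g = "\<lambda>k. k - 1"], auto)
    have rec: "G (n + 1) = - (Q powi (n - 1) * (c * b * w) * G n)" for n
    proof -
      define X1 where "X1 r = tc r * t (n + 1 - r) * d1 r" for r
      define X0 where "X0 r = tc r * t (n + 1 - r) * d0 (n + 1 - r)" for r
      define Y where "Y r = tc r * t (n + 1 - r) * 1" for r
      have sX1: "X1 summable_on UNIV" and sX0: "X0 summable_on UNIV" and sY: "Y summable_on UNIV"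
        unfolding X1_def X0_def Y_def by (rule sg[OF B1], rule sg[OF B0], rule sg[of _ 1], simp)
      have "G (n + 1) = (\<Sum>\<^sub>\<infinity>r. X1 r + - X0 r)"
        unfolding G_def F_def X1_def X0_def by (intro infsum_cong) (simp add: algebra_simps)
      also have "\<dots> = infsum X1 UNIV - infsum X0 UNIV"
        using infsum_add[OF sX1 summable_on_uminus[THEN iffD2, OF sX0]] by (simp add: infsum_uminus)
      finally have g1: "G (n + 1) = infsum X1 UNIV - infsum X0 UNIV" .
      \<comment> \<open>The factor of the recurrence replaces each fraction by itself minus one,
        since \<open>Q powi (r - 1) * (c * b) * d1 r = d1 r - 1\<close> and likewise for
        \<open>d0\<close>. The subtracted ones are collected in \<open>Y\<close> and cancel after
        the shift of \<open>r\<close>.\<close>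
      have pt: "- (Q powi (n - 1) * (c * b * w) * F r (n - r)) = (X1 r - Y r) + - (X0 (r + 1) - Y (r + 1))" for r
      proof -
        have t1: "t (n + 1 - r) = - (Q powi (n - r) * w * t (n - r))"
          using theta_term_add1[OF Q(1) w, of "n - r"] by (simp add: t_def algebra_simps)
        have tc1: "tc (r + 1) = - (Q powi r * (c * w) * tc r)"
          using theta_term_add1[OF Q(1), of "c * w" r] c w by (simp add: tc_def)
        have D1: "Q powi (n - 1) * (c * b) * d1 r = Q powi (n - r) * (d1 r - 1)"
        proof -
          have "Q powi (n - 1) = Q powi (n - r) * Q powi (r - 1)"
            using Q by (simp flip: power_int_add)
          moreover have "1 - Q powi (r - 1) * (c * b) \<noteq> 0" using ncb[of "r - 1"] by simp
          ultimately show ?thesis by (simp add: d1_def field_simps)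
        qed
        have D0: "Q powi (n - 1) * (c * b) * d0 (n - r) = c * Q powi r * (d0 (n - r) - 1)"
        proof -
          have "Q powi (n - 1) = Q powi r * Q powi (n - r - 1)"
            using Q by (simp flip: power_int_add)
          moreover have "1 - Q powi (n - r - 1) * b \<noteq> 0" using nb[of "n - r - 1"] by simp
          ultimately show ?thesis by (simp add: d0_def field_simps)
        qed
        have e: "n + 1 - (r + 1) = n - r" by simp
        have "Q powi (n - 1) * (c * b * w) * F r (n - r) =
           w * tc r * t (n - r) * (Q powi (n - 1) * (c * b) * d1 r - Q powi (n - 1) * (c * b) * d0 (n - r))"
          by (simp add: F_def algebra_simps)
        also have "\<dots> = - ((X1 r - Y r) + - (X0 (r + 1) - Y (r + 1)))"
          unfolding D1 D0 X1_def X0_def Y_def e t1 tc1 by (simp add: algebra_simps)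
        finally show ?thesis by simp
      qed
      have sXY1: "(\<lambda>r. X1 r - Y r) summable_on UNIV" and sXY0: "(\<lambda>r. X0 r - Y r) summable_on UNIV"
        using summable_on_add[OF sX1 summable_on_uminus[THEN iffD2, OF sY]]
              summable_on_add[OF sX0 summable_on_uminus[THEN iffD2, OF sY]] by auto
      have dX: "(\<Sum>\<^sub>\<infinity>r. X1 r - Y r) = infsum X1 UNIV - infsum Y UNIV"
        "(\<Sum>\<^sub>\<infinity>r. X0 r - Y r) = infsum X0 UNIV - infsum Y UNIV"
        using infsum_add[OF sX1 summable_on_uminus[THEN iffD2, OF sY]]
              infsum_add[OF sX0 summable_on_uminus[THEN iffD2, OF sY]] by (auto simp: infsum_uminus)
      have "- (Q powi (n - 1) * (c * b * w) * G n) = (\<Sum>\<^sub>\<infinity>r. - (Q powi (n - 1) * (c * b * w) * F r (n - r)))"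
        by (simp add: G_def infsum_uminus infsum_cmult_right')
      also have "\<dots> = (\<Sum>\<^sub>\<infinity>r. (X1 r - Y r) + - (X0 (r + 1) - Y (r + 1)))" by (simp only: pt)
      also have "\<dots> = (\<Sum>\<^sub>\<infinity>r. X1 r - Y r) - (\<Sum>\<^sub>\<infinity>r. X0 (r + 1) - Y (r + 1))"
        using infsum_add[OF sXY1 summable_on_uminus[THEN iffD2], of "\<lambda>r. X0 (r + 1) - Y (r + 1)"]
          shifts[of "\<lambda>r. X0 r - Y r"] sXY0 by (simp add: infsum_uminus del: minus_diff_eq)
      also have "\<dots> = infsum X1 UNIV - infsum X0 UNIV"
        using shift[of "\<lambda>r. X0 r - Y r"] dX by simp
      finally show ?thesis using g1 by simp
    qed
    \<comment> \<open>The recurrence determines \<open>G\<close> from \<open>G 1\<close> in both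
      directions; it is that of \<open>theta_term_add1\<close> for the argument
      \<open>c * b * w\<close>, one index later.\<close>
    have G: "G (n + 1) = G 1 * theta_term (c * b * w) Q n" for n
    proof -
      have rt: "theta_term (c * b * w) Q (n + 1) = - (Q powi n * (c * b * w) * theta_term (c * b * w) Q n)" for n
        using theta_term_add1[of Q "c * b * w"] Q b c w by simp
      show ?thesis
      proof (induction n rule: int_induct[where k = 0])
        case (step1 i)
        then show ?case using rec[of "i + 1"] rt[of i] by (simp add: algebra_simps)
      next
        case (step2 i)
        let ?a = "Q powi (i - 1) * (c * b * w)"
        have "?a * G i = - G (i + 1)" using rec[of i] by simp
        also have "\<dots> = - (G 1 * theta_term (c * b * w) Q (i - 1 + 1))" using step2 by simp
        also have "\<dots> = ?a * (G 1 * theta_term (c * b * w) Q (i - 1))" unfolding rt by simp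
        finally have "G i = G 1 * theta_term (c * b * w) Q (i - 1)"
          using Q b c w by (subst (asm) mult_left_cancel) auto
        then show ?case by simp
      qed (simp add: theta_term_def)
    qed
    have "infsum G UNIV = (\<Sum>\<^sub>\<infinity>n. G 1 * theta_term (c * b * w) Q n)"
      using shift[of G] by (simp add: G)
    also have "\<dots> = G 1 * jtheta (c * b * w) Q"
      using Q b c w by (simp add: infsum_cmult_right' jacobi_triple_product)
    finally have iG: "infsum G UNIV = G 1 * jtheta (c * b * w) Q" .
    have G1: "G 1 = K * w"
    proof -
      have "F r (1 - r) = (c powi r * (- (Q powi (tri r + tri (1 - r)))) * (d1 r - d0 (1 - r))) * w" for r
      proof -
        have "tc r * t (1 - r) = ((- 1) powi r * (- 1) powi (1 - r)) * c powi r * Q powi (tri r + tri (1 - r)) * (w powi r * w powi (1 - r))"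
          using Q by (simp add: tc_def t_def theta_term_def power_int_mult_distrib power_int_add algebra_simps)
        also have "\<dots> = - (c powi r * Q powi (tri r + tri (1 - r)) * w)"
          using w by (simp flip: power_int_add)
        finally show ?thesis by (simp add: F_def)
      qed
      then show ?thesis unfolding G_def K_def by (simp only: infsum_cmult_left')
    qed
    have "jtheta w Q * lerch (c * b) (c * w) Q - jtheta (c * w) Q * lerch b w Q = infsum G UNIV"
      by (rule trans[OF L LG])
    then have fin: "jtheta w Q * lerch (c * b) (c * w) Q - jtheta (c * w) Q * lerch b w Q = K * w * jtheta (c * b * w) Q"
      by (simp only: iG G1)
    show "jtheta w Q * lerch (c * b) (c * w) Q - jtheta (c * w) Q * lerch b w Q = K * w * jtheta (c * b * w) Q"
      by (rule fin)
  qed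
qed

section \<open>The constant of the Lerch relation, from the pole at 1\<close>

text \<open>The products converge uniformly on balls, with majorant \<open>R * norm q ^ n\<close>.
  Continuity serves the limits at \<open>b = 1\<close> below.\<close>

lemma isCont_qpoch:
  fixes x q :: complex
  assumes "norm q < 1"
  shows "isCont (\<lambda>x. qpoch_inf x q) x"
proof -
  define R where "R = norm x + 1"
  have "uniformly_convergent_on (cball 0 R) (\<lambda>N x. \<Prod>n<N. 1 - x * q ^ n)"
  proof (rule uniformly_convergent_on_prod')
    show "uniformly_convergent_on (cball 0 R) (\<lambda>N x. \<Sum>n<N. norm (1 - x * q ^ n - 1))"
    proof (rule Weierstrass_m_test'_ev)
      show "summable (\<lambda>n. R * norm q ^ n)" using assms by (intro summable_mult summable_geometric) auto
      show "\<forall>\<^sub>F n in sequentially. \<forall>x\<in>cball 0 R. norm (norm (1 - x * q ^ n - 1)) \<le> R * norm q ^ n"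
        by (intro always_eventually) (auto simp: norm_mult norm_power intro!: mult_right_mono)
    qed
  qed (auto intro!: continuous_intros)
  then obtain l where l: "uniform_limit (cball 0 R) (\<lambda>N x. \<Prod>n<N. 1 - x * q ^ n) l sequentially"
    by (auto simp: uniformly_convergent_on_def)
  have "l y = qpoch_inf y q" if "y \<in> cball 0 R" for y
    using tendsto_uniform_limitI[OF l that] qpoch_LIMSEQ[OF assms, of y] LIMSEQ_unique by blast
  moreover have "continuous_on (cball 0 R) l"
    by (rule uniform_limit_theorem[OF _ l]) (auto intro!: always_eventually continuous_intros)
  ultimately have "continuous_on (cball 0 R) (\<lambda>x. qpoch_inf x q)"
    by (simp cong: continuous_on_cong_simp)
  then have "continuous_on (ball 0 R) (\<lambda>x. qpoch_inf x q)"
    by (rule continuous_on_subset) auto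
  moreover have "x \<in> ball 0 R" by (simp add: R_def)
  ultimately show ?thesis by (simp add: continuous_on_eq_continuous_at)
qed

lemma isCont_jtheta:
  assumes "norm Q < 1" "z \<noteq> 0"
  shows "isCont (\<lambda>z. jtheta z Q) z"
  unfolding jtheta_def
  by (intro continuous_intros isCont_qpoch[OF assms(1)] isCont_o2[OF _ isCont_qpoch[OF assms(1)]]) (use assms in auto)

text \<open>At \<open>w = 1\<close> and at \<open>w = 1 / c\<close> one of the two products in
  \<open>lerch_relation\<close> vanishes, because \<open>jtheta 1 Q = 0\<close>. Eliminating
  \<open>K\<close> from the two evaluations leaves this invariance under \<open>b\<close> to
  \<open>c * b\<close>.\<close>

lemma lerch_1_ratio:
  assumes Q: "Q \<noteq> 0" "norm Q < 1" and c: "c \<noteq> 0" and b: "b \<noteq> 0"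
    and nb: "\<And>r::int. Q powi r * b \<noteq> 1" and ncb: "\<And>r::int. Q powi r * (c * b) \<noteq> 1"
    and nc: "jtheta c Q \<noteq> 0"
  shows "jtheta (c * b) Q * lerch (c * b) 1 Q = jtheta b Q * lerch b 1 Q"
proof -
  obtain K where K: "\<And>w. w \<noteq> 0 \<Longrightarrow>
    jtheta w Q * lerch (c * b) (c * w) Q - jtheta (c * w) Q * lerch b w Q = K * w * jtheta (c * b * w) Q"
    using lerch_relation[OF Q c b nb ncb] by blast
  have 1: "- (jtheta c Q * lerch b 1 Q) = K * jtheta (c * b) Q"
    using K[of 1] Q by simp
  have 2: "- (jtheta c Q * lerch (c * b) 1 Q) = K * jtheta b Q"
    using K[of "1 / c"] Q c jtheta_inverse[OF Q c] by (simp add: field_simps)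
  have "jtheta c Q * (jtheta (c * b) Q * lerch (c * b) 1 Q) = - (jtheta (c * b) Q * (K * jtheta b Q))"
    unfolding 2[symmetric] by simp
  also have "\<dots> = - (jtheta b Q * (K * jtheta (c * b) Q))" by simp
  also have "\<dots> = jtheta c Q * (jtheta b Q * lerch b 1 Q)"
    unfolding 1[symmetric] by simp
  finally show ?thesis using nc by simp
qed

text \<open>The zero of theta at 1 is simple: exactly one factor \<open>1 - b\<close> splits off the
  product.\<close>

lemma jtheta_over_1_minus:
  assumes "norm Q < 1"
  shows "((\<lambda>b. jtheta b Q / (1 - b)) \<longlongrightarrow> qpoch_inf Q Q ^ 3) (at 1)"
proof -
  have "isCont (\<lambda>b. qpoch_inf (b * Q) Q * qpoch_inf (Q / b) Q * qpoch_inf Q Q) 1"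
    by (intro continuous_intros isCont_o2[OF _ isCont_qpoch[OF assms]]) auto
  then have "((\<lambda>b. qpoch_inf (b * Q) Q * qpoch_inf (Q / b) Q * qpoch_inf Q Q) \<longlongrightarrow> qpoch_inf Q Q ^ 3) (at 1)"
    by (simp add: isCont_def power3_eq_cube)
  moreover have "\<forall>\<^sub>F b in at 1. qpoch_inf (b * Q) Q * qpoch_inf (Q / b) Q * qpoch_inf Q Q = jtheta b Q / (1 - b)"
    unfolding eventually_at_filter
  proof (intro always_eventually allI impI)
    fix b :: complex assume "b \<noteq> 1"
    then show "qpoch_inf (b * Q) Q * qpoch_inf (Q / b) Q * qpoch_inf Q Q = jtheta b Q / (1 - b)"
      using qpoch_Suc[OF assms, of b] by (simp add: jtheta_def)
  qed
  ultimately show ?thesis by (rule Lim_transform_eventually)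
qed

text \<open>Only the denominator with \<open>r = 1\<close> can become small. With
  \<open>p = norm Q\<close>, let \<open>norm b\<close> lie between \<open>(1 + p) / 2\<close> and
  \<open>(1 + p) / (2 * p)\<close>: then \<open>norm (Q powi (r - 1) * b)\<close> is at most
  \<open>(1 + p) / 2\<close> for \<open>r > 1\<close> and at least \<open>1 + (1 - p) / 2\<close>
  for \<open>r < 1\<close>.\<close>

lemma eventually_near_1:
  fixes Q :: complex
  assumes Q: "Q \<noteq> 0" "norm Q < 1"
  shows "\<forall>\<^sub>F b in at 1. b \<noteq> 0 \<and> b \<noteq> 1 \<and> (\<forall>r::int. r \<noteq> 1 \<longrightarrow> norm (1 - Q powi (r - 1) * b) \<ge> (1 - norm Q) / 2)"
proof -
  define p where "p = norm Q"
  have p: "0 < p" "p < 1" using Q by (auto simp: p_def)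
  have aux1: "(1 - p) / 2 \<le> y" if "x \<le> (1 + p) / 2" "1 - x \<le> y" for x y :: real
    using that by (simp add: field_simps)
  have aux2: "(1 - p) / 2 \<le> y" if "1 + (1 - p) / 2 \<le> x" "x - 1 \<le> y" for x y :: real
    using that by (simp add: field_simps)
  have "((\<lambda>b::complex. norm b) \<longlongrightarrow> norm (1 :: complex)) (at 1)" by (intro tendsto_intros)
  then have lim: "((\<lambda>b::complex. norm b) \<longlongrightarrow> 1) (at 1)" by simp
  have "1 < (1 + p) / (2 * p)" using p by (auto simp: field_simps)
  from order_tendstoD(2)[OF lim this] have "\<forall>\<^sub>F b::complex in at 1. norm b < (1 + p) / (2 * p)" .
  moreover have "(1 + p) / 2 < 1" using p by (auto simp: field_simps)
  from order_tendstoD(1)[OF lim this] have "\<forall>\<^sub>F b::complex in at 1. (1 + p) / 2 < norm b" .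
  moreover have "\<forall>\<^sub>F b::complex in at 1. b \<noteq> 1" by (simp add: eventually_at_filter)
  ultimately show ?thesis
  proof eventually_elim
    case (elim b)
    have b: "norm b > 0" using elim p by (smt (verit) divide_pos_pos)
    have "norm (1 - Q powi (r - 1) * b) \<ge> (1 - p) / 2" if "r \<noteq> 1" for r
    proof (cases "r > 1")
      case True
      define n where "n = nat (r - 2)"
      have n: "r - 1 = int (Suc n)" using True by (simp add: n_def)
      have "norm (Q powi (r - 1) * b) = p ^ n * (p * norm b)"
        unfolding n power_int_of_nat by (simp add: norm_mult norm_power p_def)
      also have "\<dots> \<le> 1 * (p * norm b)" using p b by (intro mult_right_mono power_le_one) auto
      also have "\<dots> \<le> (1 + p) / 2" using elim p by (simp add: field_simps)
      finally have "norm (Q powi (r - 1) * b) \<le> (1 + p) / 2" .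
      then show ?thesis
        using norm_triangle_ineq2[of 1 "Q powi (r - 1) * b"] unfolding norm_one by (rule aux1)
    next
      case False
      define n where "n = nat (- r)"
      have n: "r - 1 = - int (Suc n)" using that False by (simp add: n_def)
      have "1 + (1 - p) / 2 \<le> (1 + p) / (2 * p)"
      proof -
        have "(1 - p) * (1 - p) \<ge> 0" by simp
        then show ?thesis using p by (simp add: field_simps)
      qed
      also have "\<dots> = (1 + p) / 2 / p" by simp
      also have "\<dots> \<le> norm b / p" using elim p by (intro divide_right_mono) auto
      also have "\<dots> = 1 * (norm b / p)" by simp
      also have "\<dots> \<le> (1 / p ^ n) * (norm b / p)"
        using p b by (intro mult_right_mono) (auto simp: power_le_one)
      also have "\<dots> = norm (Q powi (r - 1) * b)"
        unfolding n by (simp add: norm_mult norm_power norm_inverse norm_divide p_def power_int_minus field_simps del: of_nat_Suc)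
      finally show ?thesis
        using norm_triangle_ineq2[of "Q powi (r - 1) * b" 1]
        unfolding norm_one norm_minus_commute[of "Q powi (r - 1) * b" 1] by (rule aux2)
    qed
    then show ?case using b elim by (auto simp: p_def)
  qed
qed

text \<open>The term \<open>r = 1\<close> is \<open>- 1 / (1 - b)\<close> and meets the simple zero
  of theta; the remaining terms are bounded near 1, so their product with theta tends to 0.\<close>

lemma jtheta_lerch_1_tendsto:
  assumes Q: "Q \<noteq> 0" "norm Q < 1"
  shows "((\<lambda>b. jtheta b Q * lerch b 1 Q) \<longlongrightarrow> - (qpoch_inf Q Q ^ 3)) (at 1)"
proof -
  define rest where "rest b = (\<Sum>\<^sub>\<infinity>r\<in>-{1}. theta_term 1 Q r / (1 - Q powi (r - 1) * b))" for b
  define M where "M = (\<Sum>\<^sub>\<infinity>r\<in>-{1}. norm (theta_term 1 Q r) * (2 / (1 - norm Q)))"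
  have sM: "(\<lambda>r. norm (theta_term 1 Q r) * (2 / (1 - norm Q))) summable_on (-{1})"
    by (rule summable_on_cmult_left, rule summable_on_subset_banach[OF abs_summable_theta[OF Q]]) auto
  have ev: "\<forall>\<^sub>F b in at 1. norm (rest b) \<le> M \<and> jtheta b Q * lerch b 1 Q = - (jtheta b Q / (1 - b)) + jtheta b Q * rest b"
    using eventually_near_1[OF Q]
  proof eventually_elim
    case (elim b)
    have bd: "norm (theta_term 1 Q r / (1 - Q powi (r - 1) * b)) \<le> norm (theta_term 1 Q r) * (2 / (1 - norm Q))" if "r \<in> -{1}" for r
    proof -
      have h: "(1 - norm Q) / 2 \<le> norm (1 - Q powi (r - 1) * b)" using elim that by simp
      have "norm (theta_term 1 Q r) / norm (1 - Q powi (r - 1) * b) \<le> norm (theta_term 1 Q r) / ((1 - norm Q) / 2)"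
        by (rule frac_le[OF _ order_refl _ h]) (use Q in auto)
      then show ?thesis by (simp add: norm_divide)
    qed
    have sr: "(\<lambda>r. theta_term 1 Q r / (1 - Q powi (r - 1) * b)) summable_on (-{1})"
      by (rule summable_on_subset_banach[OF summable_lerch[OF Q]]) (use elim in auto)
    have "norm (rest b) \<le> M"
      unfolding rest_def M_def by (rule norm_infsum_le[OF has_sum_infsum[OF sr] has_sum_infsum[OF sM] bd])
    moreover have "lerch b 1 Q = theta_term 1 Q 1 / (1 - Q powi (1 - 1) * b) + rest b"
    proof -
      have "UNIV = insert (1::int) (-{1})" by auto
      then show ?thesis unfolding lerch_def rest_def using infsum_insert[OF sr, of 1] by simp
    qed
    ultimately show ?case by (simp add: theta_term_def right_diff_distrib)
  qed
  have t0: "((\<lambda>b. jtheta b Q) \<longlongrightarrow> 0) (at 1)"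
    using isCont_jtheta[OF Q(2), of 1] Q by (simp add: isCont_def)
  have "((\<lambda>b. jtheta b Q * rest b) \<longlongrightarrow> 0) (at 1)"
  proof (rule Lim_null_comparison)
    show "\<forall>\<^sub>F b in at 1. norm (jtheta b Q * rest b) \<le> norm (jtheta b Q) * M"
      using ev by eventually_elim (auto simp: norm_mult intro!: mult_left_mono)
    show "((\<lambda>b. norm (jtheta b Q) * M) \<longlongrightarrow> 0) (at 1)"
      using tendsto_mult_right[OF tendsto_norm[OF t0], of M] by (simp add: mult.commute)
  qed
  then have "((\<lambda>b. - (jtheta b Q / (1 - b)) + jtheta b Q * rest b) \<longlongrightarrow> - (qpoch_inf Q Q ^ 3) + 0) (at 1)"
    by (intro tendsto_add tendsto_minus jtheta_over_1_minus Q)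
  moreover have "\<forall>\<^sub>F b in at 1. - (jtheta b Q / (1 - b)) + jtheta b Q * rest b = jtheta b Q * lerch b 1 Q"
    using ev by eventually_elim simp
  ultimately show ?thesis using Lim_transform_eventually by fastforce
qed

text \<open>The left side is constant in \<open>b\<close> by \<open>lerch_1_ratio\<close>, hence
  equal to its limit at 1. It is the partial fraction expansion of the reciprocal theta
  function.\<close>

lemma jtheta_lerch_1:
  assumes Q: "Q \<noteq> 0" "norm Q < 1" and b: "b \<noteq> 0" "\<And>r::int. Q powi r * b \<noteq> 1"
  shows "jtheta b Q * lerch b 1 Q = - (qpoch_inf Q Q ^ 3)"
proof -
  have "1 / b \<noteq> 0" using b by simp
  have "\<And>r::int. Q powi r * (1 / b) \<noteq> 1"
  proof
    fix r :: int assume "Q powi r * (1 / b) = 1"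
    then have "Q powi (- r) * b = 1" using Q b by (simp add: power_int_minus field_simps)
    then show False using b by blast
  qed
  then have "jtheta (1 / b) Q \<noteq> 0" using b by (intro jtheta_nonzero Q) auto
  moreover have "((\<lambda>b'. jtheta (b' / b) Q) \<longlongrightarrow> jtheta (1 / b) Q) (at 1)"
  proof -
    have "isCont (\<lambda>b'. b' / b) 1" using b by (intro continuous_intros)
    moreover have "isCont (\<lambda>z. jtheta z Q) (1 / b)" using b by (intro isCont_jtheta Q) auto
    ultimately have "isCont (\<lambda>b'. jtheta (b' / b) Q) 1" by (rule isCont_o2)
    then show ?thesis by (simp add: isCont_def)
  qed
  \<comment> \<open>\<open>lerch_1_ratio\<close> will be used with \<open>c = b' / b\<close> and
    asks for a nonzero theta there; continuity provides it near \<open>b' = 1\<close>.\<close>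
  ultimately have "\<forall>\<^sub>F b' in at 1. jtheta (b' / b) Q \<noteq> 0"
    by (rule tendsto_imp_eventually_ne[rotated])
  then have "\<forall>\<^sub>F b' in at 1. jtheta b' Q * lerch b' 1 Q = jtheta b Q * lerch b 1 Q"
    using eventually_near_1[OF Q]
  proof eventually_elim
    case (elim b')
    have "Q powi r * b' \<noteq> 1" for r
    proof (cases "r = 0")
      case False
      then have "norm (1 - Q powi ((r + 1) - 1) * b') \<ge> (1 - norm Q) / 2"
        using elim by (metis add_cancel_left_left)
      then show ?thesis using Q by auto
    qed (use elim in auto)
    then show ?case
      using lerch_1_ratio[of Q "b' / b" b] Q b elim by simp
  qed
  then have "((\<lambda>b'. jtheta b' Q * lerch b' 1 Q) \<longlongrightarrow> jtheta b Q * lerch b 1 Q) (at 1)"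
    by (rule tendsto_eventually)
  then show ?thesis
    using jtheta_lerch_1_tendsto[OF Q] tendsto_unique[of "at (1::complex)"] by (metis at_neq_bot)
qed

text \<open>At \<open>w = 1\<close> the first product drops out and \<open>jtheta_lerch_1\<close>
  evaluates the second, which fixes \<open>K\<close>. Divided by the two thetas on the left, this is
  the change of parameter formula for \<open>m\<close>.\<close>

theorem lerch_change:
  assumes Q: "Q \<noteq> 0" "norm Q < 1" and c: "c \<noteq> 0" and b: "b \<noteq> 0" and w: "w \<noteq> 0"
    and nb: "\<And>r::int. Q powi r * b \<noteq> 1" and ncb: "\<And>r::int. Q powi r * (c * b) \<noteq> 1"
  shows "jtheta w Q * lerch (c * b) (c * w) Q - jtheta (c * w) Q * lerch b w Q =
    w * jtheta c Q * qpoch_inf Q Q ^ 3 * jtheta (c * b * w) Q / (jtheta b Q * jtheta (c * b) Q)"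
proof -
  obtain K where K: "\<And>w. w \<noteq> 0 \<Longrightarrow>
    jtheta w Q * lerch (c * b) (c * w) Q - jtheta (c * w) Q * lerch b w Q = K * w * jtheta (c * b * w) Q"
    using lerch_relation[OF Q c b nb ncb] by blast
  have nz: "jtheta b Q \<noteq> 0" "jtheta (c * b) Q \<noteq> 0" using jtheta_nonzero[OF Q] b c nb ncb by auto
  have l: "lerch b 1 Q = - (qpoch_inf Q Q ^ 3) / jtheta b Q"
    using jtheta_lerch_1[OF Q b nb] nz by (simp add: field_simps)
  have "K * jtheta (c * b) Q = - (jtheta c Q * lerch b 1 Q)"
    using K[of 1] Q by simp
  then have "K = jtheta c Q * qpoch_inf Q Q ^ 3 / (jtheta b Q * jtheta (c * b) Q)"
    unfolding l using nz by (simp add: eq_divide_eq mult_ac)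
  then show ?thesis using K[OF w] by simp
qed

subsection \<open>Eta quotients\<close>

lemma Jq_power: "Jq (q ^ a) m = Jq q (a * m)"
  by (simp add: Jq_def power_mult)

lemma qpoch_Jq: "qpoch_inf Q Q = Jq Q 1"
  by (simp add: Jq_def)

lemma Jq_nonzero:
  assumes "norm q < 1" "m > 0"
  shows "Jq q m \<noteq> 0"
  unfolding Jq_def by (intro qpoch_self_nonzero norm_power_lt_1 assms)

lemma qpoch_bisect:
  assumes "norm q < 1"
  shows "qpoch_inf x q = qpoch_inf x (q ^ 2) * qpoch_inf (x * q) (q ^ 2)"
proof -
  have 2: "norm (q ^ 2) < 1" using assms by (intro norm_power_lt_1) auto
  have eq: "(\<Prod>k<2 * n. 1 - x * q ^ k) = (\<Prod>k<n. 1 - x * (q ^ 2) ^ k) * (\<Prod>k<n. 1 - x * q * (q ^ 2) ^ k)" for n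
    by (induction n) (simp_all add: mult_ac flip: power_mult)
  have "(\<lambda>n. \<Prod>k<2 * n. 1 - x * q ^ k) \<longlonglongrightarrow> qpoch_inf x q"
    using LIMSEQ_subseq_LIMSEQ[OF qpoch_LIMSEQ[OF assms, of x], of "\<lambda>n. 2 * n"] by (simp add: strict_mono_def o_def)
  moreover have "(\<lambda>n. \<Prod>k<2 * n. 1 - x * q ^ k) \<longlonglongrightarrow> qpoch_inf x (q ^ 2) * qpoch_inf (x * q) (q ^ 2)"
    unfolding eq by (intro tendsto_mult qpoch_LIMSEQ 2)
  ultimately show ?thesis by (rule LIMSEQ_unique)
qed

lemma qpoch_trisect:
  assumes "norm q < 1"
  shows "qpoch_inf x q = qpoch_inf x (q ^ 3) * qpoch_inf (x * q) (q ^ 3) * qpoch_inf (x * q ^ 2) (q ^ 3)"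
proof -
  have 3: "norm (q ^ 3) < 1" using assms by (intro norm_power_lt_1) auto
  have eq: "(\<Prod>k<3 * n. 1 - x * q ^ k) = (\<Prod>k<n. 1 - x * (q ^ 3) ^ k) * (\<Prod>k<n. 1 - x * q * (q ^ 3) ^ k) * (\<Prod>k<n. 1 - x * q ^ 2 * (q ^ 3) ^ k)" for n
  proof (induction n)
    case (Suc n)
    have s: "3 * Suc n = Suc (Suc (Suc (3 * n)))" by simp
    have "q ^ Suc (3 * n) = q * q ^ (3 * n)" "q ^ Suc (Suc (3 * n)) = q ^ 2 * q ^ (3 * n)"
      by (simp_all add: power2_eq_square)
    then show ?case using Suc.IH unfolding s prod.lessThan_Suc by (simp add: mult_ac flip: power_mult)
  qed simp
  have "(\<lambda>n. \<Prod>k<3 * n. 1 - x * q ^ k) \<longlonglongrightarrow> qpoch_inf x q"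
    using LIMSEQ_subseq_LIMSEQ[OF qpoch_LIMSEQ[OF assms, of x], of "\<lambda>n. 3 * n"] by (simp add: strict_mono_def o_def)
  moreover have "(\<lambda>n. \<Prod>k<3 * n. 1 - x * q ^ k) \<longlonglongrightarrow> qpoch_inf x (q ^ 3) * qpoch_inf (x * q) (q ^ 3) * qpoch_inf (x * q ^ 2) (q ^ 3)"
    unfolding eq by (intro tendsto_mult qpoch_LIMSEQ 3)
  ultimately show ?thesis by (rule LIMSEQ_unique)
qed

lemma qpoch_neg:
  assumes "norm q < 1"
  shows "qpoch_inf x q * qpoch_inf (- x) q = qpoch_inf (x ^ 2) (q ^ 2)"
proof -
  have 2: "norm (q ^ 2) < 1" using assms by (intro norm_power_lt_1) auto
  have eq: "(\<Prod>k<n. 1 - x * q ^ k) * (\<Prod>k<n. 1 - (- x) * q ^ k) = (\<Prod>k<n. 1 - x ^ 2 * (q ^ 2) ^ k)" for n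
    unfolding prod.distrib[symmetric]
    by (intro prod.cong refl) (simp add: algebra_simps power2_eq_square power_mult_distrib)
  have "(\<lambda>n. (\<Prod>k<n. 1 - x * q ^ k) * (\<Prod>k<n. 1 - (- x) * q ^ k)) \<longlonglongrightarrow> qpoch_inf x q * qpoch_inf (- x) q"
    by (intro tendsto_mult qpoch_LIMSEQ assms)
  then show ?thesis unfolding eq using qpoch_LIMSEQ[OF 2, of "x ^ 2"] LIMSEQ_unique by blast
qed

section \<open>Products over the cube roots of unity\<close>

text \<open>Through \<open>sq\<close> the locale is also interpreted at \<open>\<omega> ^ 2\<close>,
  so each twisted evaluation comes together with its conjugate.\<close>

locale cube_root =
  fixes \<omega> :: complex
  assumes cube: "\<omega> ^ 3 = 1" and ne1: "\<omega> \<noteq> 1"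
begin

lemma nz: "\<omega> \<noteq> 0" using cube by auto

lemma quad: "\<omega> ^ 2 = - 1 - \<omega>"
proof -
  have "(\<omega> - 1) * (\<omega> ^ 2 + \<omega> + 1) = 0" using cube by (simp add: algebra_simps eval_nat_numeral)
  then have "\<omega> ^ 2 + \<omega> + 1 = 0" using ne1 by simp
  then show ?thesis by (simp add: algebra_simps eq_neg_iff_add_eq_0)
qed

lemma inv: "1 / \<omega> = \<omega> ^ 2" "inverse \<omega> = \<omega> ^ 2" "x / \<omega> = x * \<omega> ^ 2" "x / \<omega> ^ 2 = x * \<omega>"
  using cube nz by (simp_all add: field_simps eval_nat_numeral)

lemma sq: "cube_root (\<omega> ^ 2)"
proof
  have "(\<omega> ^ 2) ^ 3 = (\<omega> ^ 3) ^ 2" by (simp flip: power_mult)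
  then show "(\<omega> ^ 2) ^ 3 = 1" using cube by simp
  show "\<omega> ^ 2 \<noteq> 1"
  proof
    assume "\<omega> ^ 2 = 1"
    then have "\<omega> ^ 3 = \<omega>" by (simp add: eval_nat_numeral)
    then show False using cube ne1 by simp
  qed
qed

lemma norm1: "norm \<omega> = 1"
proof -
  have "norm \<omega> ^ 3 = 1" using cube by (metis norm_one norm_power)
  then show ?thesis using power_eq_imp_eq_base[of "norm \<omega>" 3 1] by simp
qed

lemma cubic: "(1 - y) * (1 - \<omega> * y) * (1 - \<omega> ^ 2 * y) = 1 - y ^ 3"
proof -
  have "(1 - y) * (1 - \<omega> * y) * (1 - \<omega> ^ 2 * y) = 1 - (1 + \<omega> + \<omega> ^ 2) * y + (\<omega> + \<omega> ^ 2 + \<omega> ^ 3) * y ^ 2 - \<omega> ^ 3 * y ^ 3"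
    by (simp add: algebra_simps eval_nat_numeral)
  then show ?thesis unfolding cube quad by simp
qed

lemma qpoch_cube:
  assumes "norm q < 1"
  shows "qpoch_inf x q * qpoch_inf (\<omega> * x) q * qpoch_inf (\<omega> ^ 2 * x) q = qpoch_inf (x ^ 3) (q ^ 3)"
proof -
  have 3: "norm (q ^ 3) < 1" using assms by (intro norm_power_lt_1) auto
  have eq: "(\<Prod>k<n. 1 - x * q ^ k) * (\<Prod>k<n. 1 - \<omega> * x * q ^ k) * (\<Prod>k<n. 1 - \<omega> ^ 2 * x * q ^ k) = (\<Prod>k<n. 1 - x ^ 3 * (q ^ 3) ^ k)" for n
    unfolding prod.distrib[symmetric]
  proof (intro prod.cong refl)
    fix k
    show "(1 - x * q ^ k) * (1 - \<omega> * x * q ^ k) * (1 - \<omega> ^ 2 * x * q ^ k) = 1 - x ^ 3 * (q ^ 3) ^ k"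
      using cubic[of "x * q ^ k"] by (simp add: power_mult_distrib power_mult[symmetric] mult_ac)
  qed
  have "(\<lambda>n. (\<Prod>k<n. 1 - x * q ^ k) * (\<Prod>k<n. 1 - \<omega> * x * q ^ k) * (\<Prod>k<n. 1 - \<omega> ^ 2 * x * q ^ k))
      \<longlonglongrightarrow> qpoch_inf x q * qpoch_inf (\<omega> * x) q * qpoch_inf (\<omega> ^ 2 * x) q"
    by (intro tendsto_mult qpoch_LIMSEQ assms)
  then show ?thesis unfolding eq using qpoch_LIMSEQ[OF 3, of "x ^ 3"] LIMSEQ_unique by blast
qed

text \<open>Multiplying a theta by its two rotations leaves a function of \<open>x ^ 3\<close>; this
  is what removes \<open>Y\<close> from denominators once \<open>Y ^ 3\<close> is known.\<close>

lemma jtheta_cube: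
  assumes "norm q < 1" "x \<noteq> 0"
  shows "jtheta x q * jtheta (\<omega> * x) q * jtheta (\<omega> ^ 2 * x) q * Jq q 3 = jtheta (x ^ 3) (q ^ 3) * Jq q 1 ^ 3"
proof -
  have e: "q / (\<omega> * x) = \<omega> ^ 2 * (q / x)" "q / (\<omega> ^ 2 * x) = \<omega> * (q / x)"
    using cube nz assms by (simp_all add: field_simps eval_nat_numeral)
  have "jtheta x q * jtheta (\<omega> * x) q * jtheta (\<omega> ^ 2 * x) q =
     (qpoch_inf x q * qpoch_inf (\<omega> * x) q * qpoch_inf (\<omega> ^ 2 * x) q) *
     (qpoch_inf (q / x) q * qpoch_inf (\<omega> * (q / x)) q * qpoch_inf (\<omega> ^ 2 * (q / x)) q) * qpoch_inf q q ^ 3"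
    unfolding jtheta_def e by (simp add: eval_nat_numeral)
  then show ?thesis
    unfolding qpoch_cube[OF assms(1)] jtheta_def by (simp add: Jq_def power_divide)
qed

lemma jtheta_omega:
  assumes "norm q < 1"
  shows "jtheta \<omega> q = (1 - \<omega>) * Jq q 3"
proof -
  have "jtheta \<omega> q = (1 - \<omega>) * (qpoch_inf q q * qpoch_inf (\<omega> * q) q * qpoch_inf (\<omega> ^ 2 * q) q)"
    unfolding jtheta_def qpoch_Suc[OF assms, of \<omega>] inv by (simp add: mult_ac)
  then show ?thesis unfolding qpoch_cube[OF assms] by (simp add: Jq_def)
qed

end

lemma jtheta_neg:
  assumes "norm q < 1"
  shows "jtheta x q * jtheta (- x) q * Jq q 2 = jtheta (x ^ 2) (q ^ 2) * Jq q 1 ^ 2"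
proof -
  have "jtheta x q * jtheta (- x) q =
     (qpoch_inf x q * qpoch_inf (- x) q) * (qpoch_inf (q / x) q * qpoch_inf (- (q / x)) q) * qpoch_inf q q ^ 2"
    unfolding jtheta_def by (simp add: power2_eq_square)
  then show ?thesis
    unfolding qpoch_neg[OF assms] jtheta_def by (simp add: Jq_def power_divide)
qed

lemma jtheta_bisect:
  assumes "norm q < 1" "q \<noteq> 0"
  shows "jtheta x q * Jq q 2 ^ 2 = jtheta x (q ^ 2) * jtheta (q * x) (q ^ 2) * Jq q 1"
proof -
  have "q / x * q = q ^ 2 / x" "q ^ 2 / (q * x) = q / x"
    using assms by (auto simp: power2_eq_square)
  then show ?thesis
    unfolding jtheta_def qpoch_bisect[OF assms(1), of x] qpoch_bisect[OF assms(1), of "q / x"]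
    by (simp add: Jq_def mult_ac power2_eq_square)
qed

text \<open>Take \<open>y = q * x ^ 2\<close> in \<open>theta_product_third\<close>: two of the
  constant thetas become \<open>J_2\<close> and the third is \<open>j(q^6; q^6) = 0\<close>. Then
  \<open>jtheta_neg\<close> and \<open>jtheta_bisect\<close> turn the product on the left into the
  quotient.\<close>

lemma quintuple_product:
  assumes q: "q \<noteq> 0" "norm q < 1" and x: "x \<noteq> 0" and nz: "jtheta (- x) q \<noteq> 0"
  shows "jtheta (x ^ 2) q / jtheta (- x) q = (jtheta (- (q * x ^ 3)) (q ^ 3) - x * jtheta (- (q ^ 2 * x ^ 3)) (q ^ 3)) / Jq q 1"
proof -
  have e2: "jtheta (q ^ 2) (q ^ 6) = Jq q 2" and e4: "jtheta (q ^ 4) (q ^ 6) = Jq q 2" and e6: "jtheta (q ^ 6) (q ^ 6) = 0"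
  proof -
    have n2: "norm (q ^ 2) < 1" using q by (intro norm_power_lt_1) auto
    show "jtheta (q ^ 2) (q ^ 6) = Jq q 2"
      using qpoch_trisect[OF n2, of "q ^ 2"] q
      by (simp add: jtheta_def Jq_def power_diff[symmetric] flip: power_mult power_add)
    then show "jtheta (q ^ 4) (q ^ 6) = Jq q 2"
      using jtheta_flip[of "q ^ 6" "q ^ 2"] q by (simp add: power_diff[symmetric])
    show "jtheta (q ^ 6) (q ^ 6) = 0"
      using jtheta_flip[of "q ^ 6" 1] q jtheta_1[of "q ^ 6"] norm_power_lt_1[of q 6] by simp
  qed
  have d: "q ^ 3 * x ^ 2 / (q * x ^ 2) = q ^ 2" "q ^ 5 * x ^ 2 / (q * x ^ 2) = q ^ 4" "q ^ 7 * x ^ 2 / (q * x ^ 2) = q ^ 6"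
    "x * (q * x ^ 2) = q * x ^ 3" "q * x * (q * x ^ 2) = q ^ 2 * x ^ 3"
    using q x by (simp_all add: eval_nat_numeral)
  have A: "jtheta x q * jtheta (q * x ^ 2) (q ^ 2) = Jq q 2 * (jtheta (- (q * x ^ 3)) (q ^ 3) - x * jtheta (- (q ^ 2 * x ^ 3)) (q ^ 3))"
    using theta_product_third[OF q x, of "q * x ^ 2"] q x unfolding d e2 e4 e6 by (simp add: algebra_simps)
  have J: "Jq q 1 \<noteq> 0" "Jq q 2 \<noteq> 0" using q Jq_nonzero by auto
  have "jtheta (x ^ 2) q * Jq q 2 ^ 2 * Jq q 1 = (jtheta (x ^ 2) (q ^ 2) * Jq q 1 ^ 2) * jtheta (q * x ^ 2) (q ^ 2)"
    using jtheta_bisect[OF q(2,1), of "x ^ 2"] by (simp add: power2_eq_square)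
  also have "\<dots> = jtheta (- x) q * Jq q 2 * (jtheta x q * jtheta (q * x ^ 2) (q ^ 2))"
    unfolding jtheta_neg[OF q(2), symmetric] by simp
  finally have "jtheta (x ^ 2) q * Jq q 1 = jtheta (- x) q * (jtheta (- (q * x ^ 3)) (q ^ 3) - x * jtheta (- (q ^ 2 * x ^ 3)) (q ^ 3))"
    unfolding A using J by (simp add: power2_eq_square)
  then show ?thesis using J nz by (simp add: field_simps)
qed

section \<open>Theta values that are eta quotients\<close>

lemma qpoch_minus_self:
  assumes "norm q < 1"
  shows "qpoch_inf (- q) q = Jq q 2 / Jq q 1"
  using qpoch_neg[OF assms, of q] Jq_nonzero[OF assms, of 1] by (simp add: Jq_def field_simps)

lemma qpoch_odd:
  assumes "norm q < 1"
  shows "qpoch_inf q (q ^ 2) = Jq q 1 / Jq q 2"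
  using qpoch_bisect[OF assms, of q] Jq_nonzero[OF assms, of 2] by (simp add: Jq_def field_simps power2_eq_square)

lemma qpoch_minus_odd:
  assumes "norm q < 1"
  shows "qpoch_inf (- q) (q ^ 2) = Jq q 2 ^ 2 / (Jq q 1 * Jq q 4)"
proof -
  have n2: "norm (q ^ 2) < 1" using assms by (intro norm_power_lt_1) auto
  have "qpoch_inf q (q ^ 2) * qpoch_inf (- q) (q ^ 2) = qpoch_inf (q ^ 2) ((q ^ 2) ^ 2)"
    using qpoch_neg[OF n2, of q] by simp
  also have "\<dots> = Jq q 2 / Jq q 4" using qpoch_odd[OF n2] by (simp add: Jq_power)
  finally show ?thesis
    using Jq_nonzero[OF assms, of 1] Jq_nonzero[OF assms, of 2] Jq_nonzero[OF assms, of 4]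
    unfolding qpoch_odd[OF assms] by (simp add: field_simps power2_eq_square)
qed

lemma jtheta_minus_1:
  assumes "norm q < 1"
  shows "jtheta (- 1) q = 2 * Jq q 2 ^ 2 / Jq q 1"
  using qpoch_Suc[OF assms, of "- 1"] qpoch_minus_self[OF assms] Jq_nonzero[OF assms, of 1]
  by (simp add: jtheta_def qpoch_Jq power2_eq_square)

lemma jtheta_half:
  assumes "norm q < 1" "q \<noteq> 0"
  shows "jtheta q (q ^ 2) = Jq q 1 ^ 2 / Jq q 2"
proof -
  have "q ^ 2 / q = q" using assms by (simp add: power2_eq_square)
  then have "jtheta q (q ^ 2) = qpoch_inf q (q ^ 2) * qpoch_inf q (q ^ 2) * Jq q 2"
    unfolding jtheta_def Jq_def by simp
  then show ?thesis
    unfolding qpoch_odd[OF assms(1)] using Jq_nonzero[OF assms(1), of 2] by (simp add: power2_eq_square)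
qed

lemma jtheta_minus_half:
  assumes "norm q < 1" "q \<noteq> 0"
  shows "jtheta (- q) (q ^ 2) = Jq q 2 ^ 5 / (Jq q 1 ^ 2 * Jq q 4 ^ 2)"
proof -
  have n2: "norm (q ^ 2) < 1" using assms by (intro norm_power_lt_1) auto
  have "Jq q 1 ^ 2 / Jq q 2 * jtheta (- q) (q ^ 2) * Jq q 4 = Jq q 2 ^ 2 / Jq q 4 * Jq q 2 ^ 2"
    using jtheta_neg[OF n2, of q] jtheta_half[OF assms] jtheta_half[OF n2] assms by (simp add: Jq_power)
  then show ?thesis using Jq_nonzero[OF assms(1)] by (simp add: field_simps eval_nat_numeral)
qed

lemma jtheta_third:
  assumes "norm q < 1" "q \<noteq> 0"
  shows "jtheta q (q ^ 3) = Jq q 1"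
proof -
  have "q ^ 3 / q = q * q" "q * q ^ 2 = q ^ 3" using assms by (simp_all add: eval_nat_numeral)
  then show ?thesis
    using qpoch_trisect[OF assms(1), of q] by (simp add: jtheta_def Jq_def)
qed

lemma jtheta_minus_third:
  assumes "norm q < 1" "q \<noteq> 0"
  shows "jtheta (- q) (q ^ 3) = Jq q 2 * Jq q 3 ^ 2 / (Jq q 1 * Jq q 6)"
proof -
  have n: "norm (q ^ 3) < 1" "norm (q ^ 2) < 1" using assms by (auto intro!: norm_power_lt_1)
  have "(q ^ 3) ^ 2 = (q ^ 2) ^ 3" by (simp flip: power_mult)
  then have "Jq q 1 * jtheta (- q) (q ^ 3) * Jq q 6 = Jq q 2 * Jq q 3 ^ 2"
    using jtheta_neg[OF n(1), of q] jtheta_third[OF assms] jtheta_third[OF n(2)] assms by (simp add: Jq_power)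
  then show ?thesis using Jq_nonzero[OF assms(1)] by (simp add: field_simps)
qed

lemma jtheta_sixth:
  assumes "norm q < 1" "q \<noteq> 0"
  shows "jtheta q (q ^ 6) = Jq q 1 * Jq q 6 ^ 2 / (Jq q 2 * Jq q 3)"
proof -
  have n: "norm (q ^ 3) < 1" "norm (q ^ 2) < 1" using assms by (auto intro!: norm_power_lt_1)
  have "jtheta (q ^ 4) (q ^ 6) = jtheta (q ^ 2) (q ^ 6)"
    using jtheta_flip[of "q ^ 6" "q ^ 2"] assms by (simp add: power_diff[symmetric])
  also have "\<dots> = Jq q 2" using jtheta_third[OF n(2)] assms by (simp add: Jq_power flip: power_mult)
  finally have "Jq q 1 * Jq q 6 ^ 2 = jtheta q (q ^ 6) * Jq q 2 * Jq q 3"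
    using jtheta_bisect[OF n(1), of q] jtheta_third[OF assms] assms
    by (simp add: Jq_power flip: power_mult power_Suc2)
  then show ?thesis using Jq_nonzero[OF assms(1)] by (simp add: field_simps)
qed

lemma jtheta_minus_sixth:
  assumes "norm q < 1" "q \<noteq> 0"
  shows "jtheta (- q) (q ^ 6) = Jq q 2 ^ 2 * Jq q 3 * Jq q 12 / (Jq q 1 * Jq q 4 * Jq q 6)"
proof -
  have n: "norm (q ^ 6) < 1" "norm (q ^ 2) < 1" using assms by (auto intro!: norm_power_lt_1)
  have "(q ^ 6) ^ 2 = (q ^ 2) ^ 6" by (simp flip: power_mult)
  then have "Jq q 1 * Jq q 6 ^ 2 / (Jq q 2 * Jq q 3) * jtheta (- q) (q ^ 6) * Jq q 12 =
      Jq q 2 * Jq q 12 ^ 2 / (Jq q 4 * Jq q 6) * Jq q 6 ^ 2"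
    using jtheta_neg[OF n(1), of q] jtheta_sixth[OF assms] jtheta_sixth[OF n(2)] assms by (simp add: Jq_power)
  then show ?thesis using Jq_nonzero[OF assms(1)] by (simp add: field_simps eval_nat_numeral)
qed

context cube_root begin

lemma one_plus: "1 + \<omega> = - (\<omega> ^ 2)" using quad by simp

lemma one_minus_sq: "1 - \<omega> ^ 2 = (1 - \<omega>) * (1 + \<omega>)" by (simp add: algebra_simps power2_eq_square)

lemma jtheta_minus_omega:
  assumes "norm q < 1"
  shows "jtheta (- \<omega>) q = (1 + \<omega>) * (Jq q 1 ^ 2 * Jq q 6 / (Jq q 2 * Jq q 3))"
proof -
  interpret s: cube_root "\<omega> ^ 2" by (rule sq)
  have n: "norm (q ^ 2) < 1" using assms by (auto intro!: norm_power_lt_1)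
  have "(1 - \<omega>) * Jq q 3 * jtheta (- \<omega>) q * Jq q 2 = (1 - \<omega> ^ 2) * Jq q 6 * Jq q 1 ^ 2"
    using jtheta_neg[OF assms, of \<omega>] jtheta_omega[OF assms] s.jtheta_omega[OF n] by (simp add: Jq_power)
  then have "(1 - \<omega>) * (Jq q 3 * jtheta (- \<omega>) q * Jq q 2) = (1 - \<omega>) * ((1 + \<omega>) * Jq q 6 * Jq q 1 ^ 2)"
    unfolding one_minus_sq by (simp add: mult_ac)
  then have "Jq q 3 * jtheta (- \<omega>) q * Jq q 2 = (1 + \<omega>) * Jq q 6 * Jq q 1 ^ 2" using ne1 by simp
  then show ?thesis using Jq_nonzero[OF assms(1)] by (simp add: field_simps)
qed

text \<open>The two factors of the theta carry \<open>\<omega>\<close> and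
  \<open>\<omega> ^ 2\<close>. Supplying the factor of the trivial root completes a product in base
  \<open>q ^ 6\<close>, so the value is free of \<open>\<omega>\<close>.\<close>

lemma jtheta_minus_omega_half:
  assumes "norm q < 1" "q \<noteq> 0"
  shows "jtheta (- (\<omega> * q)) (q ^ 2) = Jq q 1 * Jq q 4 * Jq q 6 ^ 2 / (Jq q 2 * Jq q 3 * Jq q 12)"
proof -
  have n: "norm (q ^ 2) < 1" "norm (q ^ 3) < 1" using assms by (auto intro!: norm_power_lt_1)
  have c: "qpoch_inf (- q) (q ^ 2) * qpoch_inf (- (\<omega> * q)) (q ^ 2) * qpoch_inf (- (\<omega> ^ 2 * q)) (q ^ 2) = qpoch_inf (- (q ^ 3)) ((q ^ 3) ^ 2)"
    using qpoch_cube[OF n(1), of "- q"] by (simp flip: power_mult)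
  have e: "q ^ 2 / (- (\<omega> * q)) = - (\<omega> ^ 2 * q)"
    using assms nz cube by (simp add: field_simps eval_nat_numeral)
  have "qpoch_inf (- q) (q ^ 2) * jtheta (- (\<omega> * q)) (q ^ 2) = Jq q 2 * qpoch_inf (- (q ^ 3)) ((q ^ 3) ^ 2)"
    unfolding c[symmetric] jtheta_def e by (simp add: qpoch_Jq[of "q ^ 2"] Jq_power)
  then show ?thesis
    unfolding qpoch_minus_odd[OF n(2)] qpoch_minus_odd[OF assms(1)] Jq_power
    using Jq_nonzero[OF assms(1)] by (simp add: field_simps power2_eq_square)
qed

end

subsection \<open>Trisections of eta quotients\<close>

text \<open>Expanding numeral exponents into products lets \<open>field_simps\<close> compare eta
  quotients as plain monomials.\<close>

lemmas expand_powers = power_numeral_even[unfolded Let_def] power_numeral_odd[unfolded Let_def]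

text \<open>The left side is Ramanujan's \<open>phi(-q) = j(q; q^2)\<close>. The last two pieces of
  its trisection agree after a flip and a shift by a period, hence the factor 2.\<close>

lemma phi_dissect:
  assumes "norm q < 1" "q \<noteq> 0"
  shows "Jq q 1 ^ 2 / Jq q 2 = Jq q 9 ^ 2 / Jq q 18 - 2 * q * (Jq q 3 * Jq q 18 ^ 2 / (Jq q 6 * Jq q 9))"
proof -
  have n: "norm (q ^ 2) < 1" "norm (q ^ 3) < 1" "norm (q ^ 9) < 1" "norm (q ^ 18) < 1"
    using assms by (auto intro!: norm_power_lt_1)
  have p: "(q ^ 2) ^ 3 * q ^ 3 = q ^ 9" "(q ^ 2) ^ 6 * q ^ 3 = q ^ 15" "(q ^ 2) ^ 9 * q ^ 3 = q ^ 18 * q ^ 3" "(q ^ 2) ^ 9 = q ^ 18"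
    by (simp_all flip: power_mult power_add)
  have a: "jtheta (q ^ 15) (q ^ 18) = jtheta (q ^ 3) (q ^ 18)"
    using jtheta_flip[of "q ^ 18" "q ^ 3"] assms by (simp add: power_diff[symmetric])
  have b: "jtheta (q ^ 18 * q ^ 3) (q ^ 18) = - jtheta (q ^ 3) (q ^ 18) / q ^ 3"
    using assms n by (intro jtheta_shift) auto
  have c: "jtheta (q ^ 9) (q ^ 18) = Jq q 9 ^ 2 / Jq q 18"
    using jtheta_half[OF n(3)] assms by (simp add: Jq_power flip: power_mult)
  have d: "jtheta (q ^ 3) (q ^ 18) = Jq q 3 * Jq q 18 ^ 2 / (Jq q 6 * Jq q 9)"
    using jtheta_sixth[OF n(2)] assms by (simp add: Jq_power flip: power_mult)
  have "Jq q 1 ^ 2 / Jq q 2 = jtheta q (q ^ 2)" using jtheta_half[OF assms] by simp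
  also have "\<dots> = jtheta (q ^ 9) (q ^ 18) - 2 * q * jtheta (q ^ 3) (q ^ 18)"
    using theta_trisect[OF _ n(1) assms(2)] assms unfolding p a b by (simp add: field_simps eval_nat_numeral)
  finally show ?thesis unfolding c d .
qed

text \<open>The left side is Ramanujan's \<open>psi(q)\<close>, half of \<open>j(-1; q)\<close>; for
  this reason the computation is done doubled.\<close>

lemma psi_dissect:
  assumes "norm q < 1" "q \<noteq> 0"
  shows "Jq q 2 ^ 2 / Jq q 1 = Jq q 6 * Jq q 9 ^ 2 / (Jq q 3 * Jq q 18) + q * (Jq q 18 ^ 2 / Jq q 9)"
proof -
  have n: "norm (q ^ 3) < 1" "norm (q ^ 9) < 1" using assms by (auto intro!: norm_power_lt_1)
  have a: "jtheta (- (q ^ 6)) (q ^ 9) = jtheta (- (q ^ 3)) (q ^ 9)"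
    using jtheta_flip[of "q ^ 9" "- (q ^ 3)"] assms by (simp add: power_diff[symmetric])
  have b: "jtheta (- (q ^ 9)) (q ^ 9) = 2 * Jq q 18 ^ 2 / Jq q 9"
    using jtheta_flip[of "q ^ 9" "- 1"] jtheta_minus_1[OF n(2)] assms by (simp add: Jq_power)
  have c: "jtheta (- (q ^ 3)) (q ^ 9) = Jq q 6 * Jq q 9 ^ 2 / (Jq q 3 * Jq q 18)"
    using jtheta_minus_third[OF n(1)] assms by (simp add: Jq_power flip: power_mult)
  have "2 * (Jq q 2 ^ 2 / Jq q 1) = jtheta (- 1) q" using jtheta_minus_1[OF assms(1)] by simp
  also have "\<dots> = 2 * jtheta (- (q ^ 3)) (q ^ 9) + q * jtheta (- (q ^ 9)) (q ^ 9)"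
    using theta_trisect[OF assms(2,1), of "- 1"] unfolding a[symmetric] by (simp add: a)
  finally have "2 * (Jq q 2 ^ 2 / Jq q 1) = 2 * (Jq q 6 * Jq q 9 ^ 2 / (Jq q 3 * Jq q 18) + q * (Jq q 18 ^ 2 / Jq q 9))"
    unfolding b c by (simp add: distrib_left)
  then show ?thesis by (rule mult_left_cancel[THEN iffD1, rotated]) simp
qed

text \<open>The ratio of the two pieces in \<open>phi_dissect\<close> and in
  \<open>psi_dissect\<close>, up to the factor -2 in the former:
  \<open>phi(-q) = phi(-q^9) (1 - 2 t)\<close> and \<open>psi(q) = j(-q^3; q^9) (1 + t)\<close>. All
  five dissections are expressed through \<open>t\<close> at \<open>q\<close>, \<open>q ^ 2\<close>,
  \<open>q ^ 4\<close>, except that of \<open>f\<close>, which is a direct trisection.\<close>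

definition tq :: "complex \<Rightarrow> complex" where "tq q = q * wq (q ^ 3)"

lemma tq_eq: "tq q = q * (Jq q 3 * Jq q 18 ^ 3 / (Jq q 6 * Jq q 9 ^ 3))"
  by (simp add: tq_def wq_def Jq_power)

lemma tq_power: "tq (q ^ k) = q ^ k * (Jq q (k * 3) * Jq q (k * 18) ^ 3 / (Jq q (k * 6) * Jq q (k * 9) ^ 3))"
  by (simp add: tq_eq Jq_power)

lemma one_minus_2tq:
  assumes "norm q < 1" "q \<noteq> 0"
  shows "1 - 2 * tq q = Jq q 1 ^ 2 * Jq q 18 / (Jq q 2 * Jq q 9 ^ 2)"
proof -
  have "Jq q 1 ^ 2 / Jq q 2 = Jq q 9 ^ 2 / Jq q 18 * (1 - 2 * tq q)"
    unfolding phi_dissect[OF assms] tq_eq using Jq_nonzero[OF assms(1)] by (simp add: field_simps expand_powers)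
  then show ?thesis using Jq_nonzero[OF assms(1)] by (simp add: field_simps expand_powers)
qed

lemma one_plus_tq:
  assumes "norm q < 1" "q \<noteq> 0"
  shows "1 + tq q = Jq q 2 ^ 2 * Jq q 3 * Jq q 18 / (Jq q 1 * Jq q 6 * Jq q 9 ^ 2)"
proof -
  have "Jq q 2 ^ 2 / Jq q 1 = Jq q 6 * Jq q 9 ^ 2 / (Jq q 3 * Jq q 18) * (1 + tq q)"
    unfolding psi_dissect[OF assms] tq_eq using Jq_nonzero[OF assms(1)] by (simp add: field_simps expand_powers)
  then show ?thesis using Jq_nonzero[OF assms(1)] by (simp add: field_simps expand_powers)
qed

lemma tq_nonzero: "norm q < 1 \<Longrightarrow> q \<noteq> 0 \<Longrightarrow> tq q \<noteq> 0"
  using Jq_nonzero by (simp add: tq_eq)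

text \<open>\<open>A(q)A(q\<^sup>2) + 2q\<psi>(q\<^sup>3)\<psi>(q\<^sup>6) = \<psi>(q)\<phi>(q)\<close> with
  \<open>A(q) = j(-q;q\<^sup>3)\<close>; a cube root of unity in the same specialisation replaces \<open>2\<close> by \<open>-4\<close>.\<close>
lemma theta_AA_psi:
  assumes "norm q < 1" "q \<noteq> 0" "e ^ 3 = (1 :: complex)"
  shows "q * (jtheta (- (e / q)) q * jtheta (- (e ^ 2 * q)) (q ^ 2)) =
    4 * q * (Jq q 6 ^ 2 / Jq q 3 * (Jq q 12 ^ 2 / Jq q 6))
    + (e + e ^ 2) * (Jq q 2 * Jq q 3 ^ 2 / (Jq q 1 * Jq q 6) * (Jq q 4 * Jq q 6 ^ 2 / (Jq q 2 * Jq q 12)))"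
proof -
  have n: "norm (q ^ 2) < 1" "norm (q ^ 3) < 1" "norm (q ^ 6) < 1" using assms by (auto intro!: norm_power_lt_1)
  have e0: "e \<noteq> 0" using assms(3) by auto
  have p: "- (e / q) * - (e ^ 2 * q) = 1" "q ^ 3 * (- (e / q)) ^ 2 / (- (e ^ 2 * q)) = - 1"
    "q * - (e / q) * - (e ^ 2 * q) = q" "q ^ 5 * (- (e / q)) ^ 2 / (- (e ^ 2 * q)) = - (q ^ 2)"
    "q ^ 2 * - (e / q) * - (e ^ 2 * q) = q ^ 2" "q ^ 7 * (- (e / q)) ^ 2 / (- (e ^ 2 * q)) = - (q ^ 4)"
    using assms e0 by (simp_all add: field_simps eval_nat_numeral)
  have a: "jtheta (- (q ^ 2)) (q ^ 3) = jtheta (- q) (q ^ 3)"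
    using jtheta_flip[of "q ^ 3" "- q"] assms by (simp add: eval_nat_numeral)
  have b: "jtheta (- (q ^ 4)) (q ^ 6) = jtheta (- (q ^ 2)) (q ^ 6)"
    using jtheta_flip[of "q ^ 6" "- (q ^ 2)"] assms by (simp add: power_diff[symmetric])
  have c: "jtheta (- (q ^ 2)) (q ^ 6) = Jq q 4 * Jq q 6 ^ 2 / (Jq q 2 * Jq q 12)"
    using jtheta_minus_third[OF n(1)] assms by (simp add: Jq_power flip: power_mult)
  have "jtheta (- (e / q)) q * jtheta (- (e ^ 2 * q)) (q ^ 2) =
    jtheta (- 1) (q ^ 3) * jtheta (- 1) (q ^ 6)
    + e / q * (jtheta (- q) (q ^ 3) * jtheta (- (q ^ 2)) (q ^ 6))
    + e ^ 2 / q * (jtheta (- q) (q ^ 3) * jtheta (- (q ^ 2)) (q ^ 6))"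
    using theta_product_third[OF assms(2,1), of "- (e / q)" "- (e ^ 2 * q)"] assms e0
    unfolding p a b by (simp add: power_divide power2_eq_square)
  then show ?thesis
    unfolding c jtheta_minus_1[OF n(2)] jtheta_minus_1[OF n(3)] jtheta_minus_third[OF assms(1,2)]
    using assms by (simp add: Jq_power field_simps)
qed

text \<open>The case \<open>e = 1\<close> of \<open>theta_AA_psi\<close> at \<open>q ^ 3\<close>. In
  the proof \<open>AA\<close> is \<open>A(q^3) A(q^6)\<close> and \<open>PP\<close> is
  \<open>psi(q^9) psi(q^18)\<close>, so that \<open>q ^ 3 * PP / AA\<close> is
  \<open>t(q) t(q^2)\<close>.\<close>

lemma one_plus_2u:
  assumes "norm q < 1" "q \<noteq> 0"
  shows "1 + 2 * (tq q * tq (q ^ 2)) =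
    Jq q 6 ^ 7 * Jq q 36 / (Jq q 3 ^ 2 * Jq q 9 ^ 2 * Jq q 12 ^ 3 * Jq q 18)"
proof -
  define Q where "Q = q ^ 3"
  have Q: "norm Q < 1" "Q \<noteq> 0" using assms by (auto simp: Q_def intro!: norm_power_lt_1)
  have "jtheta (- (1 / Q)) Q = jtheta (- Q) Q / Q"
    using jtheta_inverse[of Q "- Q"] Q by simp
  also have "jtheta (- Q) Q = 2 * Jq Q 2 ^ 2 / Jq Q 1"
    using jtheta_flip[of Q "- 1"] Q jtheta_minus_1[OF Q(1)] by simp
  finally have a: "jtheta (- (1 / Q)) Q = 2 * Jq Q 2 ^ 2 / Jq Q 1 / Q" .
  define AA where "AA = Jq q 6 * Jq q 9 ^ 2 / (Jq q 3 * Jq q 18) * (Jq q 12 * Jq q 18 ^ 2 / (Jq q 6 * Jq q 36))"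
  define PP where "PP = Jq q 18 ^ 2 / Jq q 9 * (Jq q 36 ^ 2 / Jq q 18)"
  have AA: "AA \<noteq> 0" using Jq_nonzero[OF assms(1)] by (simp add: AA_def)
  have u: "tq q * tq (q ^ 2) * AA = q ^ 3 * PP"
    unfolding tq_eq[of q] tq_power AA_def PP_def using Jq_nonzero[OF assms(1)]
    by (simp add: field_simps expand_powers)
  define F where "F = Jq q 6 ^ 2 / Jq q 3 * (Jq q 6 ^ 5 / (Jq q 3 ^ 2 * Jq q 12 ^ 2))"
  have "2 * F = Q * (jtheta (- (1 / Q)) Q * jtheta (- (1 ^ 2 * Q)) (Q ^ 2))"
    unfolding a power_one mult_1 jtheta_minus_half[OF Q] F_def using Q by (simp add: Q_def Jq_power)
  also have "\<dots> = 4 * q ^ 3 * PP + 2 * AA"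
    unfolding theta_AA_psi[OF Q power_one] AA_def PP_def by (simp add: Q_def Jq_power)
  finally have "2 * F = 2 * (AA + 2 * (q ^ 3 * PP))" by simp
  then have "F = AA + 2 * (q ^ 3 * PP)" by (rule mult_left_cancel[THEN iffD1, rotated]) simp
  then have "(1 + 2 * (tq q * tq (q ^ 2))) * AA = F" using u by (simp add: distrib_right mult.assoc)
  then have "1 + 2 * (tq q * tq (q ^ 2)) = F / AA" using AA by (simp add: eq_divide_eq)
  also have "\<dots> = Jq q 6 ^ 7 * Jq q 36 / (Jq q 3 ^ 2 * Jq q 9 ^ 2 * Jq q 12 ^ 3 * Jq q 18)"
    unfolding F_def AA_def using Jq_nonzero[OF assms(1)] by (simp add: field_simps expand_powers)
  finally show ?thesis .
qed

section \<open>Rotating \<open>q\<close>, and the modular equation for \<open>t\<close>\<close>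

context cube_root begin

lemma rot_power: "(\<omega> * q) ^ (3 * k) = q ^ (3 * k)"
  by (simp add: power_mult_distrib power_mult cube)

lemma Jq_rot: "Jq (\<omega> * q) (3 * k) = Jq q (3 * k)"
  unfolding Jq_def rot_power ..

text \<open>The eta factors of \<open>tq\<close> are functions of \<open>q ^ 3\<close>; only the
  leading \<open>q\<close> feels the rotation. Over the three rotations \<open>1 - c t\<close> hence
  multiplies up to \<open>1 - c ^ 3 t ^ 3\<close>.\<close>

lemma tq_rot: "tq (\<omega> * q) = \<omega> * tq q"
  using Jq_rot[of q 1] Jq_rot[of q 2] Jq_rot[of q 3] Jq_rot[of q 6] by (simp add: tq_eq)

text \<open>Split \<open>J_1\<close> by exponents modulo 3. The multiples of 3 are unchanged and
  give \<open>J_3 ^ 3\<close>; the other two classes multiply up to base \<open>q ^ 9\<close>, where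
  together with \<open>J_9\<close> they form another \<open>J_3\<close>.\<close>

lemma Jq_rot_1:
  assumes "norm q < 1"
  shows "Jq q 1 * Jq (\<omega> * q) 1 * Jq (\<omega> ^ 2 * q) 1 * Jq q 9 = Jq q 3 ^ 4"
proof -
  have n: "norm (q ^ 3) < 1" using assms by (auto intro!: norm_power_lt_1)
  have s: "Jq x 1 = qpoch_inf x (x ^ 3) * qpoch_inf (x ^ 2) (x ^ 3) * qpoch_inf (x ^ 3) (x ^ 3)" if "norm x < 1" for x
    using qpoch_trisect[OF that, of x] by (simp add: Jq_def eval_nat_numeral)
  have r: "norm (\<omega> * q) < 1" "norm (\<omega> ^ 2 * q) < 1" using assms by (simp_all add: norm_mult norm1 norm_power)
  have e: "(\<omega> * q) ^ 3 = q ^ 3" "(\<omega> ^ 2 * q) ^ 3 = q ^ 3" "(\<omega> * q) ^ 2 = \<omega> ^ 2 * q ^ 2" "(\<omega> ^ 2 * q) ^ 2 = \<omega> * q ^ 2"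
    using cube by (simp_all add: power_mult_distrib eval_nat_numeral) 
  have pw: "q ^ 3 * q ^ 3 = q ^ 6" "q ^ 3 * (q ^ 3) ^ 2 = q ^ 9" "(q ^ 3) ^ 3 = q ^ 9" "(q ^ 2) ^ 3 = q ^ 6"
    by (simp_all flip: power_mult power_add)
  have "Jq q 1 * Jq (\<omega> * q) 1 * Jq (\<omega> ^ 2 * q) 1 =
    (qpoch_inf q (q ^ 3) * qpoch_inf (\<omega> * q) (q ^ 3) * qpoch_inf (\<omega> ^ 2 * q) (q ^ 3)) *
    (qpoch_inf (q ^ 2) (q ^ 3) * qpoch_inf (\<omega> * q ^ 2) (q ^ 3) * qpoch_inf (\<omega> ^ 2 * q ^ 2) (q ^ 3)) * Jq q 3 ^ 3"
    unfolding s[OF assms] s[OF r(1)] s[OF r(2)] e by (simp add: Jq_def power3_eq_cube)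
  also have "\<dots> = qpoch_inf (q ^ 3) (q ^ 9) * qpoch_inf (q ^ 6) (q ^ 9) * Jq q 3 ^ 3"
    unfolding qpoch_cube[OF n] pw ..
  finally have *: "Jq q 1 * Jq (\<omega> * q) 1 * Jq (\<omega> ^ 2 * q) 1 = qpoch_inf (q ^ 3) (q ^ 9) * qpoch_inf (q ^ 6) (q ^ 9) * Jq q 3 ^ 3" .
  have "Jq q 3 = qpoch_inf (q ^ 3) (q ^ 9) * qpoch_inf (q ^ 6) (q ^ 9) * Jq q 9"
    using qpoch_trisect[OF n, of "q ^ 3"] unfolding pw by (simp add: Jq_def)
  then have "Jq q 3 ^ 4 = (qpoch_inf (q ^ 3) (q ^ 9) * qpoch_inf (q ^ 6) (q ^ 9) * Jq q 9) * Jq q 3 ^ 3"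
    by (simp add: expand_powers)
  then show ?thesis unfolding * by (simp add: mult_ac)
qed

lemma Jq_rot_2:
  assumes "norm q < 1"
  shows "Jq q 2 * Jq (\<omega> * q) 2 * Jq (\<omega> ^ 2 * q) 2 * Jq q 18 = Jq q 6 ^ 4"
proof -
  have n: "norm (q ^ 2) < 1" using assms by (auto intro!: norm_power_lt_1)
  have "(\<omega> * q) ^ 2 = \<omega> ^ 2 * q ^ 2" "(\<omega> ^ 2 * q) ^ 2 = \<omega> * q ^ 2"
    using cube by (simp_all add: power_mult_distrib eval_nat_numeral)
  then show ?thesis
    using Jq_rot_1[OF n] Jq_power[of "\<omega> * q" 2 1] Jq_power[of "\<omega> ^ 2 * q" 2 1] by (simp add: Jq_power mult_ac)
qed

lemma Jq_rot_const: "Jq (\<omega> * q) 9 = Jq q 9" "Jq (\<omega> ^ 2 * q) 9 = Jq q 9"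
  "Jq (\<omega> * q) 18 = Jq q 18" "Jq (\<omega> ^ 2 * q) 18 = Jq q 18" "Jq (\<omega> * q) 3 = Jq q 3" "Jq (\<omega> ^ 2 * q) 3 = Jq q 3"
  "Jq (\<omega> * q) 6 = Jq q 6" "Jq (\<omega> ^ 2 * q) 6 = Jq q 6"
  using Jq_rot[of q 1] Jq_rot[of q 2] Jq_rot[of q 3] Jq_rot[of q 6]
   cube_root.Jq_rot[OF sq, of q 1] cube_root.Jq_rot[OF sq, of q 2] cube_root.Jq_rot[OF sq, of q 3] cube_root.Jq_rot[OF sq, of q 6]
  by simp_all

text \<open>The product of \<open>1 - 2 t\<close> over the rotations of \<open>q\<close>; each
  factor is an eta quotient by \<open>one_minus_2tq\<close>.\<close>

lemma one_minus_8T: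
  assumes "norm q < 1" "q \<noteq> 0"
  shows "1 - 8 * tq q ^ 3 = Jq q 3 ^ 8 * Jq q 18 ^ 4 / (Jq q 6 ^ 4 * Jq q 9 ^ 8)"
proof -
  interpret s: cube_root "\<omega> ^ 2" by (rule sq)
  have r: "norm (\<omega> * q) < 1" "norm (\<omega> ^ 2 * q) < 1" "\<omega> * q \<noteq> 0" "\<omega> ^ 2 * q \<noteq> 0"
    using assms nz by (simp_all add: norm_mult norm1 norm_power)
  have "1 - 8 * tq q ^ 3 = (1 - 2 * tq q) * (1 - 2 * tq (\<omega> * q)) * (1 - 2 * tq (\<omega> ^ 2 * q))"
    using cubic[of "2 * tq q"] tq_rot[of q] s.tq_rot[of q] by (simp add: power_mult_distrib mult_ac)
  also have "\<dots> = (Jq q 1 * Jq (\<omega> * q) 1 * Jq (\<omega> ^ 2 * q) 1) ^ 2 * Jq q 18 ^ 3 /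
     ((Jq q 2 * Jq (\<omega> * q) 2 * Jq (\<omega> ^ 2 * q) 2) * Jq q 9 ^ 6)"
    unfolding one_minus_2tq[OF assms] one_minus_2tq[OF r(1,3)] one_minus_2tq[OF r(2,4)] Jq_rot_const
    by (simp add: field_simps expand_powers)
  also have "Jq q 1 * Jq (\<omega> * q) 1 * Jq (\<omega> ^ 2 * q) 1 = Jq q 3 ^ 4 / Jq q 9"
    using Jq_rot_1[OF assms(1)] Jq_nonzero[OF assms(1), of 9] by (simp add: field_simps)
  also have "Jq q 2 * Jq (\<omega> * q) 2 * Jq (\<omega> ^ 2 * q) 2 = Jq q 6 ^ 4 / Jq q 18"
    using Jq_rot_2[OF assms(1)] Jq_nonzero[OF assms(1), of 18] by (simp add: field_simps)
  finally show ?thesis using Jq_nonzero[OF assms(1)] by (simp add: field_simps expand_powers)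
qed

lemma one_plus_T:
  assumes "norm q < 1" "q \<noteq> 0"
  shows "1 + tq q ^ 3 = Jq q 6 ^ 5 * Jq q 18 / (Jq q 3 * Jq q 9 ^ 5)"
proof -
  interpret s: cube_root "\<omega> ^ 2" by (rule sq)
  have r: "norm (\<omega> * q) < 1" "norm (\<omega> ^ 2 * q) < 1" "\<omega> * q \<noteq> 0" "\<omega> ^ 2 * q \<noteq> 0"
    using assms nz by (simp_all add: norm_mult norm1 norm_power)
  have "1 + tq q ^ 3 = (1 + tq q) * (1 + tq (\<omega> * q)) * (1 + tq (\<omega> ^ 2 * q))"
    using cubic[of "- tq q"] tq_rot[of q] s.tq_rot[of q] by simp
  also have "\<dots> = (Jq q 2 * Jq (\<omega> * q) 2 * Jq (\<omega> ^ 2 * q) 2) ^ 2 * Jq q 3 ^ 3 * Jq q 18 ^ 3 /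
     ((Jq q 1 * Jq (\<omega> * q) 1 * Jq (\<omega> ^ 2 * q) 1) * Jq q 6 ^ 3 * Jq q 9 ^ 6)"
    unfolding one_plus_tq[OF assms] one_plus_tq[OF r(1,3)] one_plus_tq[OF r(2,4)] Jq_rot_const
    by (simp add: field_simps expand_powers)
  also have "Jq q 1 * Jq (\<omega> * q) 1 * Jq (\<omega> ^ 2 * q) 1 = Jq q 3 ^ 4 / Jq q 9"
    using Jq_rot_1[OF assms(1)] Jq_nonzero[OF assms(1), of 9] by (simp add: field_simps)
  also have "Jq q 2 * Jq (\<omega> * q) 2 * Jq (\<omega> ^ 2 * q) 2 = Jq q 6 ^ 4 / Jq q 18"
    using Jq_rot_2[OF assms(1)] Jq_nonzero[OF assms(1), of 18] by (simp add: field_simps)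
  finally show ?thesis using Jq_nonzero[OF assms(1)] by (simp add: field_simps expand_powers)
qed

text \<open>The case \<open>e = \<omega>\<close> of \<open>theta_AA_psi\<close>: now
  \<open>e + e ^ 2\<close> is -1 instead of 2, and the twisted thetas on the left are still eta
  quotients up to a power of \<open>\<omega>\<close>.\<close>

lemma one_minus_4u:
  assumes "norm q < 1" "q \<noteq> 0"
  shows "1 - 4 * (tq q * tq (q ^ 2)) = Jq q 3 ^ 4 * Jq q 18 ^ 2 / (Jq q 6 ^ 2 * Jq q 9 ^ 4)"
proof -
  define Q where "Q = q ^ 3"
  interpret s: cube_root "\<omega> ^ 2" by (rule sq)
  have Q: "norm Q < 1" "Q \<noteq> 0" using assms by (auto simp: Q_def intro!: norm_power_lt_1)
  have "1 / (- (\<omega> ^ 2 * Q)) = - (\<omega> / Q)" using Q nz cube by (simp add: field_simps eval_nat_numeral)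
  then have "jtheta (- (\<omega> / Q)) Q = jtheta (- (\<omega> ^ 2 * Q)) Q / (\<omega> ^ 2 * Q)"
    using jtheta_inverse[of Q "- (\<omega> ^ 2 * Q)"] Q nz by simp
  also have "jtheta (- (\<omega> ^ 2 * Q)) Q = jtheta (- \<omega>) Q"
    using jtheta_flip[of Q "- \<omega>"] Q nz by (simp add: inv mult.commute)
  finally have a: "jtheta (- (\<omega> / Q)) Q = (1 + \<omega>) * (Jq Q 1 ^ 2 * Jq Q 6 / (Jq Q 2 * Jq Q 3)) / (\<omega> ^ 2 * Q)"
    unfolding jtheta_minus_omega[OF Q(1)] .
  have "jtheta (- (\<omega> ^ 2 * Q)) (Q ^ 2) = Jq Q 1 * Jq Q 4 * Jq Q 6 ^ 2 / (Jq Q 2 * Jq Q 3 * Jq Q 12)"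
    using s.jtheta_minus_omega_half[OF Q] .
  define AA where "AA = Jq q 6 * Jq q 9 ^ 2 / (Jq q 3 * Jq q 18) * (Jq q 12 * Jq q 18 ^ 2 / (Jq q 6 * Jq q 36))"
  define PP where "PP = Jq q 18 ^ 2 / Jq q 9 * (Jq q 36 ^ 2 / Jq q 18)"
  have AA: "AA \<noteq> 0" using Jq_nonzero[OF assms(1)] by (simp add: AA_def)
  have u: "tq q * tq (q ^ 2) * AA = q ^ 3 * PP"
    unfolding tq_eq[of q] tq_power AA_def PP_def using Jq_nonzero[OF assms(1)]
    by (simp add: field_simps expand_powers)
  define F where "F = Jq q 3 ^ 2 * Jq q 18 / (Jq q 6 * Jq q 9) * (Jq q 3 * Jq q 12 * Jq q 18 ^ 2 / (Jq q 6 * Jq q 9 * Jq q 36))"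
  have "(1 + \<omega>) / \<omega> ^ 2 = - 1" unfolding one_plus using nz by simp
  moreover have "\<omega> + \<omega> ^ 2 = - 1" using quad by simp
  ultimately have c: "(1 + \<omega>) / \<omega> ^ 2 = - 1" "\<omega> + \<omega> ^ 2 = - 1" .
  have "Q * (jtheta (- (\<omega> / Q)) Q * jtheta (- (\<omega> ^ 2 * Q)) (Q ^ 2)) = (1 + \<omega>) / \<omega> ^ 2 * F"
    unfolding a s.jtheta_minus_omega_half[OF Q] F_def using Q by (simp add: Q_def Jq_power mult_ac)
  then have "- F = 4 * q ^ 3 * PP - AA"
    using theta_AA_psi[OF Q cube] unfolding c AA_def PP_def by (simp add: Q_def Jq_power)
  then have "F = AA - 4 * q ^ 3 * PP" by (simp add: algebra_simps)
  then have "(1 - 4 * (tq q * tq (q ^ 2))) * AA = F" using u by (simp add: left_diff_distrib mult.assoc)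
  then have "1 - 4 * (tq q * tq (q ^ 2)) = F / AA" using AA by (simp add: eq_divide_eq)
  also have "\<dots> = Jq q 3 ^ 4 * Jq q 18 ^ 2 / (Jq q 6 ^ 2 * Jq q 9 ^ 4)"
    unfolding F_def AA_def using Jq_nonzero[OF assms(1)] by (simp add: field_simps expand_powers)
  finally show ?thesis .
qed

text \<open>The eta quotients show that \<open>1 - 8 t ^ 3\<close> is the square of
  \<open>1 - 4 u\<close>. This is the modular equation linking \<open>t(q)\<close> and
  \<open>t(q^2)\<close> from which the later eliminations start.\<close>

lemma tq_modular:
  assumes "norm q < 1" "q \<noteq> 0"
  defines "u \<equiv> tq q * tq (q ^ 2)"
  shows "tq q ^ 3 = u * (1 - 2 * u)" "tq q ^ 2 = tq (q ^ 2) * (1 - 2 * u)"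
    "(1 - u) * (1 + 2 * u) = 1 + tq q ^ 3"
proof -
  have "(1 - 4 * u) ^ 2 = 1 - 8 * tq q ^ 3"
    unfolding u_def one_minus_4u[OF assms(1,2)] one_minus_8T[OF assms(1,2)]
    by (simp add: power_divide power_mult_distrib flip: power_mult)
  then have "8 * tq q ^ 3 = 8 * (u * (1 - 2 * u))" by (simp add: power2_eq_square algebra_simps)
  then show 1: "tq q ^ 3 = u * (1 - 2 * u)" by (rule mult_left_cancel[THEN iffD1, rotated]) simp
  then have "tq q * (tq q ^ 2) = tq q * (tq (q ^ 2) * (1 - 2 * u))"
    by (simp add: u_def eval_nat_numeral)
  then show "tq q ^ 2 = tq (q ^ 2) * (1 - 2 * u)" using tq_nonzero[OF assms(1,2)] by simp
  show "(1 - u) * (1 + 2 * u) = 1 + tq q ^ 3" unfolding 1 by (simp add: algebra_simps)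
qed

lemma one_minus_u:
  assumes "norm q < 1" "q \<noteq> 0"
  shows "1 - tq q * tq (q ^ 2) = Jq q 3 * Jq q 12 ^ 3 * Jq q 18 ^ 2 / (Jq q 6 ^ 2 * Jq q 9 ^ 3 * Jq q 36)"
proof -
  have "1 + 2 * (tq q * tq (q ^ 2)) \<noteq> 0"
    unfolding one_plus_2u[OF assms] using Jq_nonzero[OF assms(1)] by simp
  then have "1 - tq q * tq (q ^ 2) = (1 + tq q ^ 3) / (1 + 2 * (tq q * tq (q ^ 2)))"
    using tq_modular(3)[OF assms] by (simp add: eq_divide_eq)
  also have "\<dots> = Jq q 3 * Jq q 12 ^ 3 * Jq q 18 ^ 2 / (Jq q 6 ^ 2 * Jq q 9 ^ 3 * Jq q 36)"
    unfolding one_plus_T[OF assms] one_plus_2u[OF assms] using Jq_nonzero[OF assms(1)] by (simp add: field_simps expand_powers)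
  finally show ?thesis .
qed

end

section \<open>Nonvanishing off the lattice, and an identity at level four\<close>

lemma norm_powi_ne_1:
  fixes q :: complex
  assumes "norm q < 1" "q \<noteq> 0" "m \<noteq> 0"
  shows "norm (q powi m) \<noteq> 1"
proof (cases m rule: int_cases2)
  case (nonneg n)
  then have "norm q ^ n < 1" using assms power_less_one_iff[of "norm q" n] by auto
  then show ?thesis using nonneg by (simp add: norm_power)
next
  case (nonpos n)
  then have "norm q ^ n < 1" using assms power_less_one_iff[of "norm q" n] by auto
  then have "norm q ^ n \<noteq> 1" by linarith
  then show ?thesis using nonpos assms by (auto simp: norm_power norm_divide power_int_minus norm_inverse field_simps)
qed

text \<open>Norms decide: the product has norm \<open>norm (q powi (n * r + k))\<close>, whose
  exponent cannot be 0 when \<open>n\<close> does not divide \<open>k\<close>.\<close>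

lemma lattice_avoid:
  fixes q z :: complex
  assumes "norm q < 1" "q \<noteq> 0" "norm z = norm (q ^ k)" "\<not> int n dvd int k"
  shows "(q ^ n) powi r * z \<noteq> 1"
proof
  assume "(q ^ n) powi r * z = 1"
  then have "norm ((q ^ n) powi r) * norm z = 1" by (metis norm_mult norm_one)
  moreover have "norm ((q ^ n) powi r) * norm z = norm (q powi (int n * r + int k))"
    using assms by (simp add: power_int_add norm_mult norm_power power_int_power)
  moreover have "int n * r + int k \<noteq> 0"
    using assms(4) by (metis dvd_triv_left dvd_add_right_iff dvd_0_right)
  ultimately show False using norm_powi_ne_1[OF assms(1,2)] by metis
qed

lemma jtheta_nonzero_power:
  assumes "norm q < 1" "q \<noteq> 0" "norm z = norm (q ^ k)" "\<not> int n dvd int k" "n > 0"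
  shows "jtheta z (q ^ n) \<noteq> 0"
proof (rule jtheta_nonzero)
  show "z \<noteq> 0" using assms by (metis norm_eq_zero power_eq_0_iff)
qed (use assms lattice_avoid[OF assms(1-4)] in \<open>auto intro!: norm_power_lt_1\<close>)

lemma theta_bisect_series:
  assumes "q \<noteq> 0" "norm q < 1" "x \<noteq> 0"
  shows "jtheta x q = jtheta (- (q * x ^ 2)) (q ^ 4) - x * jtheta (- (q ^ 3 * x ^ 2)) (q ^ 4)"
proof -
  have bij: "bij_betw (\<lambda>(s, k). 2 * k + int s) ({..<2::nat} \<times> UNIV) UNIV"
    by (rule bij_betwI[where g = "\<lambda>n. (nat (n mod 2), n div 2)"]) (auto simp: nat_less_iff)
  have "infsum (theta_term x q) UNIV = (\<Sum>s<2. \<Sum>\<^sub>\<infinity>k. theta_term x q (2 * k + int s))"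
    by (intro infsum_residue_split bij summable_theta assms)
  also have "\<dots> = (\<Sum>s<2. (- x) ^ s * jtheta (- (q ^ (1 + 2 * s) * x ^ 2)) (q ^ 4))"
  proof (intro sum.cong refl)
    fix s :: nat assume s: "s \<in> {..<2}"
    have "theta_term x q (2 * k + int s) = (- x) ^ s * theta_term (- (q ^ (1 + 2 * s) * x ^ 2)) (q ^ 4) k" for k
    proof -
      define S where "S = int s"
      have tS: "tri S = 0" using s by (cases s) (auto simp: S_def tri_def)
      have "2 * tri (2 * k + S) = 2 * (4 * tri k + (1 + 2 * S) * k + tri S)"
        using two_tri[of k] two_tri[of S] two_tri[of "2 * k + S"] by (simp add: algebra_simps)
      then have t: "tri (2 * k + S) = 4 * tri k + (1 + 2 * S) * k" using tS by simp
      have m: "(- 1 :: complex) powi (2 * k + S) = (- 1) ^ s"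
        by (simp add: S_def power_int_add power_int_mult)
      show ?thesis
        unfolding S_def[symmetric] theta_term_minus_power_base theta_term_def[of x] t m
        using assms by (simp add: S_def power_int_add power_int_mult_distrib
          power_int_power power_minus[of x] field_simps)
    qed
    then show "(\<Sum>\<^sub>\<infinity>k. theta_term x q (2 * k + int s)) =
       (- x) ^ s * jtheta (- (q ^ (1 + 2 * s) * x ^ 2)) (q ^ 4)"
      using assms norm_power_lt_1[of q 4] by (simp add: infsum_cmult_right' jacobi_triple_product)
  qed
  finally show ?thesis
    using assms by (simp add: jacobi_triple_product eval_nat_numeral mult_ac)
qed

lemma distrib3: "x * (a + b + c) = x * a + x * b + x * (c :: 'a :: semiring)"
  by (simp add: distrib_left)

lemma factor_eq_divide:
  fixes x y :: "'a :: field"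
  shows "x * j * y = z \<Longrightarrow> x \<noteq> 0 \<Longrightarrow> y \<noteq> 0 \<Longrightarrow> j = z / (x * y)"
  by (auto simp: field_simps)

lemma jtheta_quarter:
  assumes "norm q < 1" "q \<noteq> 0"
  shows "jtheta q (q ^ 4) = Jq q 1 * Jq q 4 / Jq q 2"
    and "jtheta (- q) (q ^ 4) = Jq q 2 ^ 2 / Jq q 1"
proof -
  have n: "norm (q ^ 2) < 1" "norm (q ^ 4) < 1" using assms by (auto intro!: norm_power_lt_1)
  have e: "q ^ 4 / q = q * q ^ 2" "(q ^ 2) ^ 2 = q ^ 4" using assms by (simp_all add: eval_nat_numeral)
  have "jtheta x (x ^ 4) = Jq x 1 * Jq x 4 / Jq x 2" if x: "norm x < 1" "x \<noteq> 0" for x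
  proof -
    have n: "norm (x ^ 2) < 1" using x by (auto intro!: norm_power_lt_1)
    have e: "x ^ 4 / x = x * x ^ 2" "(x ^ 2) ^ 2 = x ^ 4" using x by (simp_all add: eval_nat_numeral)
    have "jtheta x (x ^ 4) = qpoch_inf x (x ^ 2) * Jq x 4"
      unfolding jtheta_def e qpoch_bisect[OF n, of x] by (simp add: Jq_def)
    then show ?thesis unfolding qpoch_odd[OF x(1)] by simp
  qed
  note h = this
  show 1: "jtheta q (q ^ 4) = Jq q 1 * Jq q 4 / Jq q 2" by (rule h[OF assms])
  have "(q ^ 4) ^ 2 = (q ^ 2) ^ 4" by (simp flip: power_mult)
  then have "Jq q 1 * Jq q 4 / Jq q 2 * jtheta (- q) (q ^ 4) * Jq q 8 = Jq q 2 * Jq q 8 / Jq q 4 * Jq q 4 ^ 2"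
    using jtheta_neg[OF n(2), of q] 1 h[OF n(1)] assms by (simp add: Jq_power)
  then have "jtheta (- q) (q ^ 4) = (Jq q 2 * Jq q 8 / Jq q 4 * Jq q 4 ^ 2) / (Jq q 1 * Jq q 4 / Jq q 2 * Jq q 8)"
    by (rule factor_eq_divide) (use Jq_nonzero[OF assms(1)] in auto)
  also have "\<dots> = Jq q 2 ^ 2 / Jq q 1"
    using Jq_nonzero[OF assms(1)] by (simp add: field_simps expand_powers)
  finally show "jtheta (- q) (q ^ 4) = Jq q 2 ^ 2 / Jq q 1" .
qed

text \<open>Written in base \<open>q\<^sup>2\<^sup>4\<close>, the left-hand side factors as \<open>(c - q\<^sup>2a)(d - qb)\<close>, and both factors
  are instances of the quintuple product.\<close>
lemma psi_A_difference:
  assumes "norm q < 1" "q \<noteq> 0"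
  shows "Jq q 6 ^ 2 / Jq q 3 * (Jq q 8 * Jq q 12 ^ 2 / (Jq q 4 * Jq q 24))
      - q * (Jq q 24 ^ 2 / Jq q 12) * (Jq q 2 * Jq q 3 ^ 2 / (Jq q 1 * Jq q 6)) = Jq q 1 * Jq q 8 ^ 2 / Jq q 4"
proof -
  define a b c d where "a = jtheta (- q) (q ^ 24)" and "b = jtheta (- (q ^ 5)) (q ^ 24)"
    and "c = jtheta (- (q ^ 7)) (q ^ 24)" and "d = jtheta (- (q ^ 11)) (q ^ 24)"
  note J = Jq_nonzero[OF assms(1)]
  have n: "norm (q ^ 12) < 1" "norm (q ^ 3) < 1" "norm (q ^ 4) < 1" "norm (q ^ 8) < 1" "norm (q ^ 2) < 1" "norm (q ^ 24) < 1"
    using assms by (auto intro!: norm_power_lt_1)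
  have fl: "jtheta (- (q ^ i)) (q ^ N) = jtheta (- (q ^ k)) (q ^ N)" if "i + k = N" for i k N
  proof -
    have "q ^ N / - (q ^ k) = - (q ^ i)" using assms that by (auto simp: power_add)
    then show ?thesis using jtheta_flip[of "q ^ N" "- (q ^ k)"] assms by simp
  qed
  have q12: "(q ^ 12) ^ 2 = q ^ 24" by (simp flip: power_mult)
  have p1: "- (q ^ 3) * - (q ^ 4) = q ^ 7" "q ^ 12 * - (q ^ 3) / (- (q ^ 4)) = q ^ 11"
    "q ^ 12 * - (q ^ 3) * - (q ^ 4) = q ^ 19" "q ^ 24 * - (q ^ 3) / (- (q ^ 4)) = q ^ 23"
    using assms by (simp_all add: divide_eq_eq flip: power_add)
  \<comment> \<open>The products in base \<open>q ^ 12\<close> are rewritten in base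
    \<open>q ^ 24\<close> by the parity formula, so that everything becomes quadratic in
    \<open>a\<close>, \<open>b\<close>, \<open>c\<close>, \<open>d\<close>.\<close>
  have e1: "jtheta (- (q ^ 3)) (q ^ 12) * jtheta (- (q ^ 4)) (q ^ 12) = c * d + q ^ 3 * (a * b)"
    using theta_product_parity[OF _ n(1), of "- (q ^ 3)" "- (q ^ 4)"] assms fl[of 19 5 24] fl[of 23 1 24]
    unfolding q12 p1 by (simp add: a_def b_def c_def d_def mult_ac)
  have p2: "- 1 * - (q ^ 5) = q ^ 5" "q ^ 12 * - 1 / (- (q ^ 5)) = q ^ 7" "q ^ 12 * - 1 * - (q ^ 5) = q ^ 17"
    "q ^ 24 * - 1 / (- (q ^ 5)) = q ^ 19"
    using assms by (simp_all add: divide_eq_eq flip: power_add)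
  have e2: "jtheta (- 1) (q ^ 12) * jtheta (- (q ^ 5)) (q ^ 12) = 2 * (b * c)"
    using theta_product_parity[OF _ n(1), of "- 1" "- (q ^ 5)"] assms fl[of 19 5 24] fl[of 17 7 24]
    unfolding q12 p2 by (simp add: b_def c_def mult_ac)
  have p3: "- 1 * - q = q" "q ^ 12 * - 1 / (- q) = q ^ 11" "q ^ 12 * - 1 * - q = q ^ 13"
    "q ^ 24 * - 1 / (- q) = q ^ 23"
    using assms by (simp_all add: divide_eq_eq flip: power_Suc2)
  have e3: "jtheta (- 1) (q ^ 12) * jtheta (- q) (q ^ 12) = 2 * (a * d)"
    using theta_product_parity[OF _ n(1), of "- 1" "- q"] assms fl[of 13 11 24] fl[of 23 1 24]
    unfolding q12 p3 by (simp add: a_def d_def mult_ac)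
  have p4: "q ^ 3 * (- q) ^ 2 = q ^ 5" "(q ^ 3) ^ 4 = q ^ 12" "(q ^ 3) ^ 3 * (- q) ^ 2 = q ^ 11"
    by (simp_all flip: power_mult power_add)
  have A: "jtheta (- q) (q ^ 3) = jtheta (- (q ^ 5)) (q ^ 12) + q * jtheta (- q) (q ^ 12)"
    using theta_bisect_series[OF _ n(2), of "- q"] assms fl[of 11 1 12] unfolding p4 by simp
  have "jtheta (- (q ^ 3)) (q ^ 12) * jtheta (- (q ^ 4)) (q ^ 12) - q * (jtheta (- 1) (q ^ 12) / 2) * jtheta (- q) (q ^ 3)
    = c * d + q ^ 3 * (a * b) - q * (b * c) - q * q * (a * d)"
    using e1 e2 e3 unfolding A by (simp add: algebra_simps)
  also have "\<dots> = (c - q ^ 2 * a) * (d - q * b)" by (simp add: algebra_simps eval_nat_numeral)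
  finally have main: "jtheta (- (q ^ 3)) (q ^ 12) * jtheta (- (q ^ 4)) (q ^ 12) - q * (jtheta (- 1) (q ^ 12) / 2) * jtheta (- q) (q ^ 3)
    = (c - q ^ 2 * a) * (d - q * b)" .
  have ev: "jtheta (- (q ^ 3)) (q ^ 12) = Jq q 6 ^ 2 / Jq q 3" "jtheta (- (q ^ 4)) (q ^ 12) = Jq q 8 * Jq q 12 ^ 2 / (Jq q 4 * Jq q 24)"
    "jtheta (- 1) (q ^ 12) / 2 = Jq q 24 ^ 2 / Jq q 12"
    using jtheta_quarter(2)[OF n(2)] jtheta_minus_third[OF n(3)] jtheta_minus_1[OF n(1)] assms
    by (simp_all add: Jq_power flip: power_mult)
  have nz3: "jtheta (- (q ^ 3)) (q ^ 8) \<noteq> 0"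
    by (rule jtheta_nonzero_power[OF assms, where k = 3]) auto
  have nz1: "jtheta (- q) (q ^ 8) \<noteq> 0"
    by (rule jtheta_nonzero_power[OF assms, where k = 1]) auto
  have x3: "(q ^ 3) ^ 2 = q ^ 6" "q ^ 8 * (q ^ 3) ^ 3 = q ^ 17" "(q ^ 8) ^ 3 = q ^ 24" "(q ^ 8) ^ 2 * (q ^ 3) ^ 3 = q ^ 24 * q"
    by (simp_all flip: power_mult power_add power_Suc2)
  have sh: "jtheta (- (q ^ 24 * q)) (q ^ 24) = a / q"
    using jtheta_shift[OF _ n(6), of "- q"] assms by (simp add: a_def)
  have f6: "jtheta (q ^ 6) (q ^ 8) = jtheta (q ^ 2) (q ^ 8)"
    using jtheta_flip[of "q ^ 8" "q ^ 2"] assms by (simp add: power_diff[symmetric])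
  have "jtheta (q ^ 2) (q ^ 8) / jtheta (- (q ^ 3)) (q ^ 8) = (c - q ^ 3 * (a / q)) / Jq q 8"
    using quintuple_product[OF _ n(4) _ nz3] assms fl[of 17 7 24] unfolding x3 sh f6 c_def by (simp add: Jq_power)
  moreover have "q ^ 3 * (a / q) = q ^ 2 * a" using assms by (simp add: eval_nat_numeral)
  ultimately have Q1: "c - q ^ 2 * a = Jq q 8 * (jtheta (q ^ 2) (q ^ 8) / jtheta (- (q ^ 3)) (q ^ 8))"
    using J by (simp add: field_simps)
  have x1: "q ^ 8 * q ^ 3 = q ^ 11" "(q ^ 8) ^ 2 * q ^ 3 = q ^ 19"
    by (simp_all flip: power_mult power_add)
  have "jtheta (q ^ 2) (q ^ 8) / jtheta (- q) (q ^ 8) = (d - q * b) / Jq q 8"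
    using quintuple_product[OF _ n(4) _ nz1] assms fl[of 19 5 24] unfolding x1 x3(3) d_def b_def by (simp add: Jq_power)
  then have Q2: "d - q * b = Jq q 8 * (jtheta (q ^ 2) (q ^ 8) / jtheta (- q) (q ^ 8))"
    using J by (simp add: field_simps)
  have v: "jtheta (q ^ 2) (q ^ 8) = Jq q 2 * Jq q 8 / Jq q 4"
    using jtheta_quarter(1)[OF n(5)] assms by (simp add: Jq_power flip: power_mult)
  \<comment> \<open>The two quintuple product denominators are the bisection of
    \<open>j(-q; q^4)\<close>, so their product is an eta quotient; only this product is
    needed.\<close>
  have "q ^ 4 * - q = - (q ^ 5)" "(q ^ 4) ^ 2 = q ^ 8" by (simp_all flip: power_mult power_Suc2)
  then have "jtheta (- q) (q ^ 4) * Jq q 8 ^ 2 = jtheta (- q) (q ^ 8) * jtheta (- (q ^ 3)) (q ^ 8) * Jq q 4"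
    using jtheta_bisect[OF n(3), of "- q"] assms fl[of 5 3 8] by (simp add: Jq_power)
  then have pr: "jtheta (- q) (q ^ 8) * jtheta (- (q ^ 3)) (q ^ 8) = Jq q 2 ^ 2 / Jq q 1 * Jq q 8 ^ 2 / Jq q 4"
    using J unfolding jtheta_quarter(2)[OF assms] by (simp add: eq_divide_eq)
  have "(c - q ^ 2 * a) * (d - q * b) = Jq q 8 ^ 2 * (Jq q 2 * Jq q 8 / Jq q 4) ^ 2 / (jtheta (- q) (q ^ 8) * jtheta (- (q ^ 3)) (q ^ 8))"
    unfolding Q1 Q2 v by (simp add: power2_eq_square mult_ac)
  also have "\<dots> = Jq q 1 * Jq q 8 ^ 2 / Jq q 4"
    unfolding pr using J by (simp add: field_simps expand_powers)
  finally show ?thesis using main unfolding ev jtheta_minus_third[OF assms] by simp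
qed

section \<open>Relations between \<open>t(q)\<close>, \<open>t(q^2)\<close> and
  \<open>t(q^4)\<close>\<close>

text \<open>Writing \<open>t(q) = q P / A\<close> and \<open>t(q^4) = q^4 P4 / A4\<close>, the
  numerator \<open>P * A4 - q ^ 3 * P4 * A\<close> of the difference is
  \<open>psi_A_difference\<close> at \<open>q ^ 3\<close>.\<close>

lemma tq_minus_tq4:
  assumes "norm q < 1" "q \<noteq> 0"
  shows "tq q - tq (q ^ 4) = q * (Jq q 3 ^ 2 * Jq q 18 * Jq q 24 * Jq q 72 / (Jq q 6 * Jq q 9 ^ 2 * Jq q 36 ^ 2))"
proof -
  note J = Jq_nonzero[OF assms(1)]
  have n: "norm (q ^ 3) < 1" "q ^ 3 \<noteq> 0" using assms by (auto intro!: norm_power_lt_1)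
  define P A P4 A4 where "P = Jq q 18 ^ 2 / Jq q 9" and "A = Jq q 6 * Jq q 9 ^ 2 / (Jq q 3 * Jq q 18)"
    and "P4 = Jq q 72 ^ 2 / Jq q 36" and "A4 = Jq q 24 * Jq q 36 ^ 2 / (Jq q 12 * Jq q 72)"
  have nz: "A \<noteq> 0" "A4 \<noteq> 0" using J by (auto simp: A_def A4_def)
  have t: "tq q = q * (P / A)" "tq (q ^ 4) = q ^ 4 * (P4 / A4)"
    unfolding tq_eq[of q] tq_power P_def A_def P4_def A4_def using J by (simp_all add: field_simps expand_powers)
  have "P * A4 - q ^ 3 * P4 * A = Jq q 3 * Jq q 24 ^ 2 / Jq q 12"
    using psi_A_difference[OF n] unfolding P_def A_def P4_def A4_def by (simp add: Jq_power)
  moreover have "tq q - tq (q ^ 4) = q * (P * A4 - q ^ 3 * P4 * A) / (A * A4)"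
    unfolding t using nz by (simp add: field_simps eval_nat_numeral)
  ultimately have "tq q - tq (q ^ 4) = q * (Jq q 3 * Jq q 24 ^ 2 / Jq q 12) / (A * A4)" by simp
  also have "\<dots> = q * (Jq q 3 ^ 2 * Jq q 18 * Jq q 24 * Jq q 72 / (Jq q 6 * Jq q 9 ^ 2 * Jq q 36 ^ 2))"
    unfolding A_def A4_def using J assms by (simp add: field_simps expand_powers)
  finally show ?thesis .
qed

context cube_root begin

lemma tq_relations:
  assumes "norm q < 1" "q \<noteq> 0"
  defines "u \<equiv> tq q * tq (q ^ 2)" and "v \<equiv> tq (q ^ 2) * tq (q ^ 4)"
  shows "tq q ^ 2 = tq (q ^ 2) * (1 - 2 * u)" "tq (q ^ 2) ^ 2 = tq (q ^ 4) * (1 - 2 * v)"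
    "1 - v = Jq q 6 * Jq q 24 ^ 3 * Jq q 36 ^ 2 / (Jq q 12 ^ 2 * Jq q 18 ^ 3 * Jq q 72)"
    "1 + 2 * v = Jq q 12 ^ 7 * Jq q 72 / (Jq q 6 ^ 2 * Jq q 18 ^ 2 * Jq q 24 ^ 3 * Jq q 36)"
    "1 - 4 * v = Jq q 6 ^ 4 * Jq q 36 ^ 2 / (Jq q 12 ^ 2 * Jq q 18 ^ 4)"
    "1 - u = Jq q 3 * Jq q 12 ^ 3 * Jq q 18 ^ 2 / (Jq q 6 ^ 2 * Jq q 9 ^ 3 * Jq q 36)"
    "1 + tq (q ^ 2) ^ 3 = Jq q 12 ^ 5 * Jq q 36 / (Jq q 6 * Jq q 18 ^ 5)"
proof -
  have n: "norm (q ^ 2) < 1" "q ^ 2 \<noteq> 0" using assms by (auto intro!: norm_power_lt_1)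
  have e: "(q ^ 2) ^ 2 = q ^ 4" by (simp flip: power_mult)
  show "tq q ^ 2 = tq (q ^ 2) * (1 - 2 * u)" unfolding u_def by (rule tq_modular(2)[OF assms(1,2)])
  show "tq (q ^ 2) ^ 2 = tq (q ^ 4) * (1 - 2 * v)" unfolding v_def using tq_modular(2)[OF n] e by simp
  show "1 - v = Jq q 6 * Jq q 24 ^ 3 * Jq q 36 ^ 2 / (Jq q 12 ^ 2 * Jq q 18 ^ 3 * Jq q 72)"
    "1 + 2 * v = Jq q 12 ^ 7 * Jq q 72 / (Jq q 6 ^ 2 * Jq q 18 ^ 2 * Jq q 24 ^ 3 * Jq q 36)"
    "1 - 4 * v = Jq q 6 ^ 4 * Jq q 36 ^ 2 / (Jq q 12 ^ 2 * Jq q 18 ^ 4)"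
    unfolding v_def using one_minus_u[OF n] one_plus_2u[OF n] one_minus_4u[OF n] e by (simp_all add: Jq_power)
  show "1 - u = Jq q 3 * Jq q 12 ^ 3 * Jq q 18 ^ 2 / (Jq q 6 ^ 2 * Jq q 9 ^ 3 * Jq q 36)"
    unfolding u_def by (rule one_minus_u[OF assms(1,2)])
  show "1 + tq (q ^ 2) ^ 3 = Jq q 12 ^ 5 * Jq q 36 / (Jq q 6 * Jq q 18 ^ 5)"
    using one_plus_T[OF n] by (simp add: Jq_power)
qed

text \<open>By elimination: the two modular equations give
  \<open>(t + 2 f)(t - f) s = f (1 - 4 s f)(1 - t s)\<close>, in which all other factors are known
  eta quotients.\<close>

lemma tq_plus_2tq4:
  assumes "norm q < 1" "q \<noteq> 0"
  shows "tq q + 2 * tq (q ^ 4) = q * (Jq q 6 ^ 2 * Jq q 12 ^ 3 * Jq q 72 ^ 2 / (Jq q 3 * Jq q 9 * Jq q 24 ^ 2 * Jq q 36 ^ 3))"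
proof -
  note J = Jq_nonzero[OF assms(1)] and r = tq_relations[OF assms]
  have n: "norm (q ^ 2) < 1" "q ^ 2 \<noteq> 0" using assms by (auto intro!: norm_power_lt_1)
  define t s f where "t = tq q" and "s = tq (q ^ 2)" and "f = tq (q ^ 4)"
  have s0: "s \<noteq> 0" unfolding s_def by (rule tq_nonzero[OF n])
  have d0: "t - f \<noteq> 0" unfolding t_def f_def tq_minus_tq4[OF assms] using J assms by simp
  have "t ^ 2 = s * (1 - 2 * (t * s))" "s ^ 2 = f * (1 - 2 * (s * f))"
    using r(1,2) by (simp_all add: t_def s_def f_def)
  then have "s * ((t + 2 * f) * (t - f) * s) = s * (f * ((1 - 4 * (s * f)) * (1 - t * s)))" by algebra
  then have "(t + 2 * f) * (t - f) * s = f * ((1 - 4 * (s * f)) * (1 - t * s))" using s0 by simp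
  then have "t + 2 * f = f * ((1 - 4 * (s * f)) * (1 - t * s)) / ((t - f) * s)"
    using s0 d0 by (simp add: eq_divide_eq mult_ac)
  also have "\<dots> = q * (Jq q 6 ^ 2 * Jq q 12 ^ 3 * Jq q 72 ^ 2 / (Jq q 3 * Jq q 9 * Jq q 24 ^ 2 * Jq q 36 ^ 3))"
    unfolding t_def s_def f_def r(5,6) tq_minus_tq4[OF assms] unfolding tq_power
    using J assms by (simp add: field_simps expand_powers)
  finally show ?thesis by (simp add: t_def f_def)
qed

text \<open>Again by elimination, from
  \<open>(t + 2 f)(s - 2 t f) s = t f (1 - 4 s f)(1 + 2 s f)\<close>.\<close>

lemma tq_ratio:
  assumes "norm q < 1" "q \<noteq> 0"
  shows "1 - 2 * tq q * tq (q ^ 4) / tq (q ^ 2) =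
    Jq q 3 ^ 2 * Jq q 12 ^ 5 * Jq q 18 ^ 3 * Jq q 72 ^ 2 / (Jq q 6 ^ 3 * Jq q 9 ^ 2 * Jq q 24 ^ 2 * Jq q 36 ^ 5)"
proof -
  note J = Jq_nonzero[OF assms(1)] and r = tq_relations[OF assms]
  have n: "norm (q ^ 2) < 1" "q ^ 2 \<noteq> 0" "norm (q ^ 4) < 1" "q ^ 4 \<noteq> 0" using assms by (auto intro!: norm_power_lt_1)
  define t s f where "t = tq q" and "s = tq (q ^ 2)" and "f = tq (q ^ 4)"
  have s0: "s \<noteq> 0" "f \<noteq> 0" unfolding s_def f_def using tq_nonzero n by blast+
  have p0: "t + 2 * f \<noteq> 0" unfolding t_def f_def tq_plus_2tq4[OF assms] using J assms by simp
  have rr: "t ^ 2 = s * (1 - 2 * (t * s))" "s ^ 2 = f * (1 - 2 * (s * f))"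
    using r(1,2) by (simp_all add: t_def s_def f_def)
  have "(t + 2 * f) * (s - 2 * t * f) * (s * s) = t * s * ((1 - 4 * (s * f)) * (1 + 2 * (s * f))) * f"
    using rr by algebra
  then have "(s - 2 * t * f) = t * s * ((1 - 4 * (s * f)) * (1 + 2 * (s * f))) * f / ((t + 2 * f) * (s * s))"
    using s0 p0 by (simp add: eq_divide_eq mult_ac)
  moreover have "1 - 2 * t * f / s = (s - 2 * t * f) / s" using s0 by (simp add: field_simps)
  ultimately have "1 - 2 * t * f / s = t * s * ((1 - 4 * (s * f)) * (1 + 2 * (s * f))) * f / ((t + 2 * f) * (s * s)) / s"
    by simp
  also have "\<dots> = t * ((1 - 4 * (s * f)) * (1 + 2 * (s * f))) * f / ((t + 2 * f) * (s * s))"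
    using s0 by (simp add: mult_ac)
  also have "\<dots> = Jq q 3 ^ 2 * Jq q 12 ^ 5 * Jq q 18 ^ 3 * Jq q 72 ^ 2 / (Jq q 6 ^ 3 * Jq q 9 ^ 2 * Jq q 24 ^ 2 * Jq q 36 ^ 5)"
    unfolding t_def s_def f_def r(4,5) tq_plus_2tq4[OF assms] unfolding tq_power tq_eq[of q]
    using J assms by (simp add: field_simps expand_powers)
  finally show ?thesis by (simp add: t_def s_def f_def)
qed

text \<open>Used at \<open>q ^ 2\<close>, where it expresses \<open>1 - t(q^4) / t(q^2)\<close> by
  factors \<open>1 + t\<close> and \<open>1 - 2 t\<close> whose eta quotients are known.\<close>

lemma one_plus_tq_conj:
  assumes "norm q < 1" "q \<noteq> 0"
  shows "(1 + tq q) * (1 - tq (q ^ 2) / tq q) = (1 + tq (q ^ 2)) * (1 - 2 * tq (q ^ 2))"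
proof -
  have t: "tq q \<noteq> 0" by (rule tq_nonzero[OF assms])
  have "tq q * ((1 + tq q) * (1 - tq (q ^ 2) / tq q)) = (1 + tq q) * (tq q - tq (q ^ 2))"
    using t by (simp add: field_simps)
  also have "\<dots> = tq q * ((1 + tq (q ^ 2)) * (1 - 2 * tq (q ^ 2)))"
    using tq_modular(2)[OF assms] by algebra
  finally have "tq q * ((1 + tq q) * (1 - tq (q ^ 2) / tq q)) = tq q * ((1 + tq (q ^ 2)) * (1 - 2 * tq (q ^ 2)))" .
  then show ?thesis using t by simp
qed

section \<open>The five dissections\<close>

text \<open>The components are the terms of \<open>(1 + 2 t + 4 t^2)^2 (1 - t + t^2)\<close> sorted
  by exponent modulo 3; this polynomial is \<open>(1 - 8 t^3)^2 (1 + t^3)\<close> divided by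
  \<open>(1 - 2 t)^2 (1 + t)\<close>. In the divisor the eta quotients of \<open>1 - 2 t\<close> and
  \<open>1 + t\<close> combine so that \<open>J_2\<close> cancels and \<open>J_1 ^ 3\<close>
  remains.\<close>

lemma W_sum:
  assumes "norm q < 1" "q \<noteq> 0"
  shows "Wq (q ^ 3) 0 + q * Wq (q ^ 3) 1 + q ^ 2 * Wq (q ^ 3) 2 = 1 / Jq q 1 ^ 3"
proof -
  note J = Jq_nonzero[OF assms(1)]
  define w c t where "w = wq (q ^ 3)" and "c = Jq q 9 ^ 9 / Jq q 3 ^ 12 / w ^ 2" and "t = tq q"
  have t: "t = q * w" by (simp add: t_def w_def tq_def)
  have w0: "w \<noteq> 0" using tq_nonzero[OF assms] t by (auto simp: t_def)
  define D where "D = (1 - 2 * t) ^ 2 * (1 + t)"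
  have D: "D = (Jq q 1 ^ 2 * Jq q 18 / (Jq q 2 * Jq q 9 ^ 2)) ^ 2 * (Jq q 2 ^ 2 * Jq q 3 * Jq q 18 / (Jq q 1 * Jq q 6 * Jq q 9 ^ 2))"
    unfolding D_def t_def one_minus_2tq[OF assms] one_plus_tq[OF assms] ..
  then have D0: "D \<noteq> 0" using J by simp
  have "Wq (q ^ 3) 0 + q * Wq (q ^ 3) 1 + q ^ 2 * Wq (q ^ 3) 2 = c * ((1 + 2 * t + 4 * t ^ 2) ^ 2 * (1 - t + t ^ 2))"
  proof -
    define K where "K = Jq q 9 ^ 9 / Jq q 3 ^ 12"
    have "K * (1 / w ^ 2 + 8 * q ^ 3 * w + 16 * (q ^ 3) ^ 2 * w ^ 4) + q * (K * (3 / w + 12 * q ^ 3 * w ^ 2)) + q ^ 2 * (9 * K) =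
       K / w ^ 2 * ((1 + 2 * (q * w) + 4 * (q * w) ^ 2) ^ 2 * (1 - q * w + (q * w) ^ 2))"
      using w0 by (simp add: field_simps expand_powers)
    then show ?thesis unfolding Wq_def w_def[symmetric] Jq_power c_def t K_def by simp
  qed
  also have "(1 + 2 * t + 4 * t ^ 2) ^ 2 * (1 - t + t ^ 2) = (1 - 8 * t ^ 3) ^ 2 * (1 + t ^ 3) / D"
  proof -
    have "(1 + 2 * t + 4 * t ^ 2) ^ 2 * (1 - t + t ^ 2) * D = (1 - 8 * t ^ 3) ^ 2 * (1 + t ^ 3)"
      unfolding D_def by algebra
    then show ?thesis using D0 by (simp add: eq_divide_eq)
  qed
  also have "c * ((1 - 8 * t ^ 3) ^ 2 * (1 + t ^ 3) / D) = 1 / Jq q 1 ^ 3"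
    unfolding D t_def one_minus_8T[OF assms] one_plus_T[OF assms] c_def w_def wq_def Jq_power
    using J by (simp add: field_simps expand_powers)
  finally show ?thesis .
qed

text \<open>The components are the trisection of \<open>j(q; q^6)\<close>; the last piece returns to
  the argument \<open>q ^ 3\<close> by a shift of one period in base \<open>q ^ 54\<close>.\<close>

lemma f_sum:
  assumes "norm q < 1" "q \<noteq> 0"
  shows "fq (q ^ 3) 0 + q * fq (q ^ 3) 1 + q ^ 2 * fq (q ^ 3) 2 = Jq q 1 * Jq q 6 / (Jq q 2 * Jq q 3 ^ 2)"
proof -
  note J = Jq_nonzero[OF assms(1)]
  have n: "norm (q ^ 6) < 1" "norm (q ^ 54) < 1" using assms by (auto intro!: norm_power_lt_1)
  have p: "(q ^ 6) ^ 3 * q ^ 3 = q ^ 21" "(q ^ 6) ^ 6 * q ^ 3 = q ^ 39" "(q ^ 6) ^ 9 * q ^ 3 = q ^ 54 * q ^ 3" "(q ^ 6) ^ 9 = q ^ 54"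
    by (simp_all flip: power_mult power_add)
  have a: "jtheta (q ^ 39) (q ^ 54) = jtheta (q ^ 15) (q ^ 54)"
    using jtheta_flip[of "q ^ 54" "q ^ 15"] assms by (simp add: power_diff[symmetric])
  have b: "jtheta (q ^ 54 * q ^ 3) (q ^ 54) = - jtheta (q ^ 3) (q ^ 54) / q ^ 3"
    using assms n by (intro jtheta_shift) auto
  have "jtheta q (q ^ 6) = jtheta (q ^ 21) (q ^ 54) - q * jtheta (q ^ 15) (q ^ 54) - q ^ 5 * jtheta (q ^ 3) (q ^ 54)"
    using theta_trisect[OF _ n(1) assms(2)] assms unfolding p a b by (simp add: field_simps expand_powers)
  then have "jtheta (q ^ 21) (q ^ 54) - q * jtheta (q ^ 15) (q ^ 54) - q ^ 5 * jtheta (q ^ 3) (q ^ 54) = Jq q 1 * Jq q 6 ^ 2 / (Jq q 2 * Jq q 3)"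
    unfolding jtheta_sixth[OF assms] by simp
  moreover have "fq (q ^ 3) 0 + q * fq (q ^ 3) 1 + q ^ 2 * fq (q ^ 3) 2 =
      (jtheta (q ^ 21) (q ^ 54) - q * jtheta (q ^ 15) (q ^ 54) - q ^ 5 * jtheta (q ^ 3) (q ^ 54)) / (Jq q 3 * Jq q 6)"
    unfolding fq_def Jq_power using J by (simp add: field_simps expand_powers flip: power_mult)
  ultimately have "fq (q ^ 3) 0 + q * fq (q ^ 3) 1 + q ^ 2 * fq (q ^ 3) 2 = Jq q 1 * Jq q 6 ^ 2 / (Jq q 2 * Jq q 3) / (Jq q 3 * Jq q 6)"
    by simp
  also have "\<dots> = Jq q 1 * Jq q 6 / (Jq q 2 * Jq q 3 ^ 2)" using J by (simp add: field_simps expand_powers)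
  finally show ?thesis .
qed

text \<open>The right side is \<open>1 / psi(q^2)\<close>. With \<open>s = t(q^2)\<close> the
  components are proportional to 1, \<open>s ^ 2\<close> and \<open>- s\<close>, the expansion of
  \<open>(1 + s ^ 3) / (1 + s)\<close>.\<close>

lemma I_sum:
  assumes "norm q < 1" "q \<noteq> 0"
  shows "Iq (q ^ 3) 0 + q * Iq (q ^ 3) 1 + q ^ 2 * Iq (q ^ 3) 2 = Jq q 2 / Jq q 4 ^ 2"
proof -
  note J = Jq_nonzero[OF assms(1)]
  have n: "norm (q ^ 2) < 1" "q ^ 2 \<noteq> 0" using assms by (auto intro!: norm_power_lt_1)
  define s where "s = tq (q ^ 2)"
  have s: "s = q ^ 2 * (Jq q 6 * Jq q 36 ^ 3 / (Jq q 12 * Jq q 18 ^ 3))" unfolding s_def tq_power by simp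
  have s1: "1 + s = Jq q 4 ^ 2 * Jq q 6 * Jq q 36 / (Jq q 2 * Jq q 12 * Jq q 18 ^ 2)"
    unfolding s_def using one_plus_tq[OF n] by (simp add: Jq_power)
  then have s0: "1 + s \<noteq> 0" using J by simp
  have i0: "Iq (q ^ 3) 0 = Jq q 6 ^ 2 * Jq q 18 ^ 3 / Jq q 12 ^ 6" unfolding Iq_def by (simp add: Jq_power)
  have i1: "q * Iq (q ^ 3) 1 = Iq (q ^ 3) 0 * s ^ 2"
    unfolding i0 s Iq_def Jq_power using J by (simp add: field_simps expand_powers)
  have i2: "q ^ 2 * Iq (q ^ 3) 2 = - (Iq (q ^ 3) 0 * s)"
    unfolding i0 s Iq_def Jq_power using J by (simp add: field_simps expand_powers)
  have "(Iq (q ^ 3) 0 + q * Iq (q ^ 3) 1 + q ^ 2 * Iq (q ^ 3) 2) * (1 + s) = Iq (q ^ 3) 0 * (1 + s ^ 3)"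
    unfolding i1 i2 by algebra
  then have "Iq (q ^ 3) 0 + q * Iq (q ^ 3) 1 + q ^ 2 * Iq (q ^ 3) 2 = Iq (q ^ 3) 0 * (1 + s ^ 3) / (1 + s)"
    using s0 by (simp add: eq_divide_eq)
  also have "\<dots> = Jq q 2 / Jq q 4 ^ 2"
    unfolding s1 i0 unfolding s_def tq_relations(7)[OF assms] using J by (simp add: field_simps expand_powers)
  finally show ?thesis .
qed

lemma tq_ratio_2:
  assumes "norm q < 1" "q \<noteq> 0"
  shows "1 - tq (q ^ 4) / tq (q ^ 2) =
    Jq q 2 * Jq q 8 * Jq q 12 ^ 2 * Jq q 18 ^ 2 * Jq q 72 ^ 2 / (Jq q 4 * Jq q 6 * Jq q 24 * Jq q 36 ^ 5)"
proof -
  note J = Jq_nonzero[OF assms(1)]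
  have n: "norm (q ^ 2) < 1" "q ^ 2 \<noteq> 0" "norm (q ^ 4) < 1" "q ^ 4 \<noteq> 0" using assms by (auto intro!: norm_power_lt_1)
  have e: "(q ^ 2) ^ 2 = q ^ 4" by (simp flip: power_mult)
  have 1: "1 + tq (q ^ 2) = Jq q 4 ^ 2 * Jq q 6 * Jq q 36 / (Jq q 2 * Jq q 12 * Jq q 18 ^ 2)"
    using one_plus_tq[OF n(1,2)] by (simp add: Jq_power)
  then have nz: "1 + tq (q ^ 2) \<noteq> 0" using J by simp
  have "1 - tq (q ^ 4) / tq (q ^ 2) = (1 + tq (q ^ 4)) * (1 - 2 * tq (q ^ 4)) / (1 + tq (q ^ 2))"
    using one_plus_tq_conj[OF n(1,2)] nz unfolding e by (simp add: eq_divide_eq mult.commute)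
  also have "\<dots> = Jq q 2 * Jq q 8 * Jq q 12 ^ 2 * Jq q 18 ^ 2 * Jq q 72 ^ 2 / (Jq q 4 * Jq q 6 * Jq q 24 * Jq q 36 ^ 5)"
    unfolding 1 one_plus_tq[OF n(3,4)] one_minus_2tq[OF n(3,4)] Jq_power
    using J by (simp add: field_simps expand_powers)
  finally show ?thesis .
qed

text \<open>Once the common eta quotient \<open>C\<close> is extracted, the components are rational
  in \<open>t\<close>, \<open>s\<close>, \<open>f\<close>. The modular equation
  \<open>s ^ 2 = f (1 - 2 s f)\<close> makes their sum factor as
  \<open>(1 + t)(1 - f / s)(1 - s + s ^ 2)\<close>, and each factor is an eta quotient.\<close>

lemma g_sum:
  assumes "norm q < 1" "q \<noteq> 0"
  shows "gq (q ^ 3) 0 + q * gq (q ^ 3) 1 + q ^ 2 * gq (q ^ 3) 2 = Jq q 2 ^ 4 * Jq q 8 / (Jq q 1 * Jq q 4 ^ 3)"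
proof -
  note J = Jq_nonzero[OF assms(1)] and r = tq_relations[OF assms]
  have n: "norm (q ^ 2) < 1" "q ^ 2 \<noteq> 0" "norm (q ^ 4) < 1" "q ^ 4 \<noteq> 0" using assms by (auto intro!: norm_power_lt_1)
  define t s f where "t = tq q" and "s = tq (q ^ 2)" and "f = tq (q ^ 4)"
  define C where "C = Jq q 6 ^ 4 * Jq q 9 ^ 2 * Jq q 24 * Jq q 36 ^ 5 / (Jq q 3 * Jq q 12 ^ 8 * Jq q 72 ^ 2)"
  have s0: "s \<noteq> 0" unfolding s_def by (rule tq_nonzero[OF n(1,2)])
  have s1: "1 + s = Jq q 4 ^ 2 * Jq q 6 * Jq q 36 / (Jq q 2 * Jq q 12 * Jq q 18 ^ 2)"
    unfolding s_def using one_plus_tq[OF n(1,2)] by (simp add: Jq_power)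
  then have s10: "1 + s \<noteq> 0" using J by simp
  have g0: "gq (q ^ 3) 0 = C * ((1 - s * f) * (1 - 2 * t * f / s))"
    unfolding s_def t_def f_def r(3) tq_ratio[OF assms] C_def gq_def Jq_power
    using J by (simp add: field_simps expand_powers)
  have g1: "q * gq (q ^ 3) 1 = C * ((1 - s * f) * (t + 2 * f))"
    unfolding s_def t_def f_def r(3) tq_plus_2tq4[OF assms] C_def gq_def Jq_power
    using J by (simp add: field_simps expand_powers)
  have g2: "q ^ 2 * gq (q ^ 3) 2 = C * (- 2 * (f / s) * (1 - s * f) * (1 - t * s))"
    unfolding s_def t_def f_def r(3,6) unfolding tq_power C_def gq_def Jq_power
    using J assms by (simp add: field_simps expand_powers)
  have rr: "s ^ 2 = f * (1 - 2 * (s * f))"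
    using r(2) by (simp add: s_def f_def)
  have "s * ((1 - s * f) * (1 - 2 * t * f / s) + (1 - s * f) * (t + 2 * f) + (- 2 * (f / s) * (1 - s * f) * (1 - t * s)))
     = (1 - s * f) * (s - 2 * t * f) + s * (1 - s * f) * (t + 2 * f) - 2 * f * (1 - s * f) * (1 - t * s)"
    using s0 by (simp add: field_simps)
  also have "\<dots> = (1 + t) * (s - f) * (1 - s + s ^ 2)" using rr by algebra
  also have "\<dots> = s * ((1 + t) * (1 - f / s) * (1 - s + s ^ 2))" using s0 by (simp add: field_simps)
  finally have key: "(1 - s * f) * (1 - 2 * t * f / s) + (1 - s * f) * (t + 2 * f) + (- 2 * (f / s) * (1 - s * f) * (1 - t * s))
     = (1 + t) * (1 - f / s) * (1 - s + s ^ 2)" by (rule mult_left_cancel[OF s0, THEN iffD1])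
  have "1 - s + s ^ 2 = (1 + s ^ 3) / (1 + s)"
  proof -
    have "(1 - s + s ^ 2) * (1 + s) = 1 + s ^ 3" by algebra
    then show ?thesis using s10 by (simp add: eq_divide_eq)
  qed
  note e = this
  have "gq (q ^ 3) 0 + q * gq (q ^ 3) 1 + q ^ 2 * gq (q ^ 3) 2 = C *
      ((1 - s * f) * (1 - 2 * t * f / s) + (1 - s * f) * (t + 2 * f) + (- 2 * (f / s) * (1 - s * f) * (1 - t * s)))"
    unfolding g0 g1 g2 by (rule distrib3[symmetric])
  also have "\<dots> = C * ((1 + t) * (1 - f / s) * ((1 + s ^ 3) / (1 + s)))"
    unfolding key e ..
  also have "\<dots> = Jq q 2 ^ 4 * Jq q 8 / (Jq q 1 * Jq q 4 ^ 3)"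
    unfolding s1 unfolding t_def s_def f_def one_plus_tq[OF assms] tq_ratio_2[OF assms] r(7) C_def
    using J by (simp add: field_simps expand_powers)
  finally show ?thesis .
qed

text \<open>As for \<open>g_sum\<close>, but both modular equations are used, and the sum of the
  components factors as \<open>(1 + t)(1 - 2 f)(1 - s + s ^ 2)\<close>.\<close>

lemma h_sum:
  assumes "norm q < 1" "q \<noteq> 0"
  shows "hq (q ^ 3) 0 + q * hq (q ^ 3) 1 + q ^ 2 * hq (q ^ 3) 2 = Jq q 2 ^ 3 / (Jq q 1 * Jq q 8)"
proof -
  note J = Jq_nonzero[OF assms(1)] and r = tq_relations[OF assms]
  have n: "norm (q ^ 2) < 1" "q ^ 2 \<noteq> 0" "norm (q ^ 4) < 1" "q ^ 4 \<noteq> 0" using assms by (auto intro!: norm_power_lt_1)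
  define t s f where "t = tq q" and "s = tq (q ^ 2)" and "f = tq (q ^ 4)"
  define C where "C = Jq q 6 ^ 3 * Jq q 9 ^ 2 * Jq q 18 ^ 2 * Jq q 36 ^ 2 / (Jq q 3 * Jq q 12 ^ 6 * Jq q 72)"
  have t0: "t \<noteq> 0" unfolding t_def by (rule tq_nonzero[OF assms])
  have s1: "1 + s = Jq q 4 ^ 2 * Jq q 6 * Jq q 36 / (Jq q 2 * Jq q 12 * Jq q 18 ^ 2)"
    unfolding s_def using one_plus_tq[OF n(1,2)] by (simp add: Jq_power)
  then have s10: "1 + s \<noteq> 0" using J by simp
  have h0: "hq (q ^ 3) 0 = C * ((1 - t * s) * (1 + 2 * (s * f)))"
    unfolding s_def t_def f_def r(4,6) C_def hq_def Jq_power
    using J by (simp add: field_simps expand_powers)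
  have h1: "q * hq (q ^ 3) 1 = C * ((t - f) * (1 + 2 * (s * f)))"
    unfolding s_def t_def f_def r(4) tq_minus_tq4[OF assms] C_def hq_def Jq_power
    using J by (simp add: field_simps expand_powers)
  have h2: "q ^ 2 * hq (q ^ 3) 2 = C * (- ((1 - t * s) * (s / t) * (t + 2 * f)))"
    unfolding s_def t_def f_def r(6) tq_plus_2tq4[OF assms] unfolding tq_power tq_eq[of q] C_def hq_def Jq_power
    using J assms by (simp add: field_simps expand_powers)
  have rr: "s ^ 2 = f * (1 - 2 * (s * f))" "t ^ 2 = s * (1 - 2 * (t * s))"
    using r(1,2) by (simp_all add: s_def f_def t_def)
  have "t * ((1 - t * s) * (1 + 2 * (s * f)) + (t - f) * (1 + 2 * (s * f)) + (- ((1 - t * s) * (s / t) * (t + 2 * f))))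
     = t * (1 - t * s) * (1 + 2 * (s * f)) + t * (t - f) * (1 + 2 * (s * f)) - (1 - t * s) * s * (t + 2 * f)"
    using t0 by (simp add: field_simps)
  also have "\<dots> = t * ((1 + t) * (1 - 2 * f) * (1 - s + s ^ 2))" using rr by algebra
  finally have key: "(1 - t * s) * (1 + 2 * (s * f)) + (t - f) * (1 + 2 * (s * f)) + (- ((1 - t * s) * (s / t) * (t + 2 * f)))
     = (1 + t) * (1 - 2 * f) * (1 - s + s ^ 2)" by (rule mult_left_cancel[OF t0, THEN iffD1])
  have "1 - s + s ^ 2 = (1 + s ^ 3) / (1 + s)"
  proof -
    have "(1 - s + s ^ 2) * (1 + s) = 1 + s ^ 3" by algebra
    then show ?thesis using s10 by (simp add: eq_divide_eq)
  qed
  note e = this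
  have "hq (q ^ 3) 0 + q * hq (q ^ 3) 1 + q ^ 2 * hq (q ^ 3) 2 = C *
      ((1 - t * s) * (1 + 2 * (s * f)) + (t - f) * (1 + 2 * (s * f)) + (- ((1 - t * s) * (s / t) * (t + 2 * f))))"
    unfolding h0 h1 h2 by (rule distrib3[symmetric])
  also have "\<dots> = C * ((1 + t) * (1 - 2 * f) * ((1 + s ^ 3) / (1 + s)))"
    unfolding key e ..
  also have "\<dots> = Jq q 2 ^ 3 / (Jq q 1 * Jq q 8)"
    unfolding s1 unfolding t_def s_def f_def one_plus_tq[OF assms] one_minus_2tq[OF n(3,4)] r(7) C_def Jq_power
    using J by (simp add: field_simps expand_powers)
  finally show ?thesis .
qed

end

subsection \<open>Bilateral form of the rank series\<close>

lemma solve_linear: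
  fixes x :: "'a :: field"
  shows "x * l - m = r \<Longrightarrow> x \<noteq> 0 \<Longrightarrow> l = (m + r) / x"
  by (auto simp: eq_divide_eq mult.commute)

lemma infsum_int_symmetric:
  fixes f :: "int \<Rightarrow> complex"
  assumes "f summable_on UNIV"
  shows "infsum f UNIV = f 0 + (\<Sum>\<^sub>\<infinity>n\<in>{1..}. f (int n) + f (- int n))"
    and "(\<lambda>n. f (int n) + f (- int n)) summable_on {1..}"
proof -
  have s: "f summable_on S" for S by (rule summable_on_subset_banach[OF assms]) auto
  have ip: "inj_on int {1..}" and im: "inj_on (\<lambda>n. - int n) {1..}" by (auto simp: inj_on_def)
  have sp: "(\<lambda>n. f (int n)) summable_on {1..}" and sm: "(\<lambda>n. f (- int n)) summable_on {1..}"
    using s summable_on_reindex[OF ip, of f] summable_on_reindex[OF im, of f] by (auto simp: o_def)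
  have U: "(UNIV :: int set) = {0} \<union> (int ` {1..} \<union> (\<lambda>n. - int n) ` {1..})"
  proof -
    have "x \<in> {0} \<union> (int ` {1..} \<union> (\<lambda>n. - int n) ` {1..})" for x
      by (cases x rule: int_cases3) (auto simp: image_iff)
    then show ?thesis by auto
  qed
  have "infsum f UNIV = f 0 + (infsum f (int ` {1..}) + infsum f ((\<lambda>n. - int n) ` {1..}))"
    unfolding U by (subst infsum_Un_disjoint, use s in auto)+
  also have "\<dots> = f 0 + ((\<Sum>\<^sub>\<infinity>n\<in>{1..}. f (int n)) + (\<Sum>\<^sub>\<infinity>n\<in>{1..}. f (- int n)))"
    unfolding infsum_reindex[OF ip] infsum_reindex[OF im] o_def ..
  finally show "infsum f UNIV = f 0 + (\<Sum>\<^sub>\<infinity>n\<in>{1..}. f (int n) + f (- int n))"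
    unfolding infsum_add[OF sp sm] .
  show "(\<lambda>n. f (int n) + f (- int n)) summable_on {1..}" by (rule summable_on_add[OF sp sm])
qed

lemma theta_term_square: "theta_term q (q ^ 2) n = (- 1) powi n * q powi (n * n)" if "q \<noteq> 0"
proof -
  have "2 * tri n + n = n * n" using two_tri[of n] by (simp add: algebra_simps)
  then show ?thesis using that by (simp add: theta_term_def power_int_power flip: power_int_add)
qed

lemma summable_theta_quotient:
  assumes "norm q < 1" "q \<noteq> 0" "x \<noteq> 0" "norm Q < 1" "Q \<noteq> 0" "b \<noteq> 0"
  shows "(\<lambda>n. theta_term x Q n / (1 - q powi n * b)) summable_on UNIV"
proof -
  obtain B where "\<forall>r::int. norm (1 / (1 - q powi (r - 1) * (b * q))) \<le> B"
    using bounded_lerch_denominator[OF assms(2,1), of "b * q"] assms by auto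
  then have "norm (1 / (1 - q powi n * b)) \<le> B" for n
  proof -
    assume a: "\<forall>r::int. norm (1 / (1 - q powi (r - 1) * (b * q))) \<le> B"
    have "q powi (n - 1) * (b * q) = q powi n * b" using assms by (simp add: power_int_diff)
    then show ?thesis using a by metis
  qed
  then show ?thesis
    using summable_on_bounded_mult[OF summable_theta[OF assms(5,4,3)], of "\<lambda>n. 1 / (1 - q powi n * b)" B] by simp
qed

context cube_root begin

text \<open>With \<open>X = q ^ (3 * n)\<close> the two fractions are the denominators of the
  bilateral series at \<open>n\<close> and at \<open>-n\<close>, the latter cleared of negative
  powers; the subtracted 2 comes from the theta series.\<close>

lemma factor_rational:
  assumes "1 - \<omega> * X \<noteq> 0" "1 - \<omega> ^ 2 * X \<noteq> 0"
  shows "(\<omega> ^ 2 - \<omega>) * (2 * (1 / (1 - \<omega> * X) + - (\<omega> ^ 2 * X) / (1 - \<omega> ^ 2 * X)) - 2) =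
    2 * ((1 - \<omega>) * (1 - \<omega> ^ 2) * X / ((1 - \<omega> * X) * (1 - \<omega> ^ 2 * X)))"
proof -
  have "(\<omega> ^ 2 - \<omega>) * (2 * ((1 - \<omega> ^ 2 * X) + - (\<omega> ^ 2 * X) * (1 - \<omega> * X)) - 2 * ((1 - \<omega> * X) * (1 - \<omega> ^ 2 * X)))
     = 2 * ((1 - \<omega>) * (1 - \<omega> ^ 2) * X)"
    using quad by algebra
  then have "2 * ((1 - \<omega>) * (1 - \<omega> ^ 2) * X / ((1 - \<omega> * X) * (1 - \<omega> ^ 2 * X))) =
     (\<omega> ^ 2 - \<omega>) * (2 * ((1 - \<omega> ^ 2 * X) + - (\<omega> ^ 2 * X) * (1 - \<omega> * X)) - 2 * ((1 - \<omega> * X) * (1 - \<omega> ^ 2 * X))) / ((1 - \<omega> * X) * (1 - \<omega> ^ 2 * X))"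
    by simp
  also have "\<dots> = (\<omega> ^ 2 - \<omega>) * (2 * (1 / (1 - \<omega> * X) + - (\<omega> ^ 2 * X) / (1 - \<omega> ^ 2 * X)) - 2)"
    using assms by (simp add: divide_simps)
  finally show ?thesis by simp
qed

lemma root_avoid:
  fixes q :: complex
  assumes "norm q < 1" "q \<noteq> 0" "norm z = 1" "z \<noteq> 1"
  shows "1 - z * q powi n \<noteq> 0"
proof (cases "n = 0")
  case False
  then have "norm (z * q powi n) \<noteq> 1" using norm_powi_ne_1[OF assms(1,2) False] assms by (simp add: norm_mult)
  then show ?thesis by auto
qed (use assms in auto)

text \<open>Pairing \<open>n\<close> with \<open>-n\<close> and subtracting the theta series
  \<open>J_1 ^ 2 / J_2\<close> gives the summand of \<open>O3\<close> by
  \<open>factor_rational\<close>; the numerator \<open>X\<close> there accounts for the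
  \<open>3 * n\<close> in the exponent.\<close>

lemma O3_bilateral:
  assumes "norm q < 1" "q \<noteq> 0"
  shows "O3 \<omega> q = Jq q 2 / Jq q 1 ^ 2 * ((\<omega> ^ 2 - \<omega>) *
    (2 * (\<Sum>\<^sub>\<infinity>n. theta_term q (q ^ 2) n / (1 - (q ^ 3) powi n * \<omega>)) - Jq q 1 ^ 2 / Jq q 2))"
proof -
  interpret s: cube_root "\<omega> ^ 2" by (rule sq)
  have n2: "norm (q ^ 2) < 1" "q ^ 2 \<noteq> 0" "norm (q ^ 3) < 1" "q ^ 3 \<noteq> 0" using assms by (auto intro!: norm_power_lt_1)
  define b where "b = theta_term q (q ^ 2)"
  define a where "a n = b n / (1 - (q ^ 3) powi n * \<omega>)" for n
  have sb: "b summable_on UNIV" unfolding b_def using assms n2 by (intro summable_theta) auto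
  have sa: "a summable_on UNIV" unfolding a_def b_def
    using summable_theta_quotient[of "q ^ 3" q "q ^ 2" \<omega>] assms n2 nz by simp
  have bs: "infsum b UNIV = Jq q 1 ^ 2 / Jq q 2"
    using jacobi_triple_product[OF n2(2,1) assms(2)] jtheta_half[OF assms] by (simp add: b_def)
  define t where "t n = (1 - \<omega>) * (1 - inverse \<omega>) * (- 1) ^ n * q ^ (n\<^sup>2 + 3 * n) /
        ((1 - \<omega> * q ^ (3 * n)) * (1 - inverse \<omega> * q ^ (3 * n)))" for n :: nat
  have bn: "b (int n) = (- 1) ^ n * q ^ n\<^sup>2" "b (- int n) = (- 1) ^ n * q ^ n\<^sup>2" for n
    unfolding b_def theta_term_square[OF assms(2)]
    by (simp_all add: power2_eq_square power_int_minus flip: of_nat_mult power_int_of_nat)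
       (simp_all add: power_minus1_odd flip: power_inverse)
  have X: "1 - \<omega> * q ^ (3 * n) \<noteq> 0" "1 - \<omega> ^ 2 * q ^ (3 * n) \<noteq> 0" for n
    using root_avoid[OF assms norm1 ne1, of "int (3 * n)"] root_avoid[OF assms s.norm1 s.ne1, of "int (3 * n)"] 
    unfolding power_int_of_nat by auto
  have pt: "(\<omega> ^ 2 - \<omega>) * (2 * (a (int n) + a (- int n)) - (b (int n) + b (- int n))) = 2 * t n" for n
  proof -
    define Y where "Y = q ^ (3 * n)"
    have Y0: "Y \<noteq> 0" using assms by (simp add: Y_def)
    have X: "1 - \<omega> * Y \<noteq> 0" "1 - \<omega> ^ 2 * Y \<noteq> 0" using X by (auto simp: Y_def)
    have i: "1 / (1 - inverse Y * \<omega>) = - (\<omega> ^ 2 * Y) / (1 - \<omega> ^ 2 * Y)"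
    proof -
      have "1 - inverse Y * \<omega> = (1 - \<omega> ^ 2 * Y) / (- (\<omega> ^ 2 * Y))"
        using Y0 nz cube by (simp add: field_simps eval_nat_numeral)
      then show ?thesis by simp
    qed
    have Y: "(q ^ 3) ^ n = Y" by (simp add: Y_def power_mult)
    have "a (int n) = (- 1) ^ n * q ^ n\<^sup>2 * (1 / (1 - \<omega> * Y))"
      by (simp add: a_def bn Y mult.commute)
    moreover have "a (- int n) = (- 1) ^ n * q ^ n\<^sup>2 * (1 / (1 - inverse Y * \<omega>))"
      by (simp add: a_def bn power_int_minus Y)
    ultimately have "a (int n) + a (- int n) = (- 1) ^ n * q ^ n\<^sup>2 * (1 / (1 - \<omega> * Y) + - (\<omega> ^ 2 * Y) / (1 - \<omega> ^ 2 * Y))"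
      unfolding i by (simp only: distrib_left)
    moreover have "k * (2 * (c * x) - (c + c)) = c * (k * (2 * x - 2))" for k c x :: complex
      by (simp add: algebra_simps)
    ultimately have "(\<omega> ^ 2 - \<omega>) * (2 * (a (int n) + a (- int n)) - (b (int n) + b (- int n))) =
       (- 1) ^ n * q ^ n\<^sup>2 * ((\<omega> ^ 2 - \<omega>) * (2 * (1 / (1 - \<omega> * Y) + - (\<omega> ^ 2 * Y) / (1 - \<omega> ^ 2 * Y)) - 2))"
      unfolding bn by (simp only:)
    then show ?thesis
      unfolding factor_rational[OF X] t_def inv Y_def[symmetric] power_add by (simp add: mult_ac)
  qed
  define h where "h n = 2 * (a (int n) + a (- int n)) - (b (int n) + b (- int n))" for n
  have "2 * infsum a UNIV - infsum b UNIV = 2 * a 0 - b 0 + (\<Sum>\<^sub>\<infinity>n\<in>{1..}. h n)"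
  proof -
    have "(\<Sum>\<^sub>\<infinity>n\<in>{1..}. h n) = (\<Sum>\<^sub>\<infinity>n\<in>{1..}. 2 * (a (int n) + a (- int n)) + - (b (int n) + b (- int n)))"
      by (simp only: h_def diff_conv_add_uminus)
    also have "\<dots> = (\<Sum>\<^sub>\<infinity>n\<in>{1..}. 2 * (a (int n) + a (- int n))) + (\<Sum>\<^sub>\<infinity>n\<in>{1..}. - (b (int n) + b (- int n)))"
      using infsum_int_symmetric(2)[OF sa] infsum_int_symmetric(2)[OF sb]
      by (intro infsum_add summable_on_cmult_right summable_on_uminus[THEN iffD2])
    also have "\<dots> = 2 * (\<Sum>\<^sub>\<infinity>n\<in>{1..}. a (int n) + a (- int n)) - (\<Sum>\<^sub>\<infinity>n\<in>{1..}. b (int n) + b (- int n))"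
      by (simp only: infsum_uminus infsum_cmult_right' diff_conv_add_uminus)
    finally show ?thesis
      using infsum_int_symmetric(1)[OF sa] infsum_int_symmetric(1)[OF sb] by (simp add: algebra_simps)
  qed
  then have "(\<omega> ^ 2 - \<omega>) * (2 * infsum a UNIV - infsum b UNIV) = (\<omega> ^ 2 - \<omega>) * (2 * a 0 - b 0) + (\<Sum>\<^sub>\<infinity>n\<in>{1..}. (\<omega> ^ 2 - \<omega>) * h n)"
    by (simp only: distrib_left infsum_cmult_right')
  also have "(\<Sum>\<^sub>\<infinity>n\<in>{1..}. (\<omega> ^ 2 - \<omega>) * h n) = 2 * (\<Sum>\<^sub>\<infinity>n\<in>{1..}. t n)"
    unfolding h_def pt by (rule infsum_cmult_right')
  \<comment> \<open>The term with \<open>n = 0\<close> supplies the isolated 1 of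
    \<open>O3\<close>.\<close>
  also have "(\<omega> ^ 2 - \<omega>) * (2 * a 0 - b 0) = 1"
  proof -
    have "2 * a 0 - b 0 = (1 + \<omega>) / (1 - \<omega>)"
      using ne1 by (simp add: a_def b_def theta_term_def field_simps)
    moreover have "(\<omega> ^ 2 - \<omega>) * (1 + \<omega>) = 1 - \<omega>" using quad by algebra
    ultimately show ?thesis using ne1 by simp
  qed
  finally have "(\<omega> ^ 2 - \<omega>) * (2 * infsum a UNIV - infsum b UNIV) = 1 + 2 * (\<Sum>\<^sub>\<infinity>n\<in>{1..}. t n)" .
  moreover have "qpoch_inf (- q) q / qpoch_inf q q = Jq q 2 / Jq q 1 ^ 2"
    unfolding qpoch_minus_self[OF assms(1)] qpoch_Jq by (simp add: power2_eq_square)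
  ultimately show ?thesis
    unfolding O3_def t_def[symmetric] bs by (simp add: a_def[abs_def] b_def)
qed

lemma cubic_partial_fractions:
  assumes "1 - Y \<noteq> 0" "1 - \<omega> * Y \<noteq> 0" "1 - \<omega> ^ 2 * Y \<noteq> 0"
  shows "1 / (1 - Y ^ 3) = (1 / (1 - Y) + 1 / (1 - \<omega> * Y) + 1 / (1 - \<omega> ^ 2 * Y)) / 3"
proof -
  have "(1 - \<omega> * Y) * (1 - \<omega> ^ 2 * Y) + (1 - Y) * (1 - \<omega> ^ 2 * Y) + (1 - Y) * (1 - \<omega> * Y) = 3"
    using quad by algebra
  then have "1 / (1 - Y) + 1 / (1 - \<omega> * Y) + 1 / (1 - \<omega> ^ 2 * Y) = 3 / ((1 - Y) * (1 - \<omega> * Y) * (1 - \<omega> ^ 2 * Y))"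
    using assms by (simp add: add_frac_eq) (simp add: algebra_simps)
  moreover have "3 / D / 3 = 1 / D" for D :: complex by simp
  ultimately show ?thesis unfolding cubic by (simp only:)
qed

end

text \<open>Multiplying numerator and denominator by \<open>1 + yq\<^sup>n\<close> splits the series into two series in base
  \<open>q\<^sup>2\<close>: the first is changed to the parameter \<open>w = -1\<close>, and the second is the partial fraction
  expansion of a theta reciprocal.\<close>
lemma rank_series_theta:
  assumes q: "norm q < 1" "q \<noteq> 0" and y: "norm y = 1" "y ^ 2 \<noteq> 1"
  shows "(\<Sum>\<^sub>\<infinity>n. theta_term q (q ^ 2) n / (1 - q powi n * y)) =
    Jq q 1 ^ 2 / Jq q 2 * (lerch (- (q * y ^ 2)) (- 1) (q ^ 2) / jtheta (- 1) (q ^ 2)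
      + Jq q 2 ^ 4 / (2 * Jq q 4 ^ 2) * (jtheta (- y) q / (jtheta y q * jtheta (- (q * y ^ 2)) (q ^ 2))))"
proof -
  define Q where "Q = q ^ 2"
  have Q: "norm Q < 1" "Q \<noteq> 0" using q by (auto simp: Q_def intro!: norm_power_lt_1)
  note J = Jq_nonzero[OF q(1)]
  have y0: "y \<noteq> 0" using y by auto
  have y2: "norm (y ^ 2) = 1" using y by (simp add: norm_power)
  have ne: "y * q powi n \<noteq> 1 \<and> y * q powi n \<noteq> - 1" for n
  proof (cases "n = 0")
    case False
    then have "norm (y * q powi n) \<noteq> 1" using norm_powi_ne_1[OF q False] y by (simp add: norm_mult)
    then show ?thesis by auto
  qed (use y in auto)
  have nd: "1 - y * q powi n \<noteq> 0" "1 + y * q powi n \<noteq> 0" for n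
    using ne[of n] by (auto simp: add_eq_0_iff)
  have Qs: "Q powi (n - 1) * (Q * y ^ 2) = (y * q powi n) ^ 2" for n
  proof -
    have "Q powi (n - 1) * Q = Q powi n" using Q by (simp add: power_int_diff)
    also have "\<dots> = (q powi n) ^ 2" by (simp add: Q_def power_int_power power_int_power' mult.commute)
    finally show ?thesis by (simp add: power_mult_distrib mult.assoc[symmetric] mult.commute)
  qed
  have d: "1 - Q powi (n - 1) * (Q * y ^ 2) = (1 - y * q powi n) * (1 + y * q powi n)" for n
    unfolding Qs by (simp add: algebra_simps power2_eq_square)
  have avQ: "Q powi r * (Q * y ^ 2) \<noteq> 1" for r
    using d[of "r + 1"] nd[of "r + 1"] by auto
  have avq: "Q powi r * (- (q * y ^ 2)) \<noteq> 1" for r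
  proof -
    have "norm (- (q * y ^ 2)) = norm (q ^ 1)" using y(1) by (simp add: norm_mult norm_power)
    moreover have "\<not> int 2 dvd int 1" by simp
    ultimately show ?thesis unfolding Q_def by (rule lattice_avoid[OF q])
  qed
  have pt: "theta_term q Q n / (1 - q powi n * y) =
     theta_term q Q n / (1 - Q powi (n - 1) * (Q * y ^ 2)) + y * (theta_term Q Q n / (1 - Q powi (n - 1) * (Q * y ^ 2)))" for n
  proof -
    have t: "theta_term Q Q n = theta_term q Q n * q powi n"
    proof -
      have "Q powi n = q powi n * q powi n" by (simp add: Q_def power2_eq_square power_int_mult_distrib)
      then show ?thesis unfolding theta_term_def by (simp only: mult.assoc)
    qed
    have "theta_term q Q n / ((1 - y * q powi n) * (1 + y * q powi n)) + y * (theta_term q Q n * q powi n / ((1 - y * q powi n) * (1 + y * q powi n)))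
       = theta_term q Q n * (1 + y * q powi n) / ((1 - y * q powi n) * (1 + y * q powi n))"
      by (simp add: distrib_left add_divide_distrib mult_ac)
    then show ?thesis unfolding d t using nd[of n] by (simp add: mult.commute)
  qed
  have sm: "(\<lambda>n. theta_term x Q n / (1 - Q powi (n - 1) * (Q * y ^ 2))) summable_on UNIV" if "x \<noteq> 0" for x
    using summable_lerch[OF Q(2,1) that, of "Q * y ^ 2"] Q y0 by simp
  have U: "(\<Sum>\<^sub>\<infinity>n. theta_term q Q n / (1 - q powi n * y)) = lerch (Q * y ^ 2) q Q + y * lerch (Q * y ^ 2) Q Q"
    unfolding pt lerch_def infsum_add[OF sm[OF q(2)] summable_on_cmult_right[OF sm[OF Q(2)], of y]] infsum_cmult_right' ..
  define b where "b = - (q * y ^ 2)"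
  define T where "T = Jq q 2 ^ 3"
  have b: "b \<noteq> 0" "Q * y ^ 2 = (- q) * b" using q y0 by (simp_all add: b_def Q_def power2_eq_square)
  have T: "qpoch_inf Q Q ^ 3 = T" by (simp add: T_def Q_def Jq_def)
  have avb: "Q powi r * b \<noteq> 1" "Q powi r * ((- q) * b) \<noteq> 1" for r using avq avQ b by (auto simp: b_def)
  have thb: "jtheta b Q \<noteq> 0" by (rule jtheta_nonzero[OF Q(2,1) b(1)]) (rule avb)
  have sh: "jtheta (Q * y ^ 2) Q = - jtheta (y ^ 2) Q / y ^ 2" "jtheta (- (Q * y ^ 2)) Q = jtheta (- (y ^ 2)) Q / y ^ 2"
    using jtheta_shift[OF Q(2,1), of "y ^ 2"] jtheta_shift[OF Q(2,1), of "- (y ^ 2)"] y0 by simp_all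
  have thy: "jtheta (y ^ 2) Q \<noteq> 0"
  proof -
    have "jtheta (Q * y ^ 2) Q \<noteq> 0" by (rule jtheta_nonzero[OF Q(2,1)]) (use Q y0 avQ in auto)
    then show ?thesis unfolding sh using y0 by simp
  qed
  have th1: "jtheta (- 1) Q = 2 * Jq q 4 ^ 2 / Jq q 2" using jtheta_minus_1[OF Q(1)] by (simp add: Q_def Jq_power)
  then have th10: "jtheta (- 1) Q \<noteq> 0" using J by simp
  \<comment> \<open>\<open>lerch_change\<close> with \<open>c = - q\<close>,
    \<open>b = - (q * y ^ 2)\<close> and \<open>w = - 1\<close>, so that \<open>c * w = q\<close>
    and \<open>c * b = Q * y ^ 2\<close>.\<close>
  have L1: "lerch (Q * y ^ 2) q Q = (jtheta q Q * lerch b (- 1) Q + jtheta (- q) Q * T * jtheta (- (y ^ 2)) Q / (jtheta b Q * jtheta (y ^ 2) Q)) / jtheta (- 1) Q"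
  proof -
    have "- (1::complex) * jtheta (- q) Q * T * jtheta (- q * b * - 1) Q / (jtheta b Q * jtheta (- q * b) Q)
       = jtheta (- q) Q * T * jtheta (- (y ^ 2)) Q / (jtheta b Q * jtheta (y ^ 2) Q)"
    proof -
      have e: "- q * b * - 1 = - (Q * y ^ 2)" "- q * b = Q * y ^ 2" using b(2) by simp_all
      show ?thesis unfolding e(1) unfolding e(2) sh using y0 thy thb by simp
    qed
    then have "jtheta (- 1) Q * lerch (Q * y ^ 2) q Q - jtheta q Q * lerch b (- 1) Q = jtheta (- q) Q * T * jtheta (- (y ^ 2)) Q / (jtheta b Q * jtheta (y ^ 2) Q)"
      using lerch_change[OF Q(2,1) _ b(1) _ avb, of "- 1"] q unfolding T b(2)[symmetric] by simp
    then show ?thesis using th10 by (rule solve_linear)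
  qed
  \<comment> \<open>The argument \<open>w = Q\<close> is that of \<open>w = 1\<close> with the index
    moved by one.\<close>
  have L2: "lerch (Q * y ^ 2) Q Q = T / jtheta (y ^ 2) Q"
  proof -
    define b' where "b' = Q * y ^ 2"
    have b': "b' \<noteq> 0" "\<And>r. Q powi r * b' \<noteq> 1" using avQ Q y0 by (auto simp: b'_def)
    have cb: "Q powi r * (1 / Q * b') \<noteq> 1" for r
      using avQ[of "r - 1"] Q by (simp add: b'_def power_int_diff)
    have "theta_term Q Q r = - theta_term 1 Q (r + 1)" for r
      using theta_term_add1[OF Q(2), of 1 r] by (simp add: theta_term_def)
    then have "lerch b' Q Q = (\<Sum>\<^sub>\<infinity>r. - (theta_term 1 Q (r + 1) / (1 - Q powi ((r + 1) - 1) * (b' / Q))))"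
      unfolding lerch_def using Q by (intro infsum_cong) (simp add: power_int_diff)
    also have "\<dots> = - lerch (b' / Q) 1 Q"
      unfolding infsum_uminus lerch_def
      by (subst infsum_reindex_bij_betw[of "\<lambda>r. r + 1" UNIV UNIV, symmetric])
         (auto intro: bij_betwI[where g = "\<lambda>r. r - 1"])
    also have "b' / Q = y ^ 2" using Q by (simp add: b'_def)
    finally have "lerch b' Q Q = - lerch (y ^ 2) 1 Q" .
    moreover have "jtheta (y ^ 2) Q * lerch (y ^ 2) 1 Q = - T"
      using jtheta_lerch_1[OF Q(2,1), of "y ^ 2"] y0 cb Q unfolding T by (simp add: b'_def)
    ultimately show ?thesis using thy by (simp add: b'_def eq_divide_eq mult.commute)
  qed
  \<comment> \<open>Over a common denominator the theta terms form the parity expansion of this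
    square; one of its two factors cancels against \<open>jtheta (y ^ 2) Q\<close> by
    \<open>ng\<close>.\<close>
  have sq: "jtheta (- (y ^ 2)) Q * jtheta (- q) Q + y * (jtheta b Q * jtheta (- 1) Q) = jtheta (- y) q ^ 2"
  proof -
    have e: "- (q ^ 2 * - y / (- y)) = - Q" "- (q * - y / - y) = - q" using y0 by (simp_all add: Q_def)
    have m: "- (- y * - y) = - (y ^ 2)" "- (q * - y * - y) = b" by (simp_all add: b_def power2_eq_square)
    have "jtheta (- Q) Q = jtheta (- 1) Q" using jtheta_flip[OF Q(2), of "- 1"] by simp
    moreover have "jtheta (- y) q * jtheta (- y) q = jtheta (- (y ^ 2)) Q * jtheta (- q) Q - - y * (jtheta b Q * jtheta (- Q) Q)"
      using theta_product_parity[OF q(2,1), of "- y" "- y"] y0 unfolding e m Q_def[symmetric] by simp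
    ultimately show ?thesis unfolding power2_eq_square[of "jtheta (- y) q"] by simp
  qed
  have ng: "jtheta (y ^ 2) Q = jtheta y q * jtheta (- y) q * Jq q 2 / Jq q 1 ^ 2"
    using jtheta_neg[OF q(1), of y] J by (simp add: Q_def field_simps)
  have nz2: "jtheta y q \<noteq> 0" "jtheta (- y) q \<noteq> 0" using thy unfolding ng by auto
  have h: "jtheta q Q = Jq q 1 ^ 2 / Jq q 2" unfolding Q_def by (rule jtheta_half[OF q])
  have "lerch (Q * y ^ 2) q Q + y * lerch (Q * y ^ 2) Q Q =
     jtheta q Q * lerch b (- 1) Q / jtheta (- 1) Q + T * (jtheta (- (y ^ 2)) Q * jtheta (- q) Q + y * (jtheta b Q * jtheta (- 1) Q)) / (jtheta (y ^ 2) Q * jtheta b Q * jtheta (- 1) Q)"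
    unfolding L1 L2 using thy thb th10 by (simp add: field_simps)
  also have "\<dots> = Jq q 1 ^ 2 / Jq q 2 * (lerch b (- 1) Q / jtheta (- 1) Q + Jq q 2 ^ 4 / (2 * Jq q 4 ^ 2) * (jtheta (- y) q / (jtheta y q * jtheta b Q)))"
    unfolding sq unfolding ng h T_def th1 using J nz2 thb by (simp add: field_simps expand_powers)
  finally show ?thesis using U unfolding Q_def b_def by simp
qed

subsection \<open>Trisection of the Appell--Lerch part\<close>

lemma tri_residue: "2 * tri (3 * k - s) = 18 * tri k + (6 - 6 * s) * k + s * (s + 1)"
  using two_tri[of k] two_tri[of "3 * k - s"] by (simp add: algebra_simps)

lemma sum_three: "(\<Sum>s<3. f s) = f 0 + f 1 + f (2::nat)" for f :: "nat \<Rightarrow> complex"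
  by (simp add: eval_nat_numeral)

context cube_root begin

text \<open>The first summands of the two parity expansions agree, by the flip between
  \<open>Q * \<omega>\<close> and \<open>Q * \<omega> ^ 2\<close>, and cancel. The second ones are
  \<open>J_12\<close> times an elementary value at a cube root of unity.\<close>

lemma omega_theta_difference:
  assumes q: "norm q < 1" "q \<noteq> 0"
  shows "jtheta (\<omega> * q ^ 3) (q ^ 18) * jtheta (- (\<omega> ^ 2 * q ^ 3)) (q ^ 18) - jtheta (\<omega> ^ 2 * q ^ 3) (q ^ 18) * jtheta (- (\<omega> * q ^ 3)) (q ^ 18)
    = 2 * q ^ 3 * Jq q 12 * Jq q 108 * (\<omega> ^ 2 - \<omega>)"
proof -
  interpret s: cube_root "\<omega> ^ 2" by (rule sq)
  define Q where "Q = q ^ 18"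
  have Q: "norm Q < 1" "Q \<noteq> 0" "norm (Q ^ 2) < 1" "Q ^ 2 \<noteq> 0" using q by (auto simp: Q_def norm_power_lt_1 simp flip: power_mult)
  have w: "\<omega> * \<omega> ^ 2 = 1" "\<omega> ^ 2 * \<omega> = 1" "\<omega> / \<omega> ^ 2 = \<omega> ^ 2" "\<omega> ^ 2 / \<omega> = \<omega>"
    using cube nz by (simp_all add: field_simps eval_nat_numeral)
  have Q2: "Q ^ 2 = q ^ 36" by (simp add: Q_def flip: power_mult)
  have p: "- ((\<omega> * q ^ 3) * - (\<omega> ^ 2 * q ^ 3)) = q ^ 6" "- (Q * (\<omega> * q ^ 3) / - (\<omega> ^ 2 * q ^ 3)) = Q * \<omega> ^ 2"
    "- (Q * (\<omega> * q ^ 3) * - (\<omega> ^ 2 * q ^ 3)) = q ^ 24" "- (Q ^ 2 * (\<omega> * q ^ 3) / - (\<omega> ^ 2 * q ^ 3)) = Q ^ 2 * \<omega> ^ 2"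
    "- ((\<omega> ^ 2 * q ^ 3) * - (\<omega> * q ^ 3)) = q ^ 6" "- (Q * (\<omega> ^ 2 * q ^ 3) / - (\<omega> * q ^ 3)) = Q * \<omega>"
    "- (Q * (\<omega> ^ 2 * q ^ 3) * - (\<omega> * q ^ 3)) = q ^ 24" "- (Q ^ 2 * (\<omega> ^ 2 * q ^ 3) / - (\<omega> * q ^ 3)) = Q ^ 2 * \<omega>"
  proof -
    have "(\<omega> * q ^ 3) * (\<omega> ^ 2 * q ^ 3) = (\<omega> * \<omega> ^ 2) * (q ^ 3 * q ^ 3)" by (simp add: mult_ac)
    also have "\<dots> = q ^ 6" unfolding w by (simp flip: power_add)
    finally have m: "(\<omega> * q ^ 3) * (\<omega> ^ 2 * q ^ 3) = q ^ 6" .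
    then have m': "(\<omega> ^ 2 * q ^ 3) * (\<omega> * q ^ 3) = q ^ 6" by (simp only: mult.commute)
    have "Q * q ^ 6 = q ^ 24" by (simp add: Q_def flip: power_add)
    then show "- ((\<omega> * q ^ 3) * - (\<omega> ^ 2 * q ^ 3)) = q ^ 6" "- ((\<omega> ^ 2 * q ^ 3) * - (\<omega> * q ^ 3)) = q ^ 6"
      "- (Q * (\<omega> * q ^ 3) * - (\<omega> ^ 2 * q ^ 3)) = q ^ 24" "- (Q * (\<omega> ^ 2 * q ^ 3) * - (\<omega> * q ^ 3)) = q ^ 24"
      using m m' by (simp_all add: mult.assoc)
    show "- (Q * (\<omega> * q ^ 3) / - (\<omega> ^ 2 * q ^ 3)) = Q * \<omega> ^ 2" "- (Q ^ 2 * (\<omega> * q ^ 3) / - (\<omega> ^ 2 * q ^ 3)) = Q ^ 2 * \<omega> ^ 2"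
      "- (Q * (\<omega> ^ 2 * q ^ 3) / - (\<omega> * q ^ 3)) = Q * \<omega>" "- (Q ^ 2 * (\<omega> ^ 2 * q ^ 3) / - (\<omega> * q ^ 3)) = Q ^ 2 * \<omega>"
      using q nz w by (simp_all add: field_simps)
  qed
  have f: "jtheta (Q * \<omega>) (Q ^ 2) = jtheta (Q * \<omega> ^ 2) (Q ^ 2)"
  proof -
    have "Q ^ 2 / (Q * \<omega> ^ 2) = Q * \<omega>" using Q nz inv(4)[of Q] by (simp add: power2_eq_square)
    then show ?thesis using jtheta_flip[of "Q ^ 2" "Q * \<omega> ^ 2"] Q nz by simp
  qed
  have g: "jtheta (Q ^ 2 * \<omega>) (Q ^ 2) = - (\<omega> ^ 2 * ((1 - \<omega>) * Jq q 108))" "jtheta (Q ^ 2 * \<omega> ^ 2) (Q ^ 2) = - (\<omega> * ((1 - \<omega> ^ 2) * Jq q 108))"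
    using jtheta_shift[OF Q(4,3) nz] jtheta_shift[OF Q(4,3) s.nz] jtheta_omega[OF Q(3)] s.jtheta_omega[OF Q(3)]
    by (simp_all add: inv Q2 Jq_power mult.commute)
  have h: "jtheta (q ^ 24) (Q ^ 2) = Jq q 12"
  proof -
    have n: "norm (q ^ 12) < 1" using q by (intro norm_power_lt_1) auto
    have "jtheta (q ^ 24) (q ^ 36) = jtheta (q ^ 12) (q ^ 36)"
      using jtheta_flip[of "q ^ 36" "q ^ 12"] q by (simp add: power_diff[symmetric])
    then show ?thesis using jtheta_third[OF n] q by (simp add: Q2 Jq_power flip: power_mult)
  qed
  have "jtheta (\<omega> * q ^ 3) Q * jtheta (- (\<omega> ^ 2 * q ^ 3)) Q - jtheta (\<omega> ^ 2 * q ^ 3) Q * jtheta (- (\<omega> * q ^ 3)) Q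
    = (\<omega> ^ 2 * q ^ 3) * (Jq q 12 * - (\<omega> ^ 2 * ((1 - \<omega>) * Jq q 108))) - (\<omega> * q ^ 3) * (Jq q 12 * - (\<omega> * ((1 - \<omega> ^ 2) * Jq q 108)))"
    using theta_product_parity[OF Q(2,1), of "\<omega> * q ^ 3" "- (\<omega> ^ 2 * q ^ 3)"] theta_product_parity[OF Q(2,1), of "\<omega> ^ 2 * q ^ 3" "- (\<omega> * q ^ 3)"] q nz
    unfolding p f g h by simp
  also have "\<dots> = 2 * q ^ 3 * Jq q 12 * Jq q 108 * (\<omega> ^ 2 - \<omega>)" using quad by algebra
  finally show ?thesis unfolding Q_def .
qed

text \<open>The residue classes are Lerch sums with \<open>w\<close> equal to \<open>-q^6\<close>,
  \<open>-1\<close> and \<open>-q^(-6)\<close>. Changing the outer two to \<open>-1\<close> relates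
  all of them to one sum \<open>L\<close>, at the cost of two theta quotients that are conjugate in
  \<open>\<omega>\<close>; \<open>omega_theta_difference\<close> collapses their difference.\<close>

lemma first_trisection:
  assumes q: "norm q < 1" "q \<noteq> 0"
  shows "(\<omega> ^ 2 - \<omega>) * (Jq q 2 / Jq q 4 ^ 2 * (\<Sum>\<^sub>\<infinity>r. q powi (2 * tri r) / (1 - q powi (6 * r - 3) * - (\<omega> ^ 2))) - 1)
   = (\<omega> ^ 2 - \<omega>) * (2 * (lerch (- (\<omega> ^ 2 * q ^ 9)) (- 1) (q ^ 18) / jtheta (- 1) (q ^ 18)) - 1)
     + 3 * q ^ 3 * (Jq q 6 ^ 3 * Jq q 9 * Jq q 108 / (Jq q 3 * Jq q 18 * Jq q 36)) * (Jq q 2 / Jq q 4 ^ 2)"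
proof -
  interpret s: cube_root "\<omega> ^ 2" by (rule sq)
  note J = Jq_nonzero[OF q(1)]
  define Q where "Q = q ^ 18"
  have Q: "norm Q < 1" "Q \<noteq> 0" using q by (auto simp: Q_def norm_power_lt_1)
  have n: "norm (q ^ 2) < 1" "norm (q ^ 6) < 1" "norm (q ^ 9) < 1" "norm (q ^ 3) < 1" "q ^ 3 \<noteq> 0" using q by (auto intro!: norm_power_lt_1)
  define F where "F r = q powi (2 * tri r) / (1 - q powi (6 * r - 3) * - (\<omega> ^ 2))" for r
  define g where "g s = - (\<omega> ^ 2 * q ^ (15 - 6 * s))" for s :: nat
  define w where "w s = - (q powi (6 - 6 * int s))" for s :: nat
  have F: "F (3 * k - int s) = q ^ (s * (s + 1)) * (theta_term (w s) Q k / (1 - Q powi (k - 1) * g s))" if "s < 3" for s k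
  proof -
    have "q powi (2 * tri (3 * k - int s)) = q ^ (s * (s + 1)) * theta_term (w s) Q k"
      unfolding tri_residue w_def Q_def theta_term_minus_power_base
      using q by (simp add: distrib_left[of "int s"] power_int_add power_int_power power_int_power' mult_ac flip: power_int_mult power_int_of_nat)
    moreover have "q powi (6 * (3 * k - int s) - 3) * - (\<omega> ^ 2) = Q powi (k - 1) * g s"
    proof -
      have "6 * (3 * k - int s) - 3 = 18 * (k - 1) + int (15 - 6 * s)" using that by (simp add: of_nat_diff)
      then have "q powi (6 * (3 * k - int s) - 3) = q powi (18 * (k - 1)) * q ^ (15 - 6 * s)"
        using q by (simp only: power_int_add power_int_of_nat simp_thms)
      then show ?thesis by (simp add: Q_def g_def power_int_power)
    qed
    ultimately show ?thesis unfolding F_def by simp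
  qed
  have sF: "F summable_on UNIV"
  proof -
    have "(\<lambda>r. theta_term (- 1) (q ^ 2) r / (1 - (q ^ 6) powi r * (- (\<omega> ^ 2) / q ^ 3))) summable_on UNIV"
      by (rule summable_theta_quotient) (use q n s.nz in auto)
    moreover have "theta_term (- 1) (q ^ 2) r / (1 - (q ^ 6) powi r * (- (\<omega> ^ 2) / q ^ 3)) = F r" for r
      unfolding F_def theta_term_minus_power_base using q by (simp add: power_int_diff power_int_power)
    ultimately show ?thesis by simp
  qed
  have M: "infsum F UNIV = (\<Sum>s<3. q ^ (s * (s + 1)) * lerch (g s) (w s) Q)"
    unfolding infsum_residue_split[OF bij_residue_minus sF] lerch_def
  proof (intro sum.cong refl)
    fix s :: nat
    assume "s \<in> {..<3}"
    then have "F (3 * k - int s) = q ^ (s * (s + 1)) * (theta_term (w s) Q k / (1 - Q powi (k - 1) * g s))" for k by (intro F) simp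
    then show "(\<Sum>\<^sub>\<infinity>k. F (3 * k - int s)) = q ^ (s * (s + 1)) * (\<Sum>\<^sub>\<infinity>n. theta_term (w s) Q n / (1 - Q powi (n - 1) * g s))"
      by (simp only: infsum_cmult_right')
  qed
  have g: "g 0 = - (\<omega> ^ 2 * q ^ 15)" "g 1 = - (\<omega> ^ 2 * q ^ 9)" "g 2 = - (\<omega> ^ 2 * q ^ 3)"
    and w: "w 0 = - (q ^ 6)" "w 1 = - 1" "w 2 = - (1 / q ^ 6)"
    by (simp_all add: g_def w_def power_int_minus divide_inverse)
  define b where "b = g 1"
  have cb: "q ^ 6 * b = g 0" "1 / q ^ 6 * b = g 2"
    using q unfolding b_def g by (simp_all add: eval_nat_numeral)
  have av: "Q powi r * g s \<noteq> 1" if "s < 3" for r s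
    unfolding g_def Q_def
  proof (rule lattice_avoid[OF q])
    show "norm (- (\<omega>\<^sup>2 * q ^ (15 - 6 * s))) = norm (q ^ (15 - 6 * s))" by (simp add: norm_mult norm_power norm1)
    show "\<not> int 18 dvd int (15 - 6 * s)" using that by (auto simp: numeral_3_eq_3 less_Suc_eq)
  qed
  have g0: "g s \<noteq> 0" for s using q nz by (simp add: g_def)
  have b0: "b \<noteq> 0" unfolding b_def by (rule g0)
  have nzt: "jtheta (g s) Q \<noteq> 0" if "s < 3" for s
    by (rule jtheta_nonzero[OF Q(2,1) g0]) (rule av[OF that])
  define T where "T = Jq q 18 ^ 3"
  have T: "qpoch_inf Q Q ^ 3 = T" by (simp add: T_def Q_def Jq_def)
  define L where "L = lerch b (- 1) Q"
  define h where "h = jtheta (- 1) Q"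
  have h: "h = 2 * Jq q 36 ^ 2 / Jq q 18" unfolding h_def using jtheta_minus_1[OF Q(1)] by (simp add: Q_def Jq_power)
  have h0: "h \<noteq> 0" unfolding h using J by simp
  have j6: "jtheta (q ^ 6) Q = Jq q 6" using jtheta_third[OF n(2)] q by (simp add: Q_def Jq_power flip: power_mult)
  have i6: "jtheta (1 / q ^ 6) Q = - (Jq q 6 / q ^ 6)" "jtheta (- (1 / q ^ 6)) Q = jtheta (- (q ^ 6)) Q / q ^ 6"
    using jtheta_inverse[OF Q(2,1), of "q ^ 6"] jtheta_inverse[OF Q(2,1), of "- (q ^ 6)"] q j6 by simp_all
  have fl: "jtheta (\<omega> ^ 2 * q ^ 15) Q = jtheta (\<omega> * q ^ 3) Q" "jtheta (- (\<omega> ^ 2 * q ^ 15)) Q = jtheta (- (\<omega> * q ^ 3)) Q"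
  proof -
    have "q ^ 18 / (\<omega> * q ^ 3) = \<omega> ^ 2 * q ^ 15"
      using q nz cube by (simp add: field_simps) (simp add: eval_nat_numeral)
    then show "jtheta (\<omega> ^ 2 * q ^ 15) Q = jtheta (\<omega> * q ^ 3) Q" "jtheta (- (\<omega> ^ 2 * q ^ 15)) Q = jtheta (- (\<omega> * q ^ 3)) Q"
      using jtheta_flip[OF Q(2), of "\<omega> * q ^ 3"] jtheta_flip[OF Q(2), of "- (\<omega> * q ^ 3)"] q nz by (simp_all add: Q_def)
  qed
  have L0: "h * lerch (g 0) (w 0) Q = jtheta (- (q ^ 6)) Q * L
      - Jq q 6 * T * jtheta (\<omega> * q ^ 3) Q / (jtheta b Q * jtheta (- (\<omega> * q ^ 3)) Q)"
  proof -
    have "- (1::complex) * jtheta (q ^ 6) Q * T * jtheta (q ^ 6 * b * - 1) Q / (jtheta b Q * jtheta (q ^ 6 * b) Q)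
      = - (Jq q 6 * T * jtheta (\<omega> * q ^ 3) Q / (jtheta b Q * jtheta (- (\<omega> * q ^ 3)) Q))"
      unfolding cb(1) j6 by (simp add: g fl)
    moreover have "Q powi r * b \<noteq> 1" "Q powi r * (q ^ 6 * b) \<noteq> 1" for r
      unfolding cb unfolding b_def by (rule av, simp)+
    ultimately show ?thesis
      using lerch_change[OF Q(2,1) _ _ _, of "q ^ 6" b "- 1"] q b0
      unfolding T cb(1) L_def h_def w by (simp add: b_def[symmetric] algebra_simps)
  qed
  have L2: "h * lerch (g 2) (w 2) Q = jtheta (- (q ^ 6)) Q / q ^ 6 * L
      + Jq q 6 / q ^ 6 * T * jtheta (\<omega> ^ 2 * q ^ 3) Q / (jtheta b Q * jtheta (- (\<omega> ^ 2 * q ^ 3)) Q)"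
  proof -
    have "- (1::complex) * jtheta (1 / q ^ 6) Q * T * jtheta (1 / q ^ 6 * b * - 1) Q / (jtheta b Q * jtheta (1 / q ^ 6 * b) Q)
      = Jq q 6 / q ^ 6 * T * jtheta (\<omega> ^ 2 * q ^ 3) Q / (jtheta b Q * jtheta (- (\<omega> ^ 2 * q ^ 3)) Q)"
      unfolding cb(2) i6(1) by (simp add: g)
    moreover have "Q powi r * b \<noteq> 1" "Q powi r * (1 / q ^ 6 * b) \<noteq> 1" for r
      unfolding cb unfolding b_def by (rule av, simp)+
    moreover have "1 / q ^ 6 * - 1 = w 2" by (simp add: w)
    ultimately show ?thesis
      using lerch_change[OF Q(2,1) _ _ _, of "1 / q ^ 6" b "- 1"] q b0
      unfolding T cb(2) L_def h_def w(3) by (simp add: b_def[symmetric] i6(2) algebra_simps)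
  qed
  \<comment> \<open>The three coefficients of \<open>L\<close> add up to a trisected
    \<open>j(-1; q^2)\<close>, so they cancel the prefactor of the series.\<close>
  have psi: "2 * (Jq q 4 ^ 2 / Jq q 2) = 2 * jtheta (- (q ^ 6)) Q + q ^ 2 * h"
  proof -
    have p: "(q ^ 2) ^ 9 = Q" "(q ^ 2) ^ 3 = q ^ 6" "(q ^ 2) ^ 6 = q ^ 12" by (simp_all add: Q_def flip: power_mult)
    have a: "jtheta (- (q ^ 12)) Q = jtheta (- (q ^ 6)) Q" "jtheta (- Q) Q = h"
      using jtheta_flip[OF Q(2), of "- (q ^ 6)"] jtheta_flip[OF Q(2), of "- 1"] q by (simp_all add: h_def Q_def power_diff[symmetric])
    show ?thesis
      using theta_trisect[OF _ n(1), of "- 1"] jtheta_minus_1[OF n(1)] q unfolding p by (simp add: a Jq_power)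
  qed
  define N where "N = jtheta (- (\<omega> * q ^ 3)) Q * jtheta (- (\<omega> ^ 2 * q ^ 3)) Q"
  have nf: "jtheta (- (\<omega> * q ^ 3)) Q \<noteq> 0" "jtheta (- (\<omega> ^ 2 * q ^ 3)) Q \<noteq> 0"
    using nzt[of 0] nzt[of 2] fl(2) by (simp_all add: g)
  have N0: "N \<noteq> 0" using nf by (simp add: N_def)
  define ps where "ps = Jq q 4 ^ 2 / Jq q 2"
  have "h * infsum F UNIV = h * lerch (g 0) (w 0) Q + q ^ 2 * (h * lerch b (- 1) Q) + q ^ 6 * (h * lerch (g 2) (w 2) Q)"
    unfolding M sum_three b_def by (simp add: w algebra_simps del: One_nat_def)
  also have "\<dots> = 2 * ps * L - Jq q 6 * T / jtheta b Q *
      (jtheta (\<omega> * q ^ 3) Q / jtheta (- (\<omega> * q ^ 3)) Q - jtheta (\<omega> ^ 2 * q ^ 3) Q / jtheta (- (\<omega> ^ 2 * q ^ 3)) Q)"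
    unfolding L0 L2 ps_def psi L_def[symmetric] using q by (simp add: algebra_simps)
  also have "jtheta (\<omega> * q ^ 3) Q / jtheta (- (\<omega> * q ^ 3)) Q - jtheta (\<omega> ^ 2 * q ^ 3) Q / jtheta (- (\<omega> ^ 2 * q ^ 3)) Q
     = 2 * q ^ 3 * Jq q 12 * Jq q 108 * (\<omega> ^ 2 - \<omega>) / N"
    unfolding omega_theta_difference[OF q, symmetric] Q_def[symmetric] N_def using nf by (simp add: diff_frac_eq mult.commute)
  finally have hM: "h * infsum F UNIV = 2 * ps * L - Jq q 6 * T / jtheta b Q * (2 * q ^ 3 * Jq q 12 * Jq q 108 * (\<omega> ^ 2 - \<omega>) / N)" .
  have jb: "jtheta b Q = Jq q 9 * Jq q 36 * Jq q 54 ^ 2 / (Jq q 18 * Jq q 27 * Jq q 108)"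
    using s.jtheta_minus_omega_half[OF n(3)] q unfolding b_def g by (simp add: Q_def Jq_power flip: power_mult)
  have N: "N = Jq q 18 ^ 3 / Jq q 54 * (Jq q 18 ^ 2 * Jq q 27 * Jq q 108 / (Jq q 9 * Jq q 36 * Jq q 54)) / (Jq q 6 ^ 2 * Jq q 9 * Jq q 36 / (Jq q 3 * Jq q 12 * Jq q 18))"
  proof -
    have a: "jtheta (- (q ^ 3)) Q = Jq q 6 ^ 2 * Jq q 9 * Jq q 36 / (Jq q 3 * Jq q 12 * Jq q 18)"
      using jtheta_minus_sixth[OF n(4,5)] by (simp add: Q_def Jq_power flip: power_mult)
    have b: "jtheta (- (q ^ 9)) (q ^ 54) = Jq q 18 ^ 2 * Jq q 27 * Jq q 108 / (Jq q 9 * Jq q 36 * Jq q 54)"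
      using jtheta_minus_sixth[OF n(3)] q by (simp add: Jq_power flip: power_mult)
    have "jtheta (- (q ^ 3)) Q * N * Jq q 54 = jtheta (- (q ^ 9)) (q ^ 54) * Jq q 18 ^ 3"
      using jtheta_cube[OF Q(1), of "- (q ^ 3)"] q by (simp add: N_def Q_def Jq_power mult.assoc flip: power_mult)
    then have "N = jtheta (- (q ^ 9)) (q ^ 54) * Jq q 18 ^ 3 / (jtheta (- (q ^ 3)) Q * Jq q 54)"
      by (rule factor_eq_divide) (use J a in auto)
    then show ?thesis unfolding a b using J by (simp add: field_simps)
  qed
  have ps0: "ps \<noteq> 0" using J by (simp add: ps_def)
  have "infsum F UNIV = (2 * ps * L - Jq q 6 * T / jtheta b Q * (2 * q ^ 3 * Jq q 12 * Jq q 108 * (\<omega> ^ 2 - \<omega>) / N)) / h"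
    using hM h0 by (simp add: eq_divide_eq mult.commute)
  then have "d * (1 / ps * infsum F UNIV - 1) = d * (2 * (L / h) - 1)
      - d * (1 / ps * (Jq q 6 * T / jtheta b Q * (2 * q ^ 3 * Jq q 12 * Jq q 108 * (\<omega> ^ 2 - \<omega>) / N) / h))" for d
    using ps0 h0 by (simp add: diff_divide_distrib right_diff_distrib mult_ac)
  then have "(\<omega> ^ 2 - \<omega>) * (1 / ps * infsum F UNIV - 1) = (\<omega> ^ 2 - \<omega>) * (2 * (L / h) - 1)
      - (\<omega> ^ 2 - \<omega>) ^ 2 * (1 / ps * (Jq q 6 * T / jtheta b Q * (2 * q ^ 3 * Jq q 12 * Jq q 108 / N) / h))"
    unfolding power2_eq_square[of "\<omega> ^ 2 - \<omega>"] by (simp add: mult_ac)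
  \<comment> \<open>The origin of the factor 3 in front of the terms with
    \<open>I_N\<close>.\<close>
  also have "(\<omega> ^ 2 - \<omega>) ^ 2 = - 3" using quad by algebra
  finally have fin: "(\<omega> ^ 2 - \<omega>) * (1 / ps * infsum F UNIV - 1) = (\<omega> ^ 2 - \<omega>) * (2 * (L / h) - 1)
      + 3 * (1 / ps * (Jq q 6 * T / jtheta b Q * (2 * q ^ 3 * Jq q 12 * Jq q 108 / N) / h))" by simp
  have "3 * (1 / ps * (Jq q 6 * T / jtheta b Q * (2 * q ^ 3 * Jq q 12 * Jq q 108 / N) / h)) =
     3 * q ^ 3 * (Jq q 6 ^ 3 * Jq q 9 * Jq q 108 / (Jq q 3 * Jq q 18 * Jq q 36)) * (Jq q 2 / Jq q 4 ^ 2)"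
    unfolding N jb h T_def ps_def using J by (simp add: field_simps expand_powers)
  then show ?thesis using fin unfolding F_def[abs_def] L_def h_def b_def g(2) Q_def ps_def by simp
qed

end

lemma appell_m_lerch: "appell_m x Q z = lerch (x * z) z Q / jtheta z Q"
  by (simp add: appell_m_def lerch_def theta_term_def tri_def mult.assoc)

text \<open>Substitute \<open>2 - r\<close> for \<open>r\<close>. The stated
  \<open>m(q^(-27), q^162, -1)\<close> has pole parameter \<open>-q^(-27)\<close>, whereas the
  dissection produces \<open>-q^27\<close>.\<close>

lemma lerch_reflect:
  assumes "P \<noteq> 0" "x \<noteq> 0" "\<And>r::int. P powi r * (- x) \<noteq> 1"
  shows "lerch (- (1 / x)) (- 1) P = x * lerch (- x) (- 1) P"
proof -
  have "theta_term (- 1) P (2 - r) / (1 - P powi ((2 - r) - 1) * - (1 / x)) = x * (theta_term (- 1) P r / (1 - P powi (r - 1) * - x))" for r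
  proof -
    have "2 * tri (2 - r) = 2 * (tri r - (r - 1))"
      using two_tri[of r] two_tri[of "2 - r"] by (simp add: algebra_simps)
    then have t: "tri (2 - r) = tri r - (r - 1)" by simp
    define A where "A = P powi (r - 1)"
    have A: "A \<noteq> 0" "P powi ((2 - r) - 1) = 1 / A"
      using assms by (simp_all add: A_def power_int_minus_divide[symmetric])
    have nz: "1 + A * x \<noteq> 0" using assms(3)[of "r - 1"] by (auto simp: A_def add_eq_0_iff2)
    have "theta_term (- 1) P (2 - r) = P powi tri r / A"
      using assms by (simp add: theta_term_minus t power_int_diff A_def)
    then show ?thesis
      using A assms nz unfolding theta_term_minus A(2) A_def[symmetric] by (simp add: field_simps)
  qed
  then have "(\<Sum>\<^sub>\<infinity>r. theta_term (- 1) P (2 - r) / (1 - P powi ((2 - r) - 1) * - (1 / x))) = x * lerch (- x) (- 1) P"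
    unfolding lerch_def by (simp only: infsum_cmult_right')
  moreover have "bij_betw (\<lambda>r. 2 - r) UNIV (UNIV :: int set)" by (rule bij_betwI[where g = "\<lambda>r. 2 - r"]) auto
  ultimately show ?thesis
    unfolding lerch_def using infsum_reindex_bij_betw[of "\<lambda>r. 2 - r" UNIV UNIV "\<lambda>r. theta_term (- 1) P r / (1 - P powi (r - 1) * - (1 / x))"] by simp
qed

text \<open>The scheme of \<open>first_trisection\<close> without a twist and with the extra weight
  \<open>p powi (2 * r - 1)\<close>. This weight moves the class with \<open>w = -1\<close> to
  \<open>s = 2\<close>; the other two are brought there by the factors \<open>p ^ 12\<close> and
  \<open>p ^ 6\<close>.\<close>

lemma residue_theta_quotient:
  assumes q: "norm p < 1" "p \<noteq> 0"
  defines "P \<equiv> p ^ 18"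
  shows "p * jtheta (- 1) P * (\<Sum>\<^sub>\<infinity>r. p powi (2 * tri r + (2 * r - 1)) / (1 - p powi (6 * r - 3) * - 1)) =
    jtheta (- 1) (p ^ 2) * lerch (- (p ^ 3)) (- 1) P
    - Jq p 6 * Jq p 18 ^ 3 / jtheta (- (p ^ 3)) P * (jtheta (p ^ 3) P / jtheta (- (p ^ 3)) P + jtheta (p ^ 9) P / jtheta (- (p ^ 9)) P)"
proof -
  have Q: "norm P < 1" "P \<noteq> 0" using q by (auto simp: P_def norm_power_lt_1)
  have n: "norm (p ^ 2) < 1" "norm (p ^ 6) < 1" "norm (p ^ 3) < 1" using q by (auto intro!: norm_power_lt_1)
  define F where "F r = p powi (2 * tri r + (2 * r - 1)) / (1 - p powi (6 * r - 3) * - 1)" for r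
  define g where "g s = - (p ^ (15 - 6 * s))" for s :: nat
  define w where "w s = - (p ^ (12 - 6 * s))" for s :: nat
  define c where "c s = p powi (int s * int s - int s - 1)" for s :: nat
  have F: "F (3 * k - int s) = c s * (theta_term (w s) P k / (1 - P powi (k - 1) * g s))" if "s < 3" for s k
  proof -
    have "p powi (2 * tri (3 * k - int s) + (2 * (3 * k - int s) - 1)) = c s * theta_term (w s) P k"
    proof -
      have "2 * tri (3 * k - int s) + (2 * (3 * k - int s) - 1) = (int s * int s - int s - 1) + (18 * tri k + int (12 - 6 * s) * k)"
        unfolding tri_residue using that by (simp add: of_nat_diff algebra_simps)
      then have "p powi (2 * tri (3 * k - int s) + (2 * (3 * k - int s) - 1)) = c s * (p powi (18 * tri k) * p powi (int (12 - 6 * s) * k))"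
        unfolding c_def using q by (simp only: power_int_add simp_thms)
      then show ?thesis unfolding w_def P_def theta_term_minus_power_base by (simp add: power_int_power)
    qed
    moreover have "p powi (6 * (3 * k - int s) - 3) * - 1 = P powi (k - 1) * g s"
    proof -
      have "6 * (3 * k - int s) - 3 = 18 * (k - 1) + int (15 - 6 * s)" using that by (simp add: of_nat_diff)
      then have "p powi (6 * (3 * k - int s) - 3) = p powi (18 * (k - 1)) * p ^ (15 - 6 * s)"
        using q by (simp only: power_int_add power_int_of_nat simp_thms)
      then show ?thesis by (simp add: P_def g_def power_int_power)
    qed
    ultimately show ?thesis unfolding F_def by simp
  qed
  have sF: "F summable_on UNIV"
  proof -
    have "(\<lambda>r. 1 / p * (theta_term (- (p ^ 2)) (p ^ 2) r / (1 - (p ^ 6) powi r * (- 1 / p ^ 3)))) summable_on UNIV"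
      by (intro summable_on_cmult_right summable_theta_quotient) (use q n in auto)
    moreover have "1 / p * (theta_term (- (p ^ 2)) (p ^ 2) r / (1 - (p ^ 6) powi r * (- 1 / p ^ 3))) = F r" for r
      unfolding F_def theta_term_minus_power_base using q by (simp add: power_int_diff power_int_add power_int_power)
    ultimately show ?thesis by simp
  qed
  have M: "infsum F UNIV = (\<Sum>s<3. c s * lerch (g s) (w s) P)"
    unfolding infsum_residue_split[OF bij_residue_minus sF] lerch_def
  proof (intro sum.cong refl)
    fix s :: nat
    assume "s \<in> {..<3}"
    then have "F (3 * k - int s) = c s * (theta_term (w s) P k / (1 - P powi (k - 1) * g s))" for k by (intro F) simp
    then show "(\<Sum>\<^sub>\<infinity>k. F (3 * k - int s)) = c s * (\<Sum>\<^sub>\<infinity>n. theta_term (w s) P n / (1 - P powi (n - 1) * g s))"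
      by (simp only: infsum_cmult_right')
  qed
  have c: "c 0 = 1 / p" "c 1 = 1 / p" "c 2 = p" by (simp_all add: c_def power_int_minus divide_inverse)
  have g: "g 0 = - (p ^ 15)" "g 1 = - (p ^ 9)" "g 2 = - (p ^ 3)"
    and w: "w 0 = - (p ^ 12)" "w 1 = - (p ^ 6)" "w 2 = - 1"
    by (simp_all add: g_def w_def)
  define b where "b = g 2"
  have cb: "p ^ 12 * b = g 0" "p ^ 6 * b = g 1"
    unfolding b_def g by (simp_all flip: power_add)
  have av: "P powi r * g s \<noteq> 1" if "s < 3" for r s
    unfolding g_def P_def
  proof (rule lattice_avoid[OF q])
    show "norm (- (p ^ (15 - 6 * s))) = norm (p ^ (15 - 6 * s))" by simp
    show "\<not> int 18 dvd int (15 - 6 * s)" using that by (auto simp: numeral_3_eq_3 less_Suc_eq)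
  qed
  have g0: "g s \<noteq> 0" for s using q by (simp add: g_def)
  have b0: "b \<noteq> 0" unfolding b_def by (rule g0)
  define T where "T = Jq p 18 ^ 3"
  have T: "qpoch_inf P P ^ 3 = T" by (simp add: T_def P_def Jq_def)
  define L where "L = lerch b (- 1) P"
  define h where "h = jtheta (- 1) P"
  have j6: "jtheta (p ^ 6) P = Jq p 6" using jtheta_third[OF n(2)] q by (simp add: P_def Jq_power flip: power_mult)
  have fl: "jtheta (p ^ 12) P = jtheta (p ^ 6) P" "jtheta (- (p ^ 12)) P = jtheta (- (p ^ 6)) P"
     "jtheta (p ^ 15) P = jtheta (p ^ 3) P" "jtheta (- (p ^ 15)) P = jtheta (- (p ^ 3)) P"
    using jtheta_flip[OF Q(2), of "p ^ 6"] jtheta_flip[OF Q(2), of "- (p ^ 6)"]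
      jtheta_flip[OF Q(2), of "p ^ 3"] jtheta_flip[OF Q(2), of "- (p ^ 3)"] q
    by (simp_all add: P_def power_diff[symmetric])
  have L0: "h * lerch (g 0) (w 0) P = jtheta (- (p ^ 6)) P * L - Jq p 6 * T * jtheta (p ^ 3) P / (jtheta b P * jtheta (- (p ^ 3)) P)"
  proof -
    have "- (1::complex) * jtheta (p ^ 12) P * T * jtheta (p ^ 12 * b * - 1) P / (jtheta b P * jtheta (p ^ 12 * b) P)
      = - (Jq p 6 * T * jtheta (p ^ 3) P / (jtheta b P * jtheta (- (p ^ 3)) P))"
      unfolding cb(1) fl(1) j6 by (simp add: g fl)
    moreover have "P powi r * b \<noteq> 1" "P powi r * (p ^ 12 * b) \<noteq> 1" for r
      unfolding cb unfolding b_def by (rule av, simp)+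
    ultimately show ?thesis
      using lerch_change[OF Q(2,1) _ _ _, of "p ^ 12" b "- 1"] q b0
      unfolding T cb(1) L_def h_def w by (simp add: b_def[symmetric] fl algebra_simps)
  qed
  have L1: "h * lerch (g 1) (w 1) P = jtheta (- (p ^ 6)) P * L - Jq p 6 * T * jtheta (p ^ 9) P / (jtheta b P * jtheta (- (p ^ 9)) P)"
  proof -
    have "- (1::complex) * jtheta (p ^ 6) P * T * jtheta (p ^ 6 * b * - 1) P / (jtheta b P * jtheta (p ^ 6 * b) P)
      = - (Jq p 6 * T * jtheta (p ^ 9) P / (jtheta b P * jtheta (- (p ^ 9)) P))"
      unfolding cb(2) j6 unfolding g by simp
    moreover have "P powi r * b \<noteq> 1" "P powi r * (p ^ 6 * b) \<noteq> 1" for r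
      unfolding cb unfolding b_def by (rule av, simp)+
    ultimately show ?thesis
      using lerch_change[OF Q(2,1) _ _ _, of "p ^ 6" b "- 1"] q b0
      unfolding T cb(2) L_def h_def w by (simp add: b_def[symmetric] algebra_simps)
  qed
  have psi: "jtheta (- 1) (p ^ 2) = 2 * jtheta (- (p ^ 6)) P + p ^ 2 * h"
  proof -
    have e: "(p ^ 2) ^ 9 = P" "(p ^ 2) ^ 3 = p ^ 6" "(p ^ 2) ^ 6 = p ^ 12" by (simp_all add: P_def flip: power_mult)
    have a: "jtheta (- P) P = h"
      using jtheta_flip[OF Q(2), of "- 1"] by (simp add: h_def)
    show ?thesis
      using theta_trisect[OF _ n(1), of "- 1"] q unfolding e by (simp add: a fl)
  qed
  have "p * h * infsum F UNIV = h * lerch (g 0) (w 0) P + h * lerch (g 1) (w 1) P + p ^ 2 * (h * L)"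
    unfolding M sum_three c w(3) b_def[symmetric] L_def[symmetric] using q by (simp add: field_simps power2_eq_square)
  also have "\<dots> = jtheta (- 1) (p ^ 2) * L - Jq p 6 * T / jtheta b P * (jtheta (p ^ 3) P / jtheta (- (p ^ 3)) P + jtheta (p ^ 9) P / jtheta (- (p ^ 9)) P)"
    unfolding L0 L1 psi by (simp add: algebra_simps)
  finally show ?thesis unfolding F_def[abs_def] h_def L_def T_def b_def g(3) .
qed

context cube_root begin

text \<open>Expanding \<open>1 / (1 + \<omega>^2 Y) = (1 - \<omega>^2 Y + \<omega> Y^2) / (1 +
  Y^3)\<close> gives three series. The reflection of \<open>r\<close> to \<open>1 - r\<close>
  inverts \<open>Y\<close>: it identifies \<open>s1\<close> with \<open>s2\<close> and evaluates
  \<open>s0\<close> as half of \<open>j(-1; p^2)\<close>, which the subtracted 1 removes. Only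
  \<open>s1\<close> survives, and its coefficient no longer involves
  \<open>\<omega>\<close>.\<close>

lemma second_trisection:
  assumes q: "norm p < 1" "p \<noteq> 0"
  shows "(\<omega> ^ 2 - \<omega>) * (2 * (lerch (- (\<omega> ^ 2 * p)) (- 1) (p ^ 2) / jtheta (- 1) (p ^ 2)) - 1) =
    6 / p ^ 4 * appell_m (1 / p ^ 3) (p ^ 18) (- 1)
    - 3 / 2 / p * (Jq p 2 * Jq p 3 * Jq p 12 * Jq p 18 ^ 5 / (Jq p 4 ^ 2 * Jq p 6 * Jq p 9 * Jq p 36 ^ 3)) *
     (jtheta (p ^ 3) (p ^ 18) / jtheta (- (p ^ 3)) (p ^ 18) + jtheta (p ^ 9) (p ^ 18) / jtheta (- (p ^ 9)) (p ^ 18))"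
proof -
  interpret s: cube_root "\<omega> ^ 2" by (rule sq)
  note J = Jq_nonzero[OF q(1)]
  have n: "norm (p ^ 2) < 1" "p ^ 2 \<noteq> 0" "norm (p ^ 6) < 1" "norm (p ^ 3) < 1" "norm (p ^ 18) < 1" using q by (auto intro!: norm_power_lt_1)
  define E where "E r = p powi (2 * tri r)" for r
  define Y where "Y r = p powi (2 * r - 1)" for r
  have E: "E r = theta_term (- 1) (p ^ 2) r" for r by (simp add: E_def theta_term_minus_power_base)
  have Y3: "p powi (6 * r - 3) = Y r ^ 3" for r by (simp add: Y_def power_int_power' algebra_simps)
  have Y0: "Y r \<noteq> 0" for r using q by (simp add: Y_def)
  have nY: "norm (Y r) \<noteq> 1" for r unfolding Y_def by (rule norm_powi_ne_1[OF q]) presburger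
  have D0: "1 + z * Y r \<noteq> 0" if "norm z = 1" for z r
  proof
    assume "1 + z * Y r = 0"
    then have "norm (z * Y r) = 1" by (metis add_eq_0_iff norm_minus_cancel norm_one)
    then show False using nY that by (simp add: norm_mult)
  qed
  have D3: "1 + Y r ^ 3 \<noteq> 0" for r
  proof
    assume "1 + Y r ^ 3 = 0"
    then have "norm (Y r) ^ 3 = 1" by (metis add_eq_0_iff norm_minus_cancel norm_one norm_power)
    then show False using nY power_eq_imp_eq_base[of "norm (Y r)" 3 1] by auto
  qed
  define s0 where "s0 r = E r / (1 + Y r ^ 3)" for r
  define s1 where "s1 r = E r * Y r / (1 + Y r ^ 3)" for r
  define s2 where "s2 r = E r * Y r ^ 2 / (1 + Y r ^ 3)" for r
  have D: "1 - (p ^ 6) powi r * (- 1 / p ^ 3) = 1 + Y r ^ 3" for r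
    unfolding Y3[symmetric] using q by (simp add: power_int_power power_int_diff)
  have sm: "(\<lambda>r. k * (theta_term (- (p ^ j)) (p ^ 2) r / (1 + Y r ^ 3))) summable_on UNIV" for j k
    unfolding D[symmetric] by (intro summable_on_cmult_right summable_theta_quotient) (use q n in auto)
  have ss: "s0 summable_on UNIV" "s1 summable_on UNIV" "s2 summable_on UNIV"
  proof -
    have "1 * (theta_term (- (p ^ 0)) (p ^ 2) r / (1 + Y r ^ 3)) = s0 r"
      "1 / p * (theta_term (- (p ^ 2)) (p ^ 2) r / (1 + Y r ^ 3)) = s1 r"
      "1 / p ^ 2 * (theta_term (- (p ^ 4)) (p ^ 2) r / (1 + Y r ^ 3)) = s2 r" for r
      unfolding s0_def s1_def s2_def theta_term_minus_power_base E_def Y_def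
      using q by (simp_all add: power_int_diff power_int_power power_int_power' power_divide)
    then show "s0 summable_on UNIV" "s1 summable_on UNIV" "s2 summable_on UNIV"
      using sm[of 1 0] sm[of "1 / p" 2] sm[of "1 / p ^ 2" 4] by simp_all
  qed
  have bij: "bij_betw (\<lambda>r. 1 - r) UNIV (UNIV :: int set)" by (rule bij_betwI[where g = "\<lambda>r. 1 - r"]) auto
  have refl: "E (1 - r) = E r" "Y (1 - r) = 1 / Y r" for r
  proof -
    have "2 * tri (1 - r) = 2 * tri r" using two_tri[of r] two_tri[of "1 - r"] by (simp add: algebra_simps)
    then show "E (1 - r) = E r" by (simp add: E_def)
    show "Y (1 - r) = 1 / Y r" using q by (simp add: Y_def power_int_minus_divide[symmetric])
  qed
  have inv3: "1 + (1 / Y r) ^ 3 = (1 + Y r ^ 3) / Y r ^ 3" for r using Y0 by (simp add: field_simps)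
  have "s1 (1 - r) = s2 r" for r
    unfolding s1_def s2_def refl inv3 using Y0[of r] by (simp add: eval_nat_numeral)
  then have S12: "infsum s2 UNIV = infsum s1 UNIV"
    using infsum_reindex_bij_betw[OF bij, of s1] by simp
  have r0: "s0 (1 - r) = E r + - s0 r" for r
    unfolding s0_def refl inv3 using Y0[of r] D3[of r] by (simp add: field_simps)
  have sE: "E summable_on UNIV" using summable_theta[OF n(2,1), of "- 1"] by (simp add: E[abs_def])
  have iE: "infsum E UNIV = jtheta (- 1) (p ^ 2)" using jacobi_triple_product[OF n(2,1), of "- 1"] by (simp add: E[abs_def])
  have "infsum s0 UNIV = infsum E UNIV + - infsum s0 UNIV"
    using infsum_reindex_bij_betw[OF bij, of s0] infsum_add[OF sE summable_on_uminus[THEN iffD2, OF ss(1)]]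
    unfolding r0 infsum_uminus by simp
  then have S0: "2 * infsum s0 UNIV = jtheta (- 1) (p ^ 2)" unfolding iE by (simp add: algebra_simps)
  have pt: "theta_term (- 1) (p ^ 2) r / (1 - (p ^ 2) powi (r - 1) * - (\<omega> ^ 2 * p)) = s0 r + (- (\<omega> ^ 2) * s1 r + \<omega> * s2 r)" for r
  proof -
    have "(p ^ 2) powi (r - 1) * p = Y r"
    proof -
      have "2 * r - 1 = 2 * (r - 1) + 1" by simp
      then have "Y r = p powi (2 * (r - 1)) * p" unfolding Y_def using q by (simp only: power_int_add power_int_1_right simp_thms)
      then show ?thesis by (simp add: power_int_power)
    qed
    then have e: "1 - (p ^ 2) powi (r - 1) * - (\<omega> ^ 2 * p) = 1 + \<omega> ^ 2 * Y r" by (simp add: mult_ac)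
    have nz: "1 + \<omega> ^ 2 * Y r \<noteq> 0" using D0 s.norm1 by simp
    have "(1 + \<omega> ^ 2 * Y r) * (1 + - (\<omega> ^ 2) * Y r + \<omega> * Y r ^ 2) = 1 + Y r ^ 3" using quad cube by algebra
    then have "1 / (1 + \<omega> ^ 2 * Y r) = (1 + - (\<omega> ^ 2) * Y r + \<omega> * Y r ^ 2) / (1 + Y r ^ 3)"
      using nz D3[of r] by (simp add: frac_eq_eq mult.commute)
    then have "E r / (1 + \<omega> ^ 2 * Y r) = E r * ((1 + - (\<omega> ^ 2) * Y r + \<omega> * Y r ^ 2) / (1 + Y r ^ 3))"
      by (metis mult.right_neutral times_divide_eq_right)
    also have "\<dots> = s0 r + (- (\<omega> ^ 2) * s1 r + \<omega> * s2 r)"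
      unfolding s0_def s1_def s2_def by (simp add: diff_divide_distrib add_divide_distrib algebra_simps)
    finally show ?thesis unfolding e E[symmetric] .
  qed
  have "lerch (- (\<omega> ^ 2 * p)) (- 1) (p ^ 2) = infsum s0 UNIV + (- (\<omega> ^ 2) * infsum s1 UNIV + \<omega> * infsum s2 UNIV)"
  proof -
    have a: "(\<lambda>r. - (\<omega> ^ 2) * s1 r) summable_on UNIV" "(\<lambda>r. \<omega> * s2 r) summable_on UNIV"
      by (intro summable_on_cmult_right ss)+
    show ?thesis
      unfolding lerch_def pt infsum_add[OF ss(1) summable_on_add[OF a]] infsum_add[OF a] infsum_cmult_right' ..
  qed
  then have M: "2 * lerch (- (\<omega> ^ 2 * p)) (- 1) (p ^ 2) = jtheta (- 1) (p ^ 2) + 2 * (\<omega> - \<omega> ^ 2) * infsum s1 UNIV"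
    unfolding S12 using S0 by algebra
  define h h2 where "h = jtheta (- 1) (p ^ 18)" and "h2 = jtheta (- 1) (p ^ 2)"
  have h: "h = 2 * Jq p 36 ^ 2 / Jq p 18" unfolding h_def using jtheta_minus_1[OF n(5)] by (simp add: Jq_power)
  have h2: "h2 = 2 * Jq p 4 ^ 2 / Jq p 2" unfolding h2_def using jtheta_minus_1[OF n(1)] by (simp add: Jq_power)
  have h0: "h \<noteq> 0" "h2 \<noteq> 0" unfolding h h2 using J by simp_all
  have F: "p powi (2 * tri r + (2 * r - 1)) / (1 - p powi (6 * r - 3) * - 1) = s1 r" for r
    unfolding Y3 s1_def E_def Y_def using q by (simp add: power_int_add)
  define B where "B = jtheta (p ^ 3) (p ^ 18) / jtheta (- (p ^ 3)) (p ^ 18) + jtheta (p ^ 9) (p ^ 18) / jtheta (- (p ^ 9)) (p ^ 18)"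
  define L where "L = lerch (- (p ^ 3)) (- 1) (p ^ 18)"
  have "p * h * infsum s1 UNIV = h2 * L - Jq p 6 * Jq p 18 ^ 3 / jtheta (- (p ^ 3)) (p ^ 18) * B"
    using residue_theta_quotient[OF q] unfolding F h_def h2_def L_def B_def by simp
  then have S1: "infsum s1 UNIV = (h2 * L - Jq p 6 * Jq p 18 ^ 3 / jtheta (- (p ^ 3)) (p ^ 18) * B) / (p * h)"
    using q h0 by (simp add: eq_divide_eq mult_ac)
  have "(p ^ 18) powi r * - (p ^ 3) \<noteq> 1" for r
    by (rule lattice_avoid[OF q, where k = 3]) auto
  then have ap: "appell_m (1 / p ^ 3) (p ^ 18) (- 1) = p ^ 3 * L / h"
    using lerch_reflect[of "p ^ 18" "p ^ 3"] q unfolding appell_m_lerch L_def h_def by simp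
  have j3: "jtheta (- (p ^ 3)) (p ^ 18) = Jq p 6 ^ 2 * Jq p 9 * Jq p 36 / (Jq p 3 * Jq p 12 * Jq p 18)"
    using jtheta_minus_sixth[OF n(4)] q by (simp add: Jq_power flip: power_mult)
  have "(\<omega> ^ 2 - \<omega>) * (2 * (lerch (- (\<omega> ^ 2 * p)) (- 1) (p ^ 2) / h2) - 1) = (\<omega> ^ 2 - \<omega>) * (\<omega> - \<omega> ^ 2) * (2 * infsum s1 UNIV / h2)"
  proof -
    have "2 * (lerch (- (\<omega> ^ 2 * p)) (- 1) (p ^ 2) / h2) - 1 = (\<omega> - \<omega> ^ 2) * (2 * infsum s1 UNIV / h2)"
      using M h0 unfolding h2_def[symmetric] by (simp add: field_simps)
    then show ?thesis by (simp add: mult.assoc)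
  qed
  also have "(\<omega> ^ 2 - \<omega>) * (\<omega> - \<omega> ^ 2) = 3" using quad by algebra
  also have "3 * (2 * infsum s1 UNIV / h2) = 6 / p * (L / h) - 6 / (p * h * h2) * (Jq p 6 * Jq p 18 ^ 3 / jtheta (- (p ^ 3)) (p ^ 18)) * B"
    unfolding S1 using h0 q by (simp add: diff_divide_distrib right_diff_distrib mult_ac)
  also have "6 / p * (L / h) = 6 / p ^ 4 * appell_m (1 / p ^ 3) (p ^ 18) (- 1)"
    unfolding ap using q by (simp add: field_simps expand_powers)
  also have "6 / (p * h * h2) * (Jq p 6 * Jq p 18 ^ 3 / jtheta (- (p ^ 3)) (p ^ 18)) = 3 / 2 / p * (Jq p 2 * Jq p 3 * Jq p 12 * Jq p 18 ^ 5 / (Jq p 4 ^ 2 * Jq p 6 * Jq p 9 * Jq p 36 ^ 3))"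
    unfolding h h2 j3 using J q by (simp add: field_simps expand_powers)
  finally show ?thesis unfolding h2_def B_def .
qed

subsection \<open>Trisection of the theta part\<close>

lemma jtheta_minus_omega_shift:
  assumes "norm q < 1" "q \<noteq> 0"
  shows "jtheta (- (q * \<omega>)) q = - \<omega> * (Jq q 1 ^ 2 * Jq q 6 / (Jq q 2 * Jq q 3))"
proof -
  have "jtheta (- (q * \<omega>)) q = (1 + \<omega>) * \<omega> ^ 2 * (Jq q 1 ^ 2 * Jq q 6 / (Jq q 2 * Jq q 3))"
    using jtheta_shift[OF assms(2,1), of "- \<omega>"] nz jtheta_minus_omega[OF assms(1)] by (simp add: inv)
  also have "(1 + \<omega>) * \<omega> ^ 2 = - \<omega>" using quad cube by algebra
  finally show ?thesis .
qed

text \<open>The two rotations are combined by the parity formula into base \<open>q ^ 2\<close>;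
  multiplying each part by \<open>jtheta (- Y) q\<close> with \<open>theta_product_third\<close>
  then reaches base \<open>q ^ 3\<close>.\<close>

lemma theta_twisted_numerator:
  assumes q: "norm q < 1" "q \<noteq> 0" and Y: "Y \<noteq> 0"
  shows "jtheta (- Y) q * (jtheta (\<omega> * Y) q * jtheta (\<omega> ^ 2 * Y) q) =
    Jq q 2 ^ 2 * Jq q 3 ^ 3 / (Jq q 1 * Jq q 6 ^ 2) * jtheta (- (Y ^ 3)) (q ^ 3)
    + 2 * Jq q 2 * Jq q 6 * (Y * jtheta (- (q * Y ^ 3)) (q ^ 3) + Y ^ 2 * jtheta (- (q ^ 2 * Y ^ 3)) (q ^ 3))"
proof -
  interpret s: cube_root "\<omega> ^ 2" by (rule sq)
  note J = Jq_nonzero[OF q(1)]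
  have n: "norm (q ^ 2) < 1" "q ^ 2 \<noteq> 0" "norm (q ^ 3) < 1" "q ^ 3 \<noteq> 0" "norm (q ^ 6) < 1" "q ^ 6 \<noteq> 0" using q by (auto intro!: norm_power_lt_1)
  define e where "e = Jq q 1 * Jq q 4 * Jq q 6 ^ 2 / (Jq q 2 * Jq q 3 * Jq q 12)"
  define d where "d = Jq q 2 ^ 2 * Jq q 12 / (Jq q 4 * Jq q 6)"
  have e: "jtheta (- (q * \<omega> ^ 2)) (q ^ 2) = e"
    using s.jtheta_minus_omega_half[OF q] by (simp add: e_def mult.commute)
  have d: "jtheta (- (q ^ 2 * \<omega> ^ 2)) (q ^ 2) = - (\<omega> ^ 2) * d"
    using s.jtheta_minus_omega_shift[OF n(1,2)] by (simp add: d_def Jq_power)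
  have par: "jtheta (\<omega> * Z) q * jtheta (\<omega> ^ 2 * Z) q = jtheta (- (Z ^ 2)) (q ^ 2) * e + Z * jtheta (- (q * Z ^ 2)) (q ^ 2) * d" if "Z \<noteq> 0" for Z
  proof -
    have a: "\<omega> * Z * (\<omega> ^ 2 * Z) = Z ^ 2" "q * (\<omega> * Z) / (\<omega> ^ 2 * Z) = q * \<omega> ^ 2" "q ^ 2 * (\<omega> * Z) / (\<omega> ^ 2 * Z) = q ^ 2 * \<omega> ^ 2"
      "q * (\<omega> * Z) * (\<omega> ^ 2 * Z) = q * Z ^ 2"
      using that cube nz by (simp_all add: field_simps eval_nat_numeral)
    have "jtheta (\<omega> * Z) q * jtheta (\<omega> ^ 2 * Z) q = jtheta (- (Z ^ 2)) (q ^ 2) * e - \<omega> * Z * (jtheta (- (q * Z ^ 2)) (q ^ 2) * (- (\<omega> ^ 2) * d))"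
      using theta_product_parity[OF q(2,1), of "\<omega> * Z" "\<omega> ^ 2 * Z"] that nz unfolding a e d by simp
    also have "\<omega> * Z * (jtheta (- (q * Z ^ 2)) (q ^ 2) * (- (\<omega> ^ 2) * d)) = - (\<omega> ^ 3 * (Z * jtheta (- (q * Z ^ 2)) (q ^ 2) * d))"
      by (simp add: eval_nat_numeral mult_ac)
    finally show ?thesis by (simp add: cube)
  qed
  define u v where "u = jtheta (- (q ^ 3)) (q ^ 6)" and "v = jtheta (- 1) (q ^ 6)"
  define a b where "a = jtheta (- q) (q ^ 6)" and "b = jtheta (- (q ^ 2)) (q ^ 6)"
  have fl: "jtheta (- (q ^ 5)) (q ^ 6) = a" "jtheta (- (q ^ 4)) (q ^ 6) = b" "jtheta (- (q ^ 7)) (q ^ 6) = a / q" "jtheta (- (q ^ 6)) (q ^ 6) = v"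
  proof -
    have "q ^ 6 / - q = - (q ^ 5)" "q ^ 6 / - (q ^ 2) = - (q ^ 4)" "q ^ 6 * - q = - (q ^ 7)"
      using q by (simp_all add: field_simps eval_nat_numeral)
    then show "jtheta (- (q ^ 5)) (q ^ 6) = a" "jtheta (- (q ^ 4)) (q ^ 6) = b" "jtheta (- (q ^ 7)) (q ^ 6) = a / q" "jtheta (- (q ^ 6)) (q ^ 6) = v"
      using jtheta_flip[OF n(6), of "- q"] jtheta_flip[OF n(6), of "- (q ^ 2)"] jtheta_shift[OF n(6,5), of "- q"] jtheta_shift[OF n(6,5), of "- 1"] q
      by (simp_all add: a_def b_def v_def)
  qed
  have third: "jtheta (- Z) q * jtheta (- (Z ^ 2)) (q ^ 2) = jtheta (- (Z ^ 3)) (q ^ 3) * u + Z * jtheta (- (q * Z ^ 3)) (q ^ 3) * a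
        + Z ^ 2 * jtheta (- (q ^ 2 * Z ^ 3)) (q ^ 3) * a"
    "jtheta (- Z) q * (Z * jtheta (- (q * Z ^ 2)) (q ^ 2)) = Z * jtheta (- (q * Z ^ 3)) (q ^ 3) * b
        + Z ^ 2 * jtheta (- (q ^ 2 * Z ^ 3)) (q ^ 3) * b + q * jtheta (- (Z ^ 3)) (q ^ 3) * v" if "Z \<noteq> 0" for Z
  proof -
    have r: "- Z * - (Z ^ 2) = Z ^ 3" "q ^ 3 * (- Z) ^ 2 / - (Z ^ 2) = - (q ^ 3)" "q ^ 5 * (- Z) ^ 2 / - (Z ^ 2) = - (q ^ 5)"
      "q ^ 7 * (- Z) ^ 2 / - (Z ^ 2) = - (q ^ 7)" "q * - Z * - (Z ^ 2) = q * Z ^ 3" "q ^ 2 * - Z * - (Z ^ 2) = q ^ 2 * Z ^ 3"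
      using that by (simp_all add: field_simps eval_nat_numeral)
    show "jtheta (- Z) q * jtheta (- (Z ^ 2)) (q ^ 2) = jtheta (- (Z ^ 3)) (q ^ 3) * u + Z * jtheta (- (q * Z ^ 3)) (q ^ 3) * a
        + Z ^ 2 * jtheta (- (q ^ 2 * Z ^ 3)) (q ^ 3) * a"
      using theta_product_third[OF q(2,1), of "- Z" "- (Z ^ 2)"] that q unfolding r fl u_def by (simp add: mult_ac)
    have t: "- Z * - (q * Z ^ 2) = q * Z ^ 3" "q ^ 3 * (- Z) ^ 2 / - (q * Z ^ 2) = - (q ^ 2)" "q ^ 5 * (- Z) ^ 2 / - (q * Z ^ 2) = - (q ^ 4)"
      "q ^ 7 * (- Z) ^ 2 / - (q * Z ^ 2) = - (q ^ 6)" "q * - Z * - (q * Z ^ 2) = q ^ 2 * Z ^ 3" "q ^ 2 * - Z * - (q * Z ^ 2) = q ^ 3 * Z ^ 3"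
      using that q by (simp_all add: field_simps eval_nat_numeral)
    have "jtheta (- (q ^ 3 * Z ^ 3)) (q ^ 3) = jtheta (- (Z ^ 3)) (q ^ 3) / Z ^ 3"
      using jtheta_shift[OF n(4,3), of "- (Z ^ 3)"] that by simp
    then have "jtheta (- Z) q * jtheta (- (q * Z ^ 2)) (q ^ 2) = jtheta (- (q * Z ^ 3)) (q ^ 3) * b
        + Z * jtheta (- (q ^ 2 * Z ^ 3)) (q ^ 3) * b + q * (jtheta (- (Z ^ 3)) (q ^ 3) / Z) * v"
      using theta_product_third[OF q(2,1), of "- Z" "- (q * Z ^ 2)"] that q unfolding t fl b_def
      by (simp add: power2_eq_square power3_eq_cube mult_ac)
    then have "Z * (jtheta (- Z) q * jtheta (- (q * Z ^ 2)) (q ^ 2)) = Z * (jtheta (- (q * Z ^ 3)) (q ^ 3) * b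
        + Z * jtheta (- (q ^ 2 * Z ^ 3)) (q ^ 3) * b + q * (jtheta (- (Z ^ 3)) (q ^ 3) / Z) * v)" by simp
    then show "jtheta (- Z) q * (Z * jtheta (- (q * Z ^ 2)) (q ^ 2)) = Z * jtheta (- (q * Z ^ 3)) (q ^ 3) * b
        + Z ^ 2 * jtheta (- (q ^ 2 * Z ^ 3)) (q ^ 3) * b + q * jtheta (- (Z ^ 3)) (q ^ 3) * v"
      using that by (simp add: distrib_left power2_eq_square mult_ac)
  qed
  define C where "C = e * u + d * q * v"
  have c1: "e * a + d * b = 2 * Jq q 2 * Jq q 6"
  proof -
    have a: "a = Jq q 2 ^ 2 * Jq q 3 * Jq q 12 / (Jq q 1 * Jq q 4 * Jq q 6)" unfolding a_def by (rule jtheta_minus_sixth[OF q])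
    have b: "b = Jq q 4 * Jq q 6 ^ 2 / (Jq q 2 * Jq q 12)"
      using jtheta_minus_third[OF n(1,2)] by (simp add: b_def Jq_power flip: power_mult)
    show ?thesis unfolding a b e_def d_def using J by (simp add: field_simps expand_powers)
  qed
  have K: "jtheta (- Z) q * (jtheta (\<omega> * Z) q * jtheta (\<omega> ^ 2 * Z) q) = C * jtheta (- (Z ^ 3)) (q ^ 3)
    + 2 * Jq q 2 * Jq q 6 * (Z * jtheta (- (q * Z ^ 3)) (q ^ 3) + Z ^ 2 * jtheta (- (q ^ 2 * Z ^ 3)) (q ^ 3))" if "Z \<noteq> 0" for Z
  proof -
    have "jtheta (- Z) q * (jtheta (\<omega> * Z) q * jtheta (\<omega> ^ 2 * Z) q) =
       jtheta (- Z) q * jtheta (- (Z ^ 2)) (q ^ 2) * e + jtheta (- Z) q * (Z * jtheta (- (q * Z ^ 2)) (q ^ 2)) * d"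
      unfolding par[OF that] by (simp add: algebra_simps)
    also have "\<dots> = C * jtheta (- (Z ^ 3)) (q ^ 3) + (e * a + d * b) * (Z * jtheta (- (q * Z ^ 3)) (q ^ 3) + Z ^ 2 * jtheta (- (q ^ 2 * Z ^ 3)) (q ^ 3))"
      unfolding third[OF that] C_def by (simp add: algebra_simps)
    finally show ?thesis unfolding c1 .
  qed
  \<comment> \<open>\<open>C\<close> is not simplified from its definition. The expansion
    \<open>K\<close> at \<open>Y = 1\<close> has known values on all other places; there the left
    side is three times, and the known summand twice, the same eta quotient.\<close>
  have C: "C = Jq q 2 ^ 2 * Jq q 3 ^ 3 / (Jq q 1 * Jq q 6 ^ 2)"
  proof -
    have A1: "jtheta (- q) (q ^ 3) = Jq q 2 * Jq q 3 ^ 2 / (Jq q 1 * Jq q 6)" by (rule jtheta_minus_third[OF q])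
    have "q ^ 3 / - q = - (q ^ 2)" using q by (simp add: field_simps eval_nat_numeral)
    then have A2: "jtheta (- (q ^ 2)) (q ^ 3) = Jq q 2 * Jq q 3 ^ 2 / (Jq q 1 * Jq q 6)"
      using jtheta_flip[OF n(4), of "- q"] q A1 by simp
    have A0: "jtheta (- 1) (q ^ 3) = 2 * Jq q 6 ^ 2 / Jq q 3" using jtheta_minus_1[OF n(3)] by (simp add: Jq_power)
    have "(1 - \<omega>) * (1 - \<omega> ^ 2) = 3" using quad by algebra
    then have w: "(1 - \<omega>) * Jq q 3 * ((1 - \<omega> ^ 2) * Jq q 3) = 3 * Jq q 3 ^ 2"
      by (simp add: power2_eq_square mult_ac)
    have eq: "2 * Jq q 2 ^ 2 / Jq q 1 * (3 * Jq q 3 ^ 2) = C * (2 * Jq q 6 ^ 2 / Jq q 3) + 2 * Jq q 2 * Jq q 6 * (2 * (Jq q 2 * Jq q 3 ^ 2 / (Jq q 1 * Jq q 6)))"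
      using K[of 1] jtheta_minus_1[OF q(1)] w unfolding mult_1_right power_one A0 A1 A2 jtheta_omega[OF q(1)] s.jtheta_omega[OF q(1)] by (simp add: power_one)
    have m: "2 * Jq q 2 ^ 2 / Jq q 1 * (3 * Jq q 3 ^ 2) = 3 * (2 * Jq q 2 ^ 2 * Jq q 3 ^ 2 / Jq q 1)"
      "2 * Jq q 2 * Jq q 6 * (2 * (Jq q 2 * Jq q 3 ^ 2 / (Jq q 1 * Jq q 6))) = 2 * (2 * Jq q 2 ^ 2 * Jq q 3 ^ 2 / Jq q 1)"
      using J by (simp_all add: field_simps power2_eq_square)
    have "c = x" if "3 * x = c + 2 * x" for c x :: complex using that by algebra
    then have "C * (2 * Jq q 6 ^ 2 / Jq q 3) = 2 * Jq q 2 ^ 2 * Jq q 3 ^ 2 / Jq q 1" using eq unfolding m .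
    moreover have "2 * Jq q 6 ^ 2 / Jq q 3 \<noteq> 0" using J by simp
    ultimately have "C = 2 * Jq q 2 ^ 2 * Jq q 3 ^ 2 / Jq q 1 / (2 * Jq q 6 ^ 2 / Jq q 3)"
      by (simp only: nonzero_eq_divide_eq simp_thms)
    then show ?thesis using J by (simp add: field_simps expand_powers)
  qed
  show ?thesis using K[OF Y] unfolding C .
qed

text \<open>One parity expansion: the twists enter only the constant theta values, and
  \<open>Y\<close> is left as \<open>Y ^ 4\<close> in base \<open>q ^ 4\<close>. The division by
  \<open>Y ^ 2\<close> comes from a shift by a period.\<close>

lemma theta_twisted_denominator:
  assumes q: "norm q < 1" "q \<noteq> 0" and Y: "Y \<noteq> 0"
  shows "jtheta (- (\<omega> * (q * Y ^ 2))) (q ^ 2) * jtheta (- (\<omega> ^ 2 * (q * Y ^ 2))) (q ^ 2) =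
    Jq q 2 * Jq q 8 * Jq q 12 ^ 2 / (Jq q 4 * Jq q 6 * Jq q 24) * jtheta (- (q ^ 2 * Y ^ 4)) (q ^ 4)
    - q * (Jq q 4 ^ 2 * Jq q 24 / (Jq q 8 * Jq q 12)) * (jtheta (- (Y ^ 4)) (q ^ 4) / Y ^ 2)"
proof -
  interpret s: cube_root "\<omega> ^ 2" by (rule sq)
  have n: "norm (q ^ 2) < 1" "q ^ 2 \<noteq> 0" "norm (q ^ 4) < 1" "q ^ 4 \<noteq> 0" using q by (auto intro!: norm_power_lt_1)
  have p: "(q ^ 2) ^ 2 = q ^ 4" by simp
  define x y where "x = - (\<omega> * (q * Y ^ 2))" and "y = - (\<omega> ^ 2 * (q * Y ^ 2))"
  define P E where "P = Jq q 2 * Jq q 8 * Jq q 12 ^ 2 / (Jq q 4 * Jq q 6 * Jq q 24)" and "E = Jq q 4 ^ 2 * Jq q 24 / (Jq q 8 * Jq q 12)"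
  have r: "x * y = q ^ 2 * Y ^ 4" "q ^ 2 * x / y = q ^ 2 * \<omega> ^ 2" "q ^ 2 * x * y = q ^ 4 * Y ^ 4" "q ^ 4 * x / y = q ^ 4 * \<omega> ^ 2"
    using q Y nz cube unfolding x_def y_def by (simp_all add: field_simps eval_nat_numeral)
  have P: "jtheta (- (q ^ 2 * \<omega> ^ 2)) (q ^ 4) = P"
    using s.jtheta_minus_omega_half[OF n(1,2)] by (simp add: P_def Jq_power mult.commute)
  have E: "jtheta (- (q ^ 4 * \<omega> ^ 2)) (q ^ 4) = - (\<omega> ^ 2) * E"
    using s.jtheta_minus_omega_shift[OF n(3,4)] by (simp add: E_def Jq_power)
  have Y4: "jtheta (- (q ^ 4 * Y ^ 4)) (q ^ 4) = jtheta (- (Y ^ 4)) (q ^ 4) / Y ^ 4"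
    using jtheta_shift[OF n(4,3), of "- (Y ^ 4)"] Y by simp
  have "jtheta x (q ^ 2) * jtheta y (q ^ 2) = jtheta (- (q ^ 2 * Y ^ 4)) (q ^ 4) * P - x * (jtheta (- (Y ^ 4)) (q ^ 4) / Y ^ 4 * (- (\<omega> ^ 2) * E))"
    using theta_product_parity[OF n(2,1), of x y] q Y nz unfolding p r P E Y4 by (simp add: x_def y_def)
  also have "x * (jtheta (- (Y ^ 4)) (q ^ 4) / Y ^ 4 * (- (\<omega> ^ 2) * E)) = \<omega> ^ 3 * (q * E * (jtheta (- (Y ^ 4)) (q ^ 4) / Y ^ 2))"
    unfolding x_def using Y by (simp add: eval_nat_numeral mult_ac)
  finally show ?thesis unfolding x_def y_def P_def E_def by (simp add: cube mult.commute)
qed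

text \<open>The exponents 1, 2 and 4 of \<open>Y\<close> disappear because
  \<open>1 + \<omega> + \<omega> ^ 2 = 0\<close>.\<close>

lemma rotation_sum:
  "(a0 + a1 * Y + a2 * Y ^ 2) * (b0 + b1 * Y + b2 * Y ^ 2)
   + (a0 + a1 * (\<omega> * Y) + a2 * (\<omega> * Y) ^ 2) * (b0 + b1 * (\<omega> * Y) + b2 * (\<omega> * Y) ^ 2)
   + (a0 + a1 * (\<omega> ^ 2 * Y) + a2 * (\<omega> ^ 2 * Y) ^ 2) * (b0 + b1 * (\<omega> ^ 2 * Y) + b2 * (\<omega> ^ 2 * Y) ^ 2)
   = 3 * (a0 * b0 + Y ^ 3 * (a1 * b2 + a2 * b1))"
  using quad by algebra

text \<open>A, B, C are the trisection components of \<open>j(-q; q^3)\<close>; the twist marks them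
  with powers of \<open>\<omega>\<close>.\<close>

lemma jtheta_third_twisted:
  assumes q: "norm q < 1" "q \<noteq> 0"
  shows "jtheta (- (q * \<omega>)) (q ^ 3) = theta_A q + \<omega> * theta_B q + \<omega> ^ 2 * theta_C q"
proof -
  have n: "norm (q ^ 3) < 1" "q ^ 3 \<noteq> 0" "norm (q ^ 27) < 1" "q ^ 27 \<noteq> 0" using q by (auto intro!: norm_power_lt_1)
  have p: "(q ^ 3) ^ 9 = q ^ 27" "(- (q * \<omega>)) ^ 3 = - (q ^ 3)" "(q ^ 3) ^ 3 * - (q ^ 3) = - (q ^ 12)"
    "(q ^ 3) ^ 6 * - (q ^ 3) = - (q ^ 21)" "(q ^ 3) ^ 9 * - (q ^ 3) = q ^ 27 * - (q ^ 3)" "(- (q * \<omega>)) ^ 2 * q ^ 3 = \<omega> ^ 2 * (q ^ 2 * q ^ 3)"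
    using cube by (simp_all add: power_mult_distrib flip: power_mult power_add)
  have s: "jtheta (q ^ 27 * - (q ^ 3)) (q ^ 27) = jtheta (- (q ^ 3)) (q ^ 27) / q ^ 3"
    using jtheta_shift[OF n(4,3), of "- (q ^ 3)"] q by simp
  have c: "\<omega> ^ 2 * (a * b) * (z / b) = \<omega> ^ 2 * (a * z)" if "b \<noteq> 0" for a b z using that by simp
  show ?thesis
    using theta_trisect[OF n(2,1), of "- (q * \<omega>)"] q nz unfolding p(2) p(3-6) p(1) s c[OF power_not_zero[OF q(2)]]
    by (simp add: theta_A_def theta_B_def theta_C_def mult_ac)
qed

lemma jtheta_sixth_twisted:
  assumes q: "norm q < 1" "q \<noteq> 0"
  shows "jtheta (- (\<omega> * q ^ 6)) (q ^ 36) = jtheta (- (q ^ 126)) (q ^ 324) + \<omega> * (q ^ 6 * jtheta (- (q ^ 90)) (q ^ 324)) + \<omega> ^ 2 * (q ^ 30 * jtheta (- (q ^ 18)) (q ^ 324))"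
proof -
  have n: "norm (q ^ 36) < 1" "q ^ 36 \<noteq> 0" "norm (q ^ 324) < 1" "q ^ 324 \<noteq> 0" using q by (auto intro!: norm_power_lt_1)
  have p: "(q ^ 36) ^ 9 = q ^ 324" "(- (\<omega> * q ^ 6)) ^ 3 = - (q ^ 18)" "(q ^ 36) ^ 3 * - (q ^ 18) = - (q ^ 126)"
    "(q ^ 36) ^ 6 * - (q ^ 18) = - (q ^ 234)" "(q ^ 36) ^ 9 * - (q ^ 18) = q ^ 324 * - (q ^ 18)" "(- (\<omega> * q ^ 6)) ^ 2 * q ^ 36 = \<omega> ^ 2 * (q ^ 30 * q ^ 18)"
    using cube by (simp_all add: power_mult_distrib flip: power_mult power_add)
  have s: "jtheta (q ^ 324 * - (q ^ 18)) (q ^ 324) = jtheta (- (q ^ 18)) (q ^ 324) / q ^ 18"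
    using jtheta_shift[OF n(4,3), of "- (q ^ 18)"] q by simp
  have f: "jtheta (- (q ^ 234)) (q ^ 324) = jtheta (- (q ^ 90)) (q ^ 324)"
    using jtheta_flip[OF n(4), of "- (q ^ 90)"] q by (simp add: power_diff[symmetric])
  have c: "\<omega> ^ 2 * (a * b) * (z / b) = \<omega> ^ 2 * (a * z)" if "b \<noteq> 0" for a b z using that by simp
  show ?thesis
    using theta_trisect[OF n(2,1), of "- (\<omega> * q ^ 6)"] q nz unfolding p(2) p(3-6) p(1) s f c[OF power_not_zero[OF q(2)]]
    by simp
qed

lemma jtheta_twelfth_twisted:
  assumes q: "norm q < 1" "q \<noteq> 0"
  shows "jtheta (- (\<omega> * q ^ 12)) (q ^ 36) = jtheta (- (q ^ 144)) (q ^ 324) + \<omega> * (q ^ 12 * jtheta (- (q ^ 72)) (q ^ 324)) + \<omega> ^ 2 * (q ^ 24 * jtheta (- (q ^ 36)) (q ^ 324))"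
proof -
  have n: "norm (q ^ 36) < 1" "q ^ 36 \<noteq> 0" "norm (q ^ 324) < 1" "q ^ 324 \<noteq> 0" using q by (auto intro!: norm_power_lt_1)
  have p: "(q ^ 36) ^ 9 = q ^ 324" "(- (\<omega> * q ^ 12)) ^ 3 = - (q ^ 36)" "(q ^ 36) ^ 3 * - (q ^ 36) = - (q ^ 144)"
    "(q ^ 36) ^ 6 * - (q ^ 36) = - (q ^ 252)" "(q ^ 36) ^ 9 * - (q ^ 36) = q ^ 324 * - (q ^ 36)" "(- (\<omega> * q ^ 12)) ^ 2 * q ^ 36 = \<omega> ^ 2 * (q ^ 24 * q ^ 36)"
    using cube by (simp_all add: power_mult_distrib flip: power_mult power_add)
  have s: "jtheta (q ^ 324 * - (q ^ 36)) (q ^ 324) = jtheta (- (q ^ 36)) (q ^ 324) / q ^ 36"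
    using jtheta_shift[OF n(4,3), of "- (q ^ 36)"] q by simp
  have f: "jtheta (- (q ^ 252)) (q ^ 324) = jtheta (- (q ^ 72)) (q ^ 324)"
    using jtheta_flip[OF n(4), of "- (q ^ 72)"] q by (simp add: power_diff[symmetric])
  have c: "\<omega> ^ 2 * (a * b) * (z / b) = \<omega> ^ 2 * (a * z)" if "b \<noteq> 0" for a b z using that by simp
  show ?thesis
    using theta_trisect[OF n(2,1), of "- (\<omega> * q ^ 12)"] q nz unfolding p(2) p(3-6) p(1) s f c[OF power_not_zero[OF q(2)]]
    by simp
qed

end

text \<open>The quintuple product in base \<open>q ^ 108\<close> with \<open>x = q ^ k\<close> for
  \<open>k\<close> equal to 30, 42, 12 and 48. D and E are differences of the trisection components
  of \<open>j(-q^6; q^36)\<close>, F and G of those of \<open>j(-q^12; q^36)\<close>.\<close>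

lemma theta_DEFG:
  assumes q: "norm q < 1" "q \<noteq> 0"
  shows "theta_D q = (jtheta (- (q ^ 126)) (q ^ 324) - q ^ 30 * jtheta (- (q ^ 18)) (q ^ 324)) / Jq q 108"
    and "theta_E q = (q ^ 6 * jtheta (- (q ^ 90)) (q ^ 324) - q ^ 30 * jtheta (- (q ^ 18)) (q ^ 324)) / Jq q 108"
    and "theta_F q = (jtheta (- (q ^ 144)) (q ^ 324) - q ^ 12 * jtheta (- (q ^ 72)) (q ^ 324)) / Jq q 108"
    and "theta_G q = (q ^ 12 * jtheta (- (q ^ 72)) (q ^ 324) - q ^ 24 * jtheta (- (q ^ 36)) (q ^ 324)) / Jq q 108"
proof -
  have n: "norm (q ^ 108) < 1" "q ^ 108 \<noteq> 0" "norm (q ^ 324) < 1" "q ^ 324 \<noteq> 0" using q by (auto intro!: norm_power_lt_1)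
  have Qp: "jtheta (q ^ (k * 2)) (q ^ 108) / jtheta (- (q ^ k)) (q ^ 108) =
     (jtheta (- (q ^ (108 + k * 3))) (q ^ 324) - q ^ k * jtheta (- (q ^ (216 + k * 3))) (q ^ 324)) / Jq q 108"
    if "k \<in> {12, 30, 42, 48}" for k
  proof -
    have "jtheta (- (q ^ k)) (q ^ 108) \<noteq> 0"
      by (rule jtheta_nonzero_power[OF q, where k = k]) (use that in auto)
    then show ?thesis
      using quintuple_product[OF n(2,1), of "q ^ k"] q by (simp add: Jq_power flip: power_mult power_add)
  qed
  have f: "jtheta (- (q ^ 198)) (q ^ 324) = jtheta (- (q ^ 126)) (q ^ 324)" "jtheta (- (q ^ 306)) (q ^ 324) = jtheta (- (q ^ 18)) (q ^ 324)"
     "jtheta (- (q ^ 234)) (q ^ 324) = jtheta (- (q ^ 90)) (q ^ 324)" "jtheta (- (q ^ 252)) (q ^ 324) = jtheta (- (q ^ 72)) (q ^ 324)"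
    using jtheta_flip[OF n(4), of "- (q ^ 126)"] jtheta_flip[OF n(4), of "- (q ^ 18)"] jtheta_flip[OF n(4), of "- (q ^ 90)"] jtheta_flip[OF n(4), of "- (q ^ 72)"] q
    by (simp_all add: power_diff[symmetric])
  have s: "q ^ 42 * jtheta (- (q ^ 342)) (q ^ 324) = q ^ 24 * jtheta (- (q ^ 18)) (q ^ 324)"
    "q ^ 48 * jtheta (- (q ^ 360)) (q ^ 324) = q ^ 12 * jtheta (- (q ^ 36)) (q ^ 324)"
  proof -
    have "q ^ 324 * - (q ^ 18) = - (q ^ 342)" "q ^ 324 * - (q ^ 36) = - (q ^ 360)" by (simp_all flip: power_add)
    then have x: "jtheta (- (q ^ 342)) (q ^ 324) = jtheta (- (q ^ 18)) (q ^ 324) / q ^ 18"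
      "jtheta (- (q ^ 360)) (q ^ 324) = jtheta (- (q ^ 36)) (q ^ 324) / q ^ 36"
      using jtheta_shift[OF n(4,3), of "- (q ^ 18)"] jtheta_shift[OF n(4,3), of "- (q ^ 36)"] q by simp_all
    have p: "q ^ 42 = q ^ 24 * q ^ 18" "q ^ 48 = q ^ 12 * q ^ 36" by (simp_all flip: power_add)
    have c: "a * b * (z / b) = a * z" if "b \<noteq> 0" for a b z :: complex using that by simp
    show "q ^ 42 * jtheta (- (q ^ 342)) (q ^ 324) = q ^ 24 * jtheta (- (q ^ 18)) (q ^ 324)"
      "q ^ 48 * jtheta (- (q ^ 360)) (q ^ 324) = q ^ 12 * jtheta (- (q ^ 36)) (q ^ 324)"
      unfolding x p by (rule c[OF power_not_zero[OF q(2)]])+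
  qed
  show "theta_D q = (jtheta (- (q ^ 126)) (q ^ 324) - q ^ 30 * jtheta (- (q ^ 18)) (q ^ 324)) / Jq q 108"
    using Qp[of 30] by (simp add: theta_D_def f)
  show "theta_F q = (jtheta (- (q ^ 144)) (q ^ 324) - q ^ 12 * jtheta (- (q ^ 72)) (q ^ 324)) / Jq q 108"
    using Qp[of 12] by (simp add: theta_F_def f)
  have "jtheta (q ^ 84) (q ^ 108) / jtheta (- (q ^ 42)) (q ^ 108) = (jtheta (- (q ^ 90)) (q ^ 324) - q ^ 24 * jtheta (- (q ^ 18)) (q ^ 324)) / Jq q 108"
    using Qp[of 42] by (simp add: f s)
  then show "theta_E q = (q ^ 6 * jtheta (- (q ^ 90)) (q ^ 324) - q ^ 30 * jtheta (- (q ^ 18)) (q ^ 324)) / Jq q 108"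
    by (simp add: theta_E_def right_diff_distrib flip: mult.assoc power_add)
  have "jtheta (q ^ 96) (q ^ 108) / jtheta (- (q ^ 48)) (q ^ 108) = (jtheta (- (q ^ 72)) (q ^ 324) - q ^ 12 * jtheta (- (q ^ 36)) (q ^ 324)) / Jq q 108"
    using Qp[of 48] by (simp add: f s)
  then show "theta_G q = (q ^ 12 * jtheta (- (q ^ 72)) (q ^ 324) - q ^ 24 * jtheta (- (q ^ 36)) (q ^ 324)) / Jq q 108"
    by (simp add: theta_G_def right_diff_distrib flip: mult.assoc power_add)
qed

context cube_root begin

text \<open>In a sum of two conjugate products a pair of components gets the weight 2 if its powers
  of \<open>\<omega>\<close> multiply to 1, and -1 otherwise. For instance A meets
  \<open>2 a0 - a1 - a2 = 2 (a0 - a2) - (a1 - a2)\<close>, which is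
  \<open>J_108 (2 D - E)\<close>.\<close>

lemma twisted_products:
  assumes q: "norm q < 1" "q \<noteq> 0"
  shows "jtheta (- (q * \<omega>)) (q ^ 3) * jtheta (- (\<omega> * q ^ 6)) (q ^ 36) + jtheta (- (q * \<omega> ^ 2)) (q ^ 3) * jtheta (- (\<omega> ^ 2 * q ^ 6)) (q ^ 36)
    = Jq q 108 * ((2 * theta_A q * theta_D q - theta_A q * theta_E q) - (theta_B q * theta_D q + theta_B q * theta_E q)
        + (2 * theta_C q * theta_E q - theta_C q * theta_D q))" (is ?t1)
    and "\<omega> ^ 2 * (jtheta (- (q * \<omega>)) (q ^ 3) * jtheta (- (\<omega> ^ 2 * q ^ 12)) (q ^ 36)) + \<omega> * (jtheta (- (q * \<omega> ^ 2)) (q ^ 3) * jtheta (- (\<omega> * q ^ 12)) (q ^ 36))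
    = - (Jq q 108 * ((2 * theta_A q * theta_G q + theta_A q * theta_F q) - (2 * theta_B q * theta_F q + theta_B q * theta_G q)
        - (theta_C q * theta_G q - theta_C q * theta_F q)))" (is ?t2)
proof -
  interpret s: cube_root "\<omega> ^ 2" by (rule sq)
  have J: "Jq q 108 \<noteq> 0" by (rule Jq_nonzero[OF q(1)]) simp
  define A B C where "A = theta_A q" and "B = theta_B q" and "C = theta_C q"
  define a0 a1 a2 where "a0 = jtheta (- (q ^ 126)) (q ^ 324)" and "a1 = q ^ 6 * jtheta (- (q ^ 90)) (q ^ 324)" and "a2 = q ^ 30 * jtheta (- (q ^ 18)) (q ^ 324)"
  define b0 b1 b2 where "b0 = jtheta (- (q ^ 144)) (q ^ 324)" and "b1 = q ^ 12 * jtheta (- (q ^ 72)) (q ^ 324)" and "b2 = q ^ 24 * jtheta (- (q ^ 36)) (q ^ 324)"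
  have w4: "(\<omega> ^ 2) ^ 2 = \<omega>" using quad by algebra
  have D: "a0 - a2 = Jq q 108 * theta_D q" "a1 - a2 = Jq q 108 * theta_E q" "b0 - b1 = Jq q 108 * theta_F q" "b1 - b2 = Jq q 108 * theta_G q"
    unfolding theta_DEFG[OF q] a0_def a1_def a2_def b0_def b1_def b2_def using J by simp_all
  show ?t1
    unfolding jtheta_third_twisted[OF q] s.jtheta_third_twisted[OF q] jtheta_sixth_twisted[OF q] s.jtheta_sixth_twisted[OF q] w4
      A_def[symmetric] B_def[symmetric] C_def[symmetric] a0_def[symmetric] a1_def[symmetric] a2_def[symmetric]
    using quad D(1,2) by algebra
  show ?t2
    unfolding jtheta_third_twisted[OF q] s.jtheta_third_twisted[OF q] jtheta_twelfth_twisted[OF q] s.jtheta_twelfth_twisted[OF q] w4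
      A_def[symmetric] B_def[symmetric] C_def[symmetric] b0_def[symmetric] b1_def[symmetric] b2_def[symmetric]
    using quad D(3,4) by algebra
qed

text \<open>Numerator and denominator are multiplied by the rotated denominators;
  \<open>jtheta_cube\<close> then makes the new denominator depend on
  \<open>Y ^ 3 = \<omega>\<close> only, and it is the same for all three \<open>Y\<close>.\<close>

lemma theta_quotient_numerator:
  assumes q: "norm q < 1" "q \<noteq> 0" and Y: "Y ^ 3 = \<omega>"
  shows "jtheta (- Y) q / (jtheta Y q * jtheta (- (q * Y ^ 2)) (q ^ 2)) =
    (jtheta (- Y) q * (jtheta (\<omega> * Y) q * jtheta (\<omega> ^ 2 * Y) q)) * (jtheta (- (\<omega> * (q * Y ^ 2))) (q ^ 2) * jtheta (- (\<omega> ^ 2 * (q * Y ^ 2))) (q ^ 2))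
    / ((1 - \<omega>) * (Jq q 9 * Jq q 1 ^ 3 / Jq q 3 * (Jq q 3 * Jq q 12 * Jq q 18 ^ 2 / (Jq q 6 * Jq q 9 * Jq q 36) * Jq q 2 ^ 3 / Jq q 6)))"
proof -
  interpret s: cube_root "\<omega> ^ 2" by (rule sq)
  note J = Jq_nonzero[OF q(1)]
  have n: "norm (q ^ 2) < 1" "q ^ 2 \<noteq> 0" "norm (q ^ 3) < 1" "q ^ 3 \<noteq> 0" using q by (auto intro!: norm_power_lt_1)
  have Y0: "Y \<noteq> 0" using Y nz by auto
  define N where "N = Jq q 3 * Jq q 12 * Jq q 18 ^ 2 / (Jq q 6 * Jq q 9 * Jq q 36)"
  define a a' where "a = jtheta Y q" and "a' = jtheta (\<omega> * Y) q * jtheta (\<omega> ^ 2 * Y) q"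
  define d d' where "d = jtheta (- (q * Y ^ 2)) (q ^ 2)" and "d' = jtheta (- (\<omega> * (q * Y ^ 2))) (q ^ 2) * jtheta (- (\<omega> ^ 2 * (q * Y ^ 2))) (q ^ 2)"
  have "a * a' * Jq q 3 = (1 - \<omega>) * Jq q 9 * Jq q 1 ^ 3"
    using jtheta_cube[OF q(1) Y0] jtheta_omega[OF n(3)] unfolding Y a_def a'_def Jq_power by (simp add: mult.assoc)
  then have A: "a * a' = (1 - \<omega>) * (Jq q 9 * Jq q 1 ^ 3 / Jq q 3)" using J by (simp add: field_simps)
  have "(- (q * Y ^ 2)) ^ 3 = - (q ^ 3 * (Y ^ 3) ^ 2)" by (simp add: power_mult_distrib flip: power_mult)
  then have x: "(- (q * Y ^ 2)) ^ 3 = - (\<omega> ^ 2 * q ^ 3)" unfolding Y by simp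
  have e: "(q ^ 2) ^ 3 = (q ^ 3) ^ 2" by (simp flip: power_mult)
  have "jtheta (- (\<omega> ^ 2 * q ^ 3)) ((q ^ 2) ^ 3) = N"
    unfolding e using s.jtheta_minus_omega_half[OF n(3,4)] by (simp add: N_def Jq_power)
  then have "d * d' * Jq q 6 = N * Jq q 2 ^ 3"
    using jtheta_cube[OF n(1), of "- (q * Y ^ 2)"] q Y0 unfolding x d_def d'_def Jq_power by (simp add: mult.assoc)
  then have D: "d * d' = N * Jq q 2 ^ 3 / Jq q 6" using J by (simp add: field_simps)
  have ne: "N \<noteq> 0" "1 - \<omega> \<noteq> 0" using J ne1 by (simp_all add: N_def)
  have "a * a' \<noteq> 0" "d * d' \<noteq> 0" unfolding A D using J ne by simp_all
  then have nz': "a \<noteq> 0" "a' \<noteq> 0" "d \<noteq> 0" "d' \<noteq> 0" by auto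
  have "jtheta (- Y) q / (a * d) = jtheta (- Y) q * a' * d' / ((a * a') * (d * d'))"
    using nz' by (simp add: field_simps)
  then show ?thesis unfolding A D unfolding a_def a'_def d_def d'_def N_def by (simp add: mult.assoc)
qed

text \<open>Both factors of the numerator become quadratic polynomials in \<open>Y\<close> modulo
  \<open>Y ^ 3 = \<omega>\<close>, so \<open>rotation_sum\<close> gives the average. Conjugate
  products are evaluated by \<open>twisted_products\<close>, and \<open>e1\<close> to
  \<open>e4\<close> match the eta quotients.\<close>

lemma theta_quotient_average:
  assumes q: "norm q < 1" "q \<noteq> 0" and y: "y ^ 3 = \<omega>"
  defines "v \<equiv> \<lambda>Y. jtheta (- Y) q / (jtheta Y q * jtheta (- (q * Y ^ 2)) (q ^ 2))"
    and "gW \<equiv> Jq q 2 ^ 4 * Jq q 8 / (Jq q 1 * Jq q 4 ^ 3) * (1 / Jq q 1 ^ 3)"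
    and "hW \<equiv> Jq q 2 ^ 3 / (Jq q 1 * Jq q 8) * (1 / Jq q 1 ^ 3)"
    and "f \<equiv> Jq q 1 * Jq q 6 / (Jq q 2 * Jq q 3 ^ 2)"
  shows "(\<omega> ^ 2 - \<omega>) * (Jq q 2 ^ 4 / (3 * Jq q 4 ^ 2)) * (v y + v (\<omega> * y) + v (\<omega> ^ 2 * y)) =
    Jq q 3 ^ 2 * Jq q 6 ^ 2 * Jq q 36 / (Jq q 12 * Jq q 18 ^ 2) *
       (Jq q 3 ^ 3 * Jq q 12 ^ 2 * Jq q 18 ^ 2 * Jq q 72 * Jq q 108 ^ 2 /
          (Jq q 6 ^ 4 * Jq q 9 * Jq q 24 * Jq q 36 * Jq q 54 * Jq q 216) * gW
        - 2 * q ^ 2 * (Jq q 12 ^ 2 * Jq q 108 / (Jq q 6 * Jq q 24)) *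
          (((2 * theta_A q * theta_D q - theta_A q * theta_E q) - (theta_B q * theta_D q + theta_B q * theta_E q)
           + (2 * theta_C q * theta_E q - theta_C q * theta_D q)) * (gW * f))
        + q ^ 5 * (Jq q 3 ^ 3 * Jq q 18 * Jq q 24 * Jq q 36 ^ 2 * Jq q 216 /
            (Jq q 6 ^ 3 * Jq q 9 * Jq q 12 * Jq q 72 * Jq q 108)) * hW
        - 2 * q * (Jq q 24 * Jq q 108 / Jq q 12) *
          (((2 * theta_A q * theta_G q + theta_A q * theta_F q) - (2 * theta_B q * theta_F q + theta_B q * theta_G q)
           - (theta_C q * theta_G q - theta_C q * theta_F q)) * (hW * f)))"
proof -
  interpret s: cube_root "\<omega> ^ 2" by (rule sq)
  note J = Jq_nonzero[OF q(1)]
  have n: "norm (q ^ 3) < 1" "q ^ 3 \<noteq> 0" "norm (q ^ 4) < 1" "q ^ 4 \<noteq> 0" "norm (q ^ 18) < 1" "q ^ 18 \<noteq> 0" "norm (q ^ 36) < 1" "q ^ 36 \<noteq> 0"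
    using q by (auto intro!: norm_power_lt_1)
  define c0 c1 where "c0 = Jq q 2 ^ 2 * Jq q 3 ^ 3 / (Jq q 1 * Jq q 6 ^ 2)" and "c1 = 2 * Jq q 2 * Jq q 6"
  define P E where "P = Jq q 2 * Jq q 8 * Jq q 12 ^ 2 / (Jq q 4 * Jq q 6 * Jq q 24)" and "E = Jq q 4 ^ 2 * Jq q 24 / (Jq q 8 * Jq q 12)"
  define M where "M = Jq q 9 * Jq q 1 ^ 3 / Jq q 3 * (Jq q 3 * Jq q 12 * Jq q 18 ^ 2 / (Jq q 6 * Jq q 9 * Jq q 36) * Jq q 2 ^ 3 / Jq q 6)"
  define E3 E36 where "E3 = Jq q 3 ^ 2 * Jq q 18 / (Jq q 6 * Jq q 9)" and "E36 = Jq q 36 ^ 2 * Jq q 216 / (Jq q 72 * Jq q 108)"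
  define A18 where "A18 = Jq q 18 * Jq q 72 * Jq q 108 ^ 2 / (Jq q 36 * Jq q 54 * Jq q 216)"
  define Ta Tb where "Ta = jtheta (- (q * \<omega>)) (q ^ 3)" and "Tb = jtheta (- (q * \<omega> ^ 2)) (q ^ 3)"
  define X6 X6' where "X6 = jtheta (- (\<omega> * q ^ 6)) (q ^ 36)" and "X6' = jtheta (- (\<omega> ^ 2 * q ^ 6)) (q ^ 36)"
  define X12 X12' where "X12 = jtheta (- (\<omega> * q ^ 12)) (q ^ 36)" and "X12' = jtheta (- (\<omega> ^ 2 * q ^ 12)) (q ^ 36)"
  define GP HP where "GP = (2 * theta_A q * theta_D q - theta_A q * theta_E q) - (theta_B q * theta_D q + theta_B q * theta_E q)
           + (2 * theta_C q * theta_E q - theta_C q * theta_D q)"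
    and "HP = (2 * theta_A q * theta_G q + theta_A q * theta_F q) - (2 * theta_B q * theta_F q + theta_B q * theta_G q)
           - (theta_C q * theta_G q - theta_C q * theta_F q)"
  have GP: "Ta * X6 + Tb * X6' = Jq q 108 * GP" and HP: "\<omega> ^ 2 * (Ta * X12') + \<omega> * (Tb * X12) = - (Jq q 108 * HP)"
    unfolding Ta_def Tb_def X6_def X6'_def X12_def X12'_def GP_def HP_def by (rule twisted_products[OF q])+
  have w4: "\<omega> ^ 4 = \<omega>" using quad by algebra
  have minus_one: "jtheta (- \<omega>) (q ^ 36) = - (\<omega> ^ 2) * E36" "jtheta (- \<omega>) (q ^ 3) = - (\<omega> ^ 2) * E3"
    using jtheta_minus_omega[OF n(7)] jtheta_minus_omega[OF n(1)] unfolding one_plus E3_def E36_def by (simp_all add: Jq_power)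
  have half: "jtheta (- (\<omega> * q ^ 18)) (q ^ 36) = A18"
    using jtheta_minus_omega_half[OF n(5,6)] by (simp add: A18_def Jq_power flip: power_mult)
  have flip: "jtheta (- (q ^ 2 * \<omega>)) (q ^ 3) = Tb" "jtheta (- (\<omega> * q ^ 30)) (q ^ 36) = X6'" "jtheta (- (\<omega> * q ^ 24)) (q ^ 36) = X12'"
  proof -
    have "q ^ 3 / - (q ^ 2 * \<omega>) = - (q * \<omega> ^ 2)" "q ^ 36 / - (\<omega> * q ^ 30) = - (\<omega> ^ 2 * q ^ 6)" "q ^ 36 / - (\<omega> * q ^ 24) = - (\<omega> ^ 2 * q ^ 12)"
      using q nz cube by (simp_all add: divide_eq_eq mult_ac flip: power_add power_Suc mult.assoc)
    then show "jtheta (- (q ^ 2 * \<omega>)) (q ^ 3) = Tb" "jtheta (- (\<omega> * q ^ 30)) (q ^ 36) = X6'" "jtheta (- (\<omega> * q ^ 24)) (q ^ 36) = X12'"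
      using jtheta_flip[OF n(2), of "- (q ^ 2 * \<omega>)"] jtheta_flip[OF n(8), of "- (\<omega> * q ^ 30)"] jtheta_flip[OF n(8), of "- (\<omega> * q ^ 24)"] q nz
      by (simp_all add: Tb_def X6'_def X12'_def)
  qed
  have K: "jtheta (- Y) q * (jtheta (\<omega> * Y) q * jtheta (\<omega> ^ 2 * Y) q) = - (\<omega> ^ 2) * c0 * E3 + c1 * Ta * Y + c1 * Tb * Y ^ 2"
    if "Y ^ 3 = \<omega>" for Y
  proof -
    have "Y \<noteq> 0" using that nz by auto
    then show ?thesis using theta_twisted_numerator[OF q, of Y] unfolding that minus_one flip
      by (simp add: c0_def c1_def Ta_def algebra_simps)
  qed
  \<comment> \<open>Since \<open>Y ^ 4 = \<omega> * Y\<close>, a trisection in base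
    \<open>q ^ 4\<close> confines \<open>Y\<close> to the prefactors; the thetas in base
    \<open>q ^ 36\<close> depend on \<open>\<omega>\<close> and \<open>q\<close> alone.\<close>
  have L: "jtheta (- (\<omega> * (q * Y ^ 2))) (q ^ 2) * jtheta (- (\<omega> ^ 2 * (q * Y ^ 2))) (q ^ 2) =
     (P * A18 + q ^ 5 * E * E36) + (P * (q ^ 2 * \<omega> * X6') - q * E * (\<omega> ^ 2 * X12)) * Y + (P * (q ^ 2 * \<omega> * X6) - q * E * X12') * Y ^ 2"
    if Y3: "Y ^ 3 = \<omega>" for Y
  proof -
    have Y0: "Y \<noteq> 0" using that nz by auto
    have Y4: "Y ^ 4 = \<omega> * Y" using Y3 power_add[of Y 3 1] by simp
    have p: "(q ^ 4) ^ 9 = q ^ 36" "(q ^ 4) ^ 3 = q ^ 12" "(q ^ 4) ^ 6 = q ^ 24" by (simp_all flip: power_mult)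
    have c: "(- (q ^ 2 * Y ^ 4)) ^ 3 = - (\<omega> * q ^ 6)" "(- (Y ^ 4)) ^ 3 = - \<omega>"
      using Y3 cube unfolding Y4 by (simp_all add: power_mult_distrib flip: power_mult)
    have e: "q ^ 12 * - (\<omega> * q ^ 6) = - (\<omega> * q ^ 18)" "q ^ 24 * - (\<omega> * q ^ 6) = - (\<omega> * q ^ 30)" "q ^ 12 * - \<omega> = - (\<omega> * q ^ 12)" "q ^ 24 * - \<omega> = - (\<omega> * q ^ 24)"
      by (simp_all add: mult_ac flip: power_add mult.assoc)
    have sh: "jtheta (q ^ 36 * - (\<omega> * q ^ 6)) (q ^ 36) = X6 * \<omega> ^ 2 / q ^ 6" "jtheta (q ^ 36 * - \<omega>) (q ^ 36) = - (\<omega> * E36)"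
    proof -
      show "jtheta (q ^ 36 * - (\<omega> * q ^ 6)) (q ^ 36) = X6 * \<omega> ^ 2 / q ^ 6"
        using jtheta_shift[OF n(8,7), of "- (\<omega> * q ^ 6)"] q nz unfolding X6_def by (simp add: inv(3)[symmetric])
      have "jtheta (q ^ 36 * - \<omega>) (q ^ 36) = - (\<omega> ^ 2) * E36 * \<omega> ^ 2"
        using jtheta_shift[OF n(8,7), of "- \<omega>"] nz minus_one(1) by (simp add: inv(3)[symmetric])
      also have "\<dots> = - (\<omega> * E36)" using cube by algebra
      finally show "jtheta (q ^ 36 * - \<omega>) (q ^ 36) = - (\<omega> * E36)" .
    qed
    have "jtheta (- (q ^ 2 * Y ^ 4)) (q ^ 4) = A18 + q ^ 2 * Y ^ 4 * X6' + (q ^ 2 * Y ^ 4) ^ 2 * q ^ 4 * (X6 * \<omega> ^ 2 / q ^ 6)"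
      using theta_trisect[OF n(4,3), of "- (q ^ 2 * Y ^ 4)"] q Y0 unfolding c p e sh half flip by simp
    also have "(q ^ 2 * Y ^ 4) ^ 2 * q ^ 4 * (X6 * \<omega> ^ 2 / q ^ 6) = q ^ 2 * \<omega> * X6 * Y ^ 2"
      using q cube unfolding Y4 by (simp add: field_simps eval_nat_numeral)
    finally have Z1: "jtheta (- (q ^ 2 * Y ^ 4)) (q ^ 4) = A18 + q ^ 2 * \<omega> * X6' * Y + q ^ 2 * \<omega> * X6 * Y ^ 2"
      unfolding Y4 by (simp add: mult_ac)
    have "jtheta (- (Y ^ 4)) (q ^ 4) = X12 + \<omega> * Y * X12' - \<omega> ^ 3 * Y ^ 2 * q ^ 4 * E36"
      using theta_trisect[OF n(4,3), of "- (Y ^ 4)"] q Y0 nz unfolding c p e sh half flip X12_def[symmetric] unfolding Y4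
      by (simp add: power2_eq_square power3_eq_cube mult_ac)
    also have "\<dots> = (\<omega> ^ 2 * X12 * Y + X12' * Y ^ 2 - q ^ 4 * E36) * Y ^ 2"
    proof -
      have "\<omega> ^ 2 * Y * Y ^ 2 = \<omega> ^ 2 * Y ^ 3" "Y ^ 2 * Y ^ 2 = Y ^ 4" by (simp_all add: eval_nat_numeral)
      moreover have "\<omega> ^ 2 * \<omega> = 1" using cube by (simp add: eval_nat_numeral mult.assoc)
      ultimately have "\<omega> ^ 2 * Y * Y ^ 2 = 1" "Y ^ 2 * Y ^ 2 = \<omega> * Y"
        unfolding Y3 Y4 by simp_all
      then show ?thesis using cube by algebra
    qed
    finally have Z2: "jtheta (- (Y ^ 4)) (q ^ 4) / Y ^ 2 = \<omega> ^ 2 * X12 * Y + X12' * Y ^ 2 - q ^ 4 * E36" using Y0 by simp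
    show ?thesis unfolding theta_twisted_denominator[OF q Y0] Z1 Z2 P_def[symmetric] E_def[symmetric]
      by (simp add: algebra_simps eval_nat_numeral)
  qed
  have dist: "k * (a + p * b - r * c * g - s * d * h) = k * a + p * (k * b) - r * (k * c) * g - s * (k * d) * h" for k a b c d g h p r s :: complex
    by (simp add: algebra_simps)
  define k0 k1 k2 where "k0 = - (\<omega> ^ 2) * c0 * E3" and "k1 = c1 * Ta" and "k2 = c1 * Tb"
  define l0 l1 l2 where "l0 = P * A18 + q ^ 5 * E * E36" and "l1 = P * (q ^ 2 * \<omega> * X6') - q * E * (\<omega> ^ 2 * X12)" and "l2 = P * (q ^ 2 * \<omega> * X6) - q * E * X12'"
  have v: "v Y = (k0 + k1 * Y + k2 * Y ^ 2) * (l0 + l1 * Y + l2 * Y ^ 2) / ((1 - \<omega>) * M)" if "Y ^ 3 = \<omega>" for Y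
    unfolding v_def theta_quotient_numerator[OF q that] K[OF that] L[OF that] M_def k0_def k1_def k2_def l0_def l1_def l2_def ..
  have r: "(\<omega> * y) ^ 3 = \<omega>" "(\<omega> ^ 2 * y) ^ 3 = \<omega>" unfolding power_mult_distrib y cube s.cube by simp_all
  have ne: "1 - \<omega> \<noteq> 0" using ne1 by simp
  have av: "v y + v (\<omega> * y) + v (\<omega> ^ 2 * y) = 3 * (k0 * l0 + \<omega> * (k1 * l2 + k2 * l1)) / ((1 - \<omega>) * M)"
    unfolding v[OF y] v[OF r(1)] v[OF r(2)] using rotation_sum[of k0 k1 y k2 l0 l1 l2] unfolding y by (simp only: add_divide_distrib[symmetric])
  have d: "\<omega> ^ 2 - \<omega> = (1 - \<omega>) * - \<omega>" by (simp add: algebra_simps power2_eq_square)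
  have "(1 - \<omega>) * - \<omega> * (j / (3 * k)) * (3 * S / ((1 - \<omega>) * M)) = j / k / M * (- \<omega> * S)" for j k S
    using ne by simp
  then have "(\<omega> ^ 2 - \<omega>) * (Jq q 2 ^ 4 / (3 * Jq q 4 ^ 2)) * (v y + v (\<omega> * y) + v (\<omega> ^ 2 * y))
      = Jq q 2 ^ 4 / Jq q 4 ^ 2 / M * (- \<omega> * (k0 * l0 + \<omega> * (k1 * l2 + k2 * l1)))"
    unfolding av d .
  also have "- \<omega> * (k0 * l0 + \<omega> * (k1 * l2 + k2 * l1)) = c0 * E3 * (P * A18 + q ^ 5 * E * E36)
      - c1 * P * q ^ 2 * (Ta * X6 + Tb * X6') + c1 * q * E * (\<omega> ^ 2 * (Ta * X12') + \<omega> * (Tb * X12))"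
    unfolding k0_def k1_def k2_def l0_def l1_def l2_def using cube by algebra
  also have "\<dots> = c0 * E3 * P * A18 + q ^ 5 * (c0 * E3 * E * E36) - 2 * q ^ 2 * (c1 / 2 * P * Jq q 108) * GP - 2 * q * (c1 / 2 * E * Jq q 108) * HP"
    unfolding GP HP by (simp add: algebra_simps)
  finally have fin: "(\<omega> ^ 2 - \<omega>) * (Jq q 2 ^ 4 / (3 * Jq q 4 ^ 2)) * (v y + v (\<omega> * y) + v (\<omega> ^ 2 * y)) =
     Jq q 2 ^ 4 / Jq q 4 ^ 2 / M * (c0 * E3 * P * A18) + q ^ 5 * (Jq q 2 ^ 4 / Jq q 4 ^ 2 / M * (c0 * E3 * E * E36))
      - 2 * q ^ 2 * (Jq q 2 ^ 4 / Jq q 4 ^ 2 / M * (c1 / 2 * P * Jq q 108)) * GP - 2 * q * (Jq q 2 ^ 4 / Jq q 4 ^ 2 / M * (c1 / 2 * E * Jq q 108)) * HP"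
    unfolding dist .
  define c where "c = Jq q 3 ^ 2 * Jq q 6 ^ 2 * Jq q 36 / (Jq q 12 * Jq q 18 ^ 2)"
  have e1: "Jq q 2 ^ 4 / Jq q 4 ^ 2 / M * (c0 * E3 * P * A18) = c * (Jq q 3 ^ 3 * Jq q 12 ^ 2 * Jq q 18 ^ 2 * Jq q 72 * Jq q 108 ^ 2 /
          (Jq q 6 ^ 4 * Jq q 9 * Jq q 24 * Jq q 36 * Jq q 54 * Jq q 216) * gW)"
    unfolding M_def c0_def E3_def P_def A18_def c_def gW_def using J by (simp add: field_simps expand_powers)
  have e2: "Jq q 2 ^ 4 / Jq q 4 ^ 2 / M * (c0 * E3 * E * E36) = c * (Jq q 3 ^ 3 * Jq q 18 * Jq q 24 * Jq q 36 ^ 2 * Jq q 216 /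
            (Jq q 6 ^ 3 * Jq q 9 * Jq q 12 * Jq q 72 * Jq q 108) * hW)"
    unfolding M_def c0_def E3_def E_def E36_def c_def hW_def using J by (simp add: field_simps expand_powers)
  have e3: "Jq q 2 ^ 4 / Jq q 4 ^ 2 / M * (c1 / 2 * P * Jq q 108) = c * (Jq q 12 ^ 2 * Jq q 108 / (Jq q 6 * Jq q 24) * (gW * f))"
    unfolding M_def c1_def P_def c_def gW_def f_def using J by (simp add: field_simps expand_powers)
  have e4: "Jq q 2 ^ 4 / Jq q 4 ^ 2 / M * (c1 / 2 * E * Jq q 108) = c * (Jq q 24 * Jq q 108 / Jq q 12 * (hW * f))"
    unfolding M_def c1_def E_def c_def hW_def f_def using J by (simp add: field_simps expand_powers)
  have "k * (a * g) + p * (k * (b * h)) - r * (k * (d * x)) * G - s * (k * (e * z)) * H = k * (a * g - r * d * (G * x) + p * b * h - s * e * (H * z))"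
    for k a b d e g h p r s x z G H :: complex by (simp add: algebra_simps)
  then show ?thesis unfolding fin e1 e2 e3 e4 GP_def[symmetric] HP_def[symmetric] c_def[symmetric] .
qed

end

section \<open>Averaging over the cube roots of \<open>\<zeta>\<close>\<close>

lemma third_of_sum:
  fixes t a b c :: complex
  shows "t * ((1 / a + 1 / b + 1 / c) / 3) = 1 / 3 * (t / a + (t / b + t / c))"
  by (simp add: distrib_left add_divide_distrib add.assoc mult.commute)

context cube_root begin

lemma rotations:
  assumes "y ^ 3 = \<omega>"
  shows "norm y = 1" "y ^ 2 \<noteq> 1" "y \<noteq> 1" "y \<noteq> 0" "(\<omega> * y) ^ 3 = \<omega>" "(\<omega> ^ 2 * y) ^ 3 = \<omega>"
proof -
  interpret s: cube_root "\<omega> ^ 2" by (rule sq)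
  have "norm y ^ 3 = 1" using assms norm1 by (metis norm_power)
  then show "norm y = 1" using power_eq_imp_eq_base[of "norm y" 3 1] by simp
  show "y ^ 2 \<noteq> 1"
  proof
    assume "y ^ 2 = 1"
    then have "(y ^ 3) ^ 2 = 1" by (metis power_commutes power_mult power_one mult.commute)
    then show False using assms s.ne1 by simp
  qed
  then show "y \<noteq> 1" by auto
  show "y \<noteq> 0" using assms nz by auto
  show "(\<omega> * y) ^ 3 = \<omega>" "(\<omega> ^ 2 * y) ^ 3 = \<omega>" unfolding power_mult_distrib assms cube s.cube by simp_all
qed

lemma rank_series_average:
  assumes q: "norm q < 1" "q \<noteq> 0" and y: "y ^ 3 = \<omega>"
  defines "S \<equiv> \<lambda>Y. \<Sum>\<^sub>\<infinity>n. theta_term q (q ^ 2) n / (1 - q powi n * Y)"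
  shows "(\<Sum>\<^sub>\<infinity>n. theta_term q (q ^ 2) n / (1 - (q ^ 3) powi n * \<omega>)) = 1 / 3 * (S y + (S (\<omega> * y) + S (\<omega> ^ 2 * y)))"
proof -
  note r = rotations[OF y]
  define F where "F Y n = theta_term q (q ^ 2) n / (1 - q powi n * Y)" for Y n
  have n: "norm (q ^ 2) < 1" "q ^ 2 \<noteq> 0" using q by (auto intro!: norm_power_lt_1)
  have sm: "F Y summable_on UNIV" if "Y \<noteq> 0" for Y
    unfolding F_def[abs_def] by (rule summable_theta_quotient) (use q n that in auto)
  note sms = sm[OF r(4)] sm[OF rotations(4)[OF r(5)]] sm[OF rotations(4)[OF r(6)]]
  have pt: "theta_term q (q ^ 2) n / (1 - (q ^ 3) powi n * \<omega>) = 1 / 3 * (F y n + (F (\<omega> * y) n + F (\<omega> ^ 2 * y) n))" for n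
  proof -
    define Y where "Y = q powi n * y"
    have Y3: "(q ^ 3) powi n * \<omega> = Y ^ 3" by (simp add: Y_def power_mult_distrib y power_int_power power_int_power' mult.commute)
    have "1 - Y \<noteq> 0" "1 - \<omega> * Y \<noteq> 0" "1 - \<omega> ^ 2 * Y \<noteq> 0"
      using root_avoid[OF q r(1) r(3), of n] root_avoid[OF q rotations(1,3)[OF r(5)], of n] root_avoid[OF q rotations(1,3)[OF r(6)], of n]
      by (simp_all add: Y_def mult_ac)
    then have "1 / (1 - Y ^ 3) = (1 / (1 - Y) + 1 / (1 - \<omega> * Y) + 1 / (1 - \<omega> ^ 2 * Y)) / 3" by (rule cubic_partial_fractions)
    then have "theta_term q (q ^ 2) n * (1 / (1 - Y ^ 3)) = 1 / 3 * (theta_term q (q ^ 2) n / (1 - Y) + (theta_term q (q ^ 2) n / (1 - \<omega> * Y) + theta_term q (q ^ 2) n / (1 - \<omega> ^ 2 * Y)))"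
      by (simp only: third_of_sum)
    moreover have "F y n = theta_term q (q ^ 2) n / (1 - Y)" "F (\<omega> * y) n = theta_term q (q ^ 2) n / (1 - \<omega> * Y)" "F (\<omega> ^ 2 * y) n = theta_term q (q ^ 2) n / (1 - \<omega> ^ 2 * Y)"
      by (simp_all add: F_def Y_def mult_ac)
    ultimately show ?thesis unfolding Y3 by simp
  qed
  show ?thesis
    unfolding pt S_def F_def[symmetric] infsum_cmult_right' infsum_add[OF sms(1) summable_on_add[OF sms(2,3)]] infsum_add[OF sms(2,3)] ..
qed

text \<open>The denominators are \<open>1 + X Y^2\<close> with
  \<open>X = q powi (2 * r - 1)\<close>; their product over the rotations is
  \<open>1 + X^3 \<omega>^2\<close>, which explains \<open>6 * r - 3\<close> and the argument
  \<open>- (\<omega> ^ 2)\<close>.\<close>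

lemma lerch_average:
  assumes q: "norm q < 1" "q \<noteq> 0" and y: "y ^ 3 = \<omega>"
  defines "S \<equiv> \<lambda>Y. lerch (- (q * Y ^ 2)) (- 1) (q ^ 2)"
  shows "(\<Sum>\<^sub>\<infinity>r. q powi (2 * tri r) / (1 - q powi (6 * r - 3) * - (\<omega> ^ 2))) = 1 / 3 * (S y + (S (\<omega> * y) + S (\<omega> ^ 2 * y)))"
proof -
  note r = rotations[OF y]
  define F where "F Y n = theta_term (- 1) (q ^ 2) n / (1 - (q ^ 2) powi (n - 1) * - (q * Y ^ 2))" for Y n
  have n: "norm (q ^ 2) < 1" "q ^ 2 \<noteq> 0" using q by (auto intro!: norm_power_lt_1)
  have sm: "F Y summable_on UNIV" if "Y \<noteq> 0" for Y
    unfolding F_def[abs_def] by (rule summable_lerch) (use q n that in auto)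
  note sms = sm[OF r(4)] sm[OF rotations(4)[OF r(5)]] sm[OF rotations(4)[OF r(6)]]
  have pt: "q powi (2 * tri n) / (1 - q powi (6 * n - 3) * - (\<omega> ^ 2)) = 1 / 3 * (F y n + (F (\<omega> * y) n + F (\<omega> ^ 2 * y) n))" for n
  proof -
    define X where "X = q powi (2 * n - 1)"
    define Y where "Y = - (X * y ^ 2)"
    have "2 * n - 1 = 2 * (n - 1) + 1" by simp
    then have "X = q powi (2 * (n - 1)) * q" unfolding X_def using q by (simp only: power_int_add power_int_1_right simp_thms)
    then have X: "(q ^ 2) powi (n - 1) * - (q * Z ^ 2) = - (X * Z ^ 2)" for Z by (simp add: power_int_power)
    have "Y ^ 3 = - (X ^ 3 * (y ^ 3) ^ 2)" by (simp add: Y_def power_mult_distrib flip: power_mult)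
    also have "X ^ 3 = q powi (6 * n - 3)" by (simp add: X_def power_int_power' algebra_simps)
    finally have Y3: "q powi (6 * n - 3) * - (\<omega> ^ 2) = Y ^ 3" unfolding y by simp
    have t: "theta_term (- 1) (q ^ 2) n = q powi (2 * tri n)" by (simp add: theta_term_minus_power_base)
    have nX: "norm X \<noteq> 1" unfolding X_def by (rule norm_powi_ne_1[OF q]) presburger
    have ne: "1 - z * Y \<noteq> 0" if "norm z = 1" for z
    proof
      assume "1 - z * Y = 0"
      then have "norm (z * Y) = 1" by (metis eq_iff_diff_eq_0 norm_one)
      then show False using nX that r(1) by (simp add: Y_def norm_mult norm_power)
    qed
    have "1 - Y \<noteq> 0" "1 - \<omega> * Y \<noteq> 0" "1 - \<omega> ^ 2 * Y \<noteq> 0"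
      using ne[of 1] ne[of \<omega>] ne[of "\<omega> ^ 2"] norm1 by (simp_all add: norm_power)
    then have "1 / (1 - Y ^ 3) = (1 / (1 - Y) + 1 / (1 - \<omega> * Y) + 1 / (1 - \<omega> ^ 2 * Y)) / 3" by (rule cubic_partial_fractions)
    \<comment> \<open>Rotating \<open>y\<close> by \<open>\<omega>\<close> rotates
      \<open>y ^ 2\<close> by \<open>\<omega> ^ 2\<close>, so the last two fractions trade
      places.\<close>
    then have "1 / (1 - Y ^ 3) = (1 / (1 - Y) + 1 / (1 - \<omega> ^ 2 * Y) + 1 / (1 - \<omega> * Y)) / 3" by (simp add: add_ac)
    then have "theta_term (- 1) (q ^ 2) n * (1 / (1 - Y ^ 3)) = 1 / 3 * (theta_term (- 1) (q ^ 2) n / (1 - Y) + (theta_term (- 1) (q ^ 2) n / (1 - \<omega> ^ 2 * Y) + theta_term (- 1) (q ^ 2) n / (1 - \<omega> * Y)))"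
      by (simp only: third_of_sum)
    moreover have "- (X * (\<omega> * y) ^ 2) = \<omega> ^ 2 * Y" "- (X * (\<omega> ^ 2 * y) ^ 2) = \<omega> * Y"
    proof -
      have "(\<omega> ^ 2) ^ 2 = \<omega>" using quad by algebra
      then show "- (X * (\<omega> * y) ^ 2) = \<omega> ^ 2 * Y" "- (X * (\<omega> ^ 2 * y) ^ 2) = \<omega> * Y"
        unfolding power_mult_distrib Y_def by simp_all
    qed
    ultimately show ?thesis unfolding F_def X Y3 Y_def[symmetric] unfolding t by simp
  qed
  show ?thesis
    unfolding pt S_def lerch_def F_def[symmetric] infsum_cmult_right' infsum_add[OF sms(1) summable_on_add[OF sms(2,3)]] infsum_add[OF sms(2,3)] ..
qed

text \<open>The factor \<open>J_1 ^ 2 / J_2\<close> from \<open>rank_series_theta\<close> cancels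
  the prefactor of \<open>O3\<close>, and the subtracted theta series turns into the constant
  -1.\<close>

lemma O3_split:
  assumes q: "norm q < 1" "q \<noteq> 0" and y: "y ^ 3 = \<omega>"
  defines "v \<equiv> \<lambda>Y. jtheta (- Y) q / (jtheta Y q * jtheta (- (q * Y ^ 2)) (q ^ 2))"
  shows "O3 \<omega> q = (\<omega> ^ 2 - \<omega>) * (Jq q 2 / Jq q 4 ^ 2 * (\<Sum>\<^sub>\<infinity>r. q powi (2 * tri r) / (1 - q powi (6 * r - 3) * - (\<omega> ^ 2))) - 1)
    + (\<omega> ^ 2 - \<omega>) * (Jq q 2 ^ 4 / (3 * Jq q 4 ^ 2)) * (v y + v (\<omega> * y) + v (\<omega> ^ 2 * y))"
proof -
  note r = rotations[OF y] and J = Jq_nonzero[OF q(1)]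
  define l where "l Y = lerch (- (q * Y ^ 2)) (- 1) (q ^ 2)" for Y
  define a b where "a = Jq q 1 ^ 2 / Jq q 2" and "b = Jq q 2 ^ 4 / (2 * Jq q 4 ^ 2)"
  define h where "h = jtheta (- 1) (q ^ 2)"
  have "norm (q ^ 2) < 1" using q by (auto intro!: norm_power_lt_1)
  then have h: "h = 2 * (Jq q 4 ^ 2 / Jq q 2)" using jtheta_minus_1[of "q ^ 2"] by (simp add: h_def Jq_power)
  have S: "(\<Sum>\<^sub>\<infinity>n. theta_term q (q ^ 2) n / (1 - q powi n * Y)) = a * (l Y / h + b * v Y)" if "Y ^ 3 = \<omega>" for Y
    unfolding rank_series_theta[OF q rotations(1,2)[OF that]] l_def a_def b_def h_def v_def ..
  have nz: "a \<noteq> 0" "h \<noteq> 0" unfolding a_def h using J by simp_all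
  have c: "Jq q 2 / Jq q 1 ^ 2 = 1 / a" "Jq q 2 / Jq q 4 ^ 2 = 2 / h" "Jq q 2 ^ 4 / (3 * Jq q 4 ^ 2) = 2 / 3 * b"
    unfolding a_def b_def h by simp_all
  have "1 / a * (d * (2 * (1 / 3 * (a * (l0 / h + b * v0) + (a * (l1 / h + b * v1) + a * (l2 / h + b * v2)))) - a))
     = d * (2 / h * (1 / 3 * (l0 + (l1 + l2))) - 1) + d * (2 / 3 * b) * (v0 + v1 + v2)" for d l0 l1 l2 v0 v1 v2
    using nz by (simp add: field_simps)
  then show ?thesis
    unfolding O3_bilateral[OF q] rank_series_average[OF q y] S[OF y] S[OF r(5)] S[OF r(6)] lerch_average[OF q y] l_def[symmetric] a_def[symmetric] c .
qed

end

section \<open>Recombining the residue classes\<close>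

text \<open>\<open>calB_term\<close> refers to the classes \<open>N + 1\<close> and
  \<open>N + 2\<close>, which leave the range 0, 1, 2.\<close>

lemma idx_period: "idx2 (N + 3) = idx2 N" "idx3 (N + 3) = idx3 N"
  by (simp_all add: idx2_def idx3_def cong_def)

text \<open>The three classes partition all pairs of indices, so their sums add up to the product of
  the two dissected functions.\<close>

lemma sum_idx2:
  fixes a b :: "nat \<Rightarrow> complex"
  shows "(\<Sum>(k, l)\<in>idx2 0. q ^ (k + l) * a k * b l) + (\<Sum>(k, l)\<in>idx2 1. q ^ (k + l) * a k * b l) + (\<Sum>(k, l)\<in>idx2 2. q ^ (k + l) * a k * b l)
    = (a 0 + q * a 1 + q ^ 2 * a 2) * (b 0 + q * b 1 + q ^ 2 * b 2)"
proof -
  define A :: "nat set" where "A = {0, 1, 2}"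
  define f where "f = (\<lambda>(k, l). q ^ (k + l) * a k * b l)"
  have i: "idx2 N = {p \<in> A \<times> A. (\<lambda>(k, l). int (k + l) mod 3) p = N}" if "N \<in> {0, 1, 2}" for N
    using that by (auto simp: idx2_def A_def cong_def)
  have "(\<Sum>N\<in>{0, 1, 2}. sum f {p \<in> A \<times> A. (\<lambda>(k, l). int (k + l) mod 3) p = N}) = sum f (A \<times> A)"
    by (rule sum.group) (auto simp: A_def)
  then have "sum f (idx2 0) + sum f (idx2 1) + sum f (idx2 2) = sum f (A \<times> A)"
    by (simp add: i add.assoc)
  also have "\<dots> = (\<Sum>k\<in>A. \<Sum>l\<in>A. q ^ (k + l) * a k * b l)" by (simp add: f_def sum.cartesian_product)
  also have "\<dots> = (a 0 + q * a 1 + q ^ 2 * a 2) * (b 0 + q * b 1 + q ^ 2 * b 2)"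
    by (simp add: A_def algebra_simps eval_nat_numeral)
  finally show ?thesis unfolding f_def .
qed

lemma sum_idx3:
  fixes a b c :: "nat \<Rightarrow> complex"
  shows "(\<Sum>(k, l, m)\<in>idx3 0. q ^ (k + l + m) * a k * b l * c m) + (\<Sum>(k, l, m)\<in>idx3 1. q ^ (k + l + m) * a k * b l * c m)
      + (\<Sum>(k, l, m)\<in>idx3 2. q ^ (k + l + m) * a k * b l * c m)
    = (a 0 + q * a 1 + q ^ 2 * a 2) * (b 0 + q * b 1 + q ^ 2 * b 2) * (c 0 + q * c 1 + q ^ 2 * c 2)"
proof -
  define A :: "nat set" where "A = {0, 1, 2}"
  define f where "f = (\<lambda>(k, l, m). q ^ (k + l + m) * a k * b l * c m)"
  have i: "idx3 N = {p \<in> A \<times> A \<times> A. (\<lambda>(k, l, m). int (k + l + m) mod 3) p = N}" if "N \<in> {0, 1, 2}" for N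
    using that by (auto simp: idx3_def A_def cong_def)
  have "(\<Sum>N\<in>{0, 1, 2}. sum f {p \<in> A \<times> A \<times> A. (\<lambda>(k, l, m). int (k + l + m) mod 3) p = N}) = sum f (A \<times> A \<times> A)"
    by (rule sum.group) (auto simp: A_def)
  then have "sum f (idx3 0) + sum f (idx3 1) + sum f (idx3 2) = sum f (A \<times> A \<times> A)"
    by (simp add: i add.assoc)
  also have "\<dots> = (\<Sum>k\<in>A. \<Sum>l\<in>A. \<Sum>m\<in>A. q ^ (k + l + m) * a k * b l * c m)" by (simp add: f_def sum.cartesian_product)
  also have "\<dots> = (\<Sum>k\<in>A. \<Sum>l\<in>A. \<Sum>m\<in>A. (q ^ k * a k) * ((q ^ l * b l) * (q ^ m * c m)))"
    by (simp add: power_add mult_ac)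
  also have "\<dots> = (\<Sum>k\<in>A. q ^ k * a k) * ((\<Sum>l\<in>A. q ^ l * b l) * (\<Sum>m\<in>A. q ^ m * c m))"
    by (simp only: sum_distrib_left[symmetric] sum_distrib_right[symmetric])
  also have "\<dots> = (a 0 + q * a 1 + q ^ 2 * a 2) * (b 0 + q * b 1 + q ^ 2 * b 2) * (c 0 + q * c 1 + q ^ 2 * c 2)"
    by (simp add: A_def add.assoc mult.assoc)
  finally show ?thesis unfolding f_def .
qed

text \<open>A shift of the class by 1 or 2 only permutes the three residues. Summed over
  \<open>N\<close>, every coefficient therefore multiplies the same complete sum, which the five
  dissections evaluate.\<close>

lemma (in cube_root) calB_term_sum:
  assumes q: "norm q < 1" "q \<noteq> 0"
  defines "gW \<equiv> Jq q 2 ^ 4 * Jq q 8 / (Jq q 1 * Jq q 4 ^ 3) * (1 / Jq q 1 ^ 3)"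
    and "hW \<equiv> Jq q 2 ^ 3 / (Jq q 1 * Jq q 8) * (1 / Jq q 1 ^ 3)"
    and "f \<equiv> Jq q 1 * Jq q 6 / (Jq q 2 * Jq q 3 ^ 2)"
  shows "calB_term q 0 + calB_term q 1 + calB_term q 2 =
    3 * q ^ 3 * (Jq q 6 ^ 3 * Jq q 9 * Jq q 108 / (Jq q 3 * Jq q 18 * Jq q 36)) * (Jq q 2 / Jq q 4 ^ 2)
    + Jq q 3 ^ 2 * Jq q 6 ^ 2 * Jq q 36 / (Jq q 12 * Jq q 18 ^ 2) *
       (Jq q 3 ^ 3 * Jq q 12 ^ 2 * Jq q 18 ^ 2 * Jq q 72 * Jq q 108 ^ 2 /
          (Jq q 6 ^ 4 * Jq q 9 * Jq q 24 * Jq q 36 * Jq q 54 * Jq q 216) * gW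
        - 2 * q ^ 2 * (Jq q 12 ^ 2 * Jq q 108 / (Jq q 6 * Jq q 24)) *
          (((2 * theta_A q * theta_D q - theta_A q * theta_E q) - (theta_B q * theta_D q + theta_B q * theta_E q)
           + (2 * theta_C q * theta_E q - theta_C q * theta_D q)) * (gW * f))
        + q ^ 5 * (Jq q 3 ^ 3 * Jq q 18 * Jq q 24 * Jq q 36 ^ 2 * Jq q 216 /
            (Jq q 6 ^ 3 * Jq q 9 * Jq q 12 * Jq q 72 * Jq q 108)) * hW
        - 2 * q * (Jq q 24 * Jq q 108 / Jq q 12) *
          (((2 * theta_A q * theta_G q + theta_A q * theta_F q) - (2 * theta_B q * theta_F q + theta_B q * theta_G q)
           - (theta_C q * theta_G q - theta_C q * theta_F q)) * (hW * f)))"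
proof -
  define s where "s N = (\<Sum>(k, l)\<in>idx2 N. q ^ (k + l) * gq (q ^ 3) k * Wq (q ^ 3) l)" for N
  define t where "t N = (\<Sum>(k, l)\<in>idx2 N. q ^ (k + l) * hq (q ^ 3) k * Wq (q ^ 3) l)" for N
  have s: "s 0 + s 1 + s 2 = gW" and t: "t 0 + t 1 + t 2 = hW"
    unfolding s_def t_def sum_idx2 g_sum[OF q] h_sum[OF q] W_sum[OF q] gW_def hW_def by simp_all
  have G: "calG q 0 + calG q 1 + calG q 2 = gW * f" and H: "calH q 0 + calH q 1 + calH q 2 = hW * f"
    unfolding calG_def calH_def sum_idx3 g_sum[OF q] h_sum[OF q] W_sum[OF q] f_sum[OF q] gW_def hW_def f_def by simp_all
  have per: "t 3 = t 0" "calG q 3 = calG q 0" "calG q 4 = calG q 1" "calH q 3 = calH q 0" "calH q 4 = calH q 1"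
    using idx_period[of 0] idx_period[of 1] by (simp_all add: t_def calG_def calH_def)
  define X where "X = 3 * q ^ 3 * (Jq q 6 ^ 3 * Jq q 9 * Jq q 108 / (Jq q 3 * Jq q 18 * Jq q 36))"
  define C where "C = Jq q 3 ^ 2 * Jq q 6 ^ 2 * Jq q 36 / (Jq q 12 * Jq q 18 ^ 2)"
  define Y where "Y = Jq q 3 ^ 3 * Jq q 12 ^ 2 * Jq q 18 ^ 2 * Jq q 72 * Jq q 108 ^ 2 / (Jq q 6 ^ 4 * Jq q 9 * Jq q 24 * Jq q 36 * Jq q 54 * Jq q 216)"
  define z where "z = 2 * q ^ 2 * (Jq q 12 ^ 2 * Jq q 108 / (Jq q 6 * Jq q 24))"
  define p where "p = q ^ 5 * (Jq q 3 ^ 3 * Jq q 18 * Jq q 24 * Jq q 36 ^ 2 * Jq q 216 / (Jq q 6 ^ 3 * Jq q 9 * Jq q 12 * Jq q 72 * Jq q 108))"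
  define u where "u = 2 * q * (Jq q 24 * Jq q 108 / Jq q 12)"
  define a b d where "a = 2 * theta_A q * theta_D q - theta_A q * theta_E q" and "b = theta_B q * theta_D q + theta_B q * theta_E q"
    and "d = 2 * theta_C q * theta_E q - theta_C q * theta_D q"
  define a' b' d' where "a' = 2 * theta_A q * theta_G q + theta_A q * theta_F q" and "b' = 2 * theta_B q * theta_F q + theta_B q * theta_G q"
    and "d' = theta_C q * theta_G q - theta_C q * theta_F q"
  have B: "calB_term q N = X * q ^ N * Iq (q ^ 3) N + C * (Y * s (int N) - z * (a * calG q (int N + 1) - b * calG q (int N) + d * calG q (int N + 2))
     + p * t (int N + 1) - u * (a' * calH q (int N + 2) - b' * calH q (int N + 1) - d' * calH q (int N)))" for N
    unfolding calB_term_def X_def C_def Y_def z_def p_def u_def a_def b_def d_def a'_def b'_def d'_def s_def t_def ..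
  have "calB_term q 0 + calB_term q 1 + calB_term q 2 = X * (Iq (q ^ 3) 0 + q * Iq (q ^ 3) 1 + q ^ 2 * Iq (q ^ 3) 2)
     + C * (Y * (s 0 + s 1 + s 2) - z * ((a - b + d) * (calG q 0 + calG q 1 + calG q 2)) + p * (t 0 + t 1 + t 2)
       - u * ((a' - b' - d') * (calH q 0 + calH q 1 + calH q 2)))"
    unfolding B by (simp add: per algebra_simps)
  then show ?thesis
    unfolding s t G H I_sum[OF q] unfolding X_def C_def Y_def z_def p_def u_def a_def b_def d_def a'_def b'_def d'_def .
qed

theorem theorem5p1:
  fixes q \<zeta> :: complex
  assumes "q \<noteq> 0" and "norm q < 1"
    and "primitive_root_of_unity 3 \<zeta>"
  shows "O3 \<zeta> q = calB0_bar_cubed q + q * calB_cubed q 1 + q ^ 2 * calB_cubed q 2"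
proof -
  note q = assms(2,1)
  have "\<zeta> ^ 3 = 1" "\<zeta> ^ 1 \<noteq> 1"
    using assms(3) unfolding primitive_root_of_unity_def by (blast, metis one_less_numeral_iff semiring_norm(77) zero_less_one)
  then interpret cube_root \<zeta> by unfold_locales simp_all
  define y where "y = exp (Ln \<zeta> / 3)"
  have y: "y ^ 3 = \<zeta>" using nz by (simp add: y_def flip: exp_of_nat_mult)
  \<comment> \<open>\<open>first_trisection\<close> leaves a Lerch sum in base
    \<open>q ^ 18\<close>, so \<open>second_trisection\<close> is applied at
    \<open>p = q ^ 9\<close>.\<close>
  have p: "norm (q ^ 9) < 1" "q ^ 9 \<noteq> 0" using q by (auto intro!: norm_power_lt_1)
  have pw: "(q ^ 9) ^ 2 = q ^ 18" "(q ^ 9) ^ 3 = q ^ 27" "(q ^ 9) ^ 4 = q ^ 36" "(q ^ 9) ^ 9 = q ^ 81" "(q ^ 9) ^ 18 = q ^ 162"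
    by (simp_all flip: power_mult)
  have inv: "q powi (- 36) = 1 / q ^ 36" "q powi (- 27) = 1 / q ^ 27" "q powi (- 9) = 1 / q ^ 9"
    by (simp_all add: power_int_minus divide_inverse)
  have "O3 \<zeta> q = 6 / q ^ 36 * appell_m (1 / q ^ 27) (q ^ 162) (- 1)
      - 3 / 2 / q ^ 9 * (Jq q 18 * Jq q 27 * Jq q 108 * Jq q 162 ^ 5 / (Jq q 36 ^ 2 * Jq q 54 * Jq q 81 * Jq q 324 ^ 3)) *
       (jtheta (q ^ 27) (q ^ 162) / jtheta (- (q ^ 27)) (q ^ 162) + jtheta (q ^ 81) (q ^ 162) / jtheta (- (q ^ 81)) (q ^ 162))
      + (calB_term q 0 + calB_term q 1 + calB_term q 2)"
    unfolding O3_split[OF q y] first_trisection[OF q] theta_quotient_average[OF q y] calB_term_sum[OF q]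
    using second_trisection[OF p] unfolding pw Jq_power by simp
  moreover have "calB_cubed q 0 = calB_term q 0" "q * calB_cubed q 1 = calB_term q 1" "q ^ 2 * calB_cubed q 2 = calB_term q 2"
    using q by (simp_all add: calB_cubed_def)
  ultimately show ?thesis unfolding calB0_bar_cubed_def inv by simp
qed

end
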